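(* Consider the controlled system $dx(t)=b(t,x(t),u_t)\,dt+\sigma(t,x(t),u_t)\,dW(t)$, $x(0)=x_0$, $t\in I=[0,T]$, with cost functional $J(u)=\mathcal E\{\int_0^T\ell(t,x(t),u_t)\,dt+\Phi(x(T))\}$, under the standing assumptions listed in the context, with controls $u\in\mathcal U_{ad}$ which are $\mathcal G_t$-adapted. Let $u^o\in\mathcal U_{ad}$ and let $(x^o,\psi,Q)$, with $x^o\in B_\infty^a(I,L_2(\Omega,\mathbb R^n))$ and $(\psi,Q)\in L_2^a(I,\mathbb R^n)\times L_2^a(I,\mathcal L(\mathbb R^m,\mathbb R^n))$, satisfy the Hamiltonian system $$dx^o(t)=H_\psi(t,x^o(t),\psi(t),Q(t),u^o_t)\,dt+\sigma(t,x^o(t),u^o_t)\,dW(t),\quad x^o(0)=x_0,$$ $$d\psi(t)=-H_x(t,x^o(t),\psi(t),Q(t),u^o_t)\,dt+Q(t)\,dW(t),\quad \psi(T)=\Phi_x(x^o(T)).$$ Then the inequality $$\mathcal E\int_0^TH(t,x^o(t),\psi(t),Q(t),u_t)\,dt\ \ge\ \mathcal E\int_0^TH(t,x^o(t),\psi(t),Q(t),u^o_t)\,dt\quad\text{for all }u\in\mathcal U_{ad}$$ is equivalent to the pointwise almost sure inequality $$\mathcal E\{H(t,x^o(t),\psi(t),Q(t),\mu)\mid\mathcal G_t\}\ \ge\ \mathcal E\{H(t,x^o(t),\psi(t),Q(t),u^o_t)\mid\mathcal G_t\}$$ for all $\mu\in\mathcal M_1(U)$, a.e. $t\in[0,T]$,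 $P$-a.s.
   Context: $(\Omega,\mathcal F,\{\mathcal F_t\}_{t\ge0},P)$ is a complete filtered probability space with $\{\mathcal F_t\}$ increasing; $\mathcal E$ denotes expectation; $W$ is an $\mathbb R^m$-valued standard Brownian motion on this filtered space with $W(0)=0$ a.s. $\mathcal G_t\subset\mathcal F_t$, $t\ge0$, is a family of sub-$\sigma$-algebras (partial information). $I=[0,T]$ is finite, $U\subset\mathbb R^d$ is closed and bounded, $\mathcal M(U)$ is the space of regular bounded signed Borel measures on $U$, $\mathcal M_1(U)$ the set of regular probability measures. $L_1^a(I,C(U))$ is the $L_1$-space (over $I\times\Omega$) of $\mathcal G_t$-adapted $C(U)$-valued processes; its dual $L_\infty^a(I,\mathcal M(U))$ consists of weak-star measurable, $\mathcal G_t$-adapted, essentially bounded $\mathcal M(U)$-valued processes; $\mathcal U_{ad}=L_\infty^a(I,\mathcal M_1(U))$ is the subset of $\mathcal M_1(U)$-valued ones (relaxed controls). For a (signed) measure $\nu$ on $U$, $b(t,x,\nu):=\int_Ub(t,x,\xi)\nu(d\xi)$, and similarly for $\sigma,\ell$ and their $x$-derivatives. $(\cdot,\cdot)$ is the Euclidean inner product and $*$ denotes transpose. Hamiltonian: $H:I\times\mathbb R^n\times\mathbb R^n\times\mathcal L(\mathbb R^m,\mathbb R^n)\times\mathcal M_1(U)\to\mathbb R$, $$H(t,x,\psi,Q,\nu)=(b(t,x,\nu),\psi)+\mathrm{tr}(Q^*\sigma(t,x,\nu))+\ell(t,x,\nu);$$ $H_x,H_\psi$ denote gradients in $x$ and $\psi$.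 Thus $H_\psi=b(t,x,\nu)$ and $H_x=b_x^*(t,x,\nu)\psi+V+\ell_x(t,x,\nu)$ with $(V,\zeta)=\mathrm{tr}(Q^*\sigma_x(t,x,\nu;\zeta))$ for $\zeta\in\mathbb R^n$, where $\sigma_x(t,x,\nu;\zeta)$ is the derivative of $\sigma(t,\cdot,\nu)$ at $x$ in direction $\zeta$. $B_\infty^a(I,L_2(\Omega,\mathbb R^n))$: $\mathcal F_t$-adapted $\mathbb R^n$-valued processes with finite norm $\|x\|^2=\sup_{t\in I}\mathcal E|x(t)|^2$. $L_2^a(I,\mathbb R^n)$ and $L_2^a(I,\mathcal L(\mathbb R^m,\mathbb R^n))$: $\mathcal F_t$-adapted processes in $L_2(I\times\Omega)$ with values in the indicated spaces. Standing assumptions. $x_0$ is $\mathcal F_0$-measurable with finite second moment; $b:I\times\mathbb R^n\times\mathbb R^d\to\mathbb R^n$, $\sigma:I\times\mathbb R^n\times\mathbb R^d\to\mathcal L(\mathbb R^m,\mathbb R^n)$, $\ell:I\times\mathbb R^n\times U\to(-\infty,\infty]$, $\Phi:\mathbb R^n\to(-\infty,\infty]$ are Borel measurable. For some nonnegative $K\in L_2(I)$, uniformly in $\xi\in U$: (A1) $|b(t,x,\xi)-b(t,y,\xi)|\le K(t)|x-y|$; (A2) $|b(t,x,\xi)|\le K(t)(1+|x|)$; (A3) $|\sigma(t,x,\xi)-\sigma(t,y,\xi)|\le K(t)|x-y|$; (A4) $|\sigma(t,x,\xi)|\le K(t)(1+|x|)$; (A5) $b(t,x,\cdot),\sigma(t,x,\cdot)$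 are continuous in $\xi\in U$ uniformly in $t\in I,x\in\mathbb R^n$. (a1) $x\mapsto\ell(t,x,\xi)$ is continuous for each $t$, uniformly in $\xi\in U$; (a2) $|\ell(t,x,\xi)|\le h(t)(1+|x|^2)$ for some nonnegative $h\in L_1(I)$; (a3) $\Phi$ is lower semicontinuous and $|\Phi(x)|\le c_0+c_1|x|^2$ for some $c_0,c_1\ge0$. (NC1) $b,\sigma,\ell$ are measurable in $t\in I$; $b,\sigma,\ell,\Phi$ are once continuously differentiable in $x\in\mathbb R^n$; the first $x$-derivatives of $b,\sigma$ are bounded uniformly on $I\times\mathbb R^n\times U$.
   Formalization: Added: P(A|G_t) has a jointly measurable, G_t-adapted version for every event A (true if G_t is increasing); for arbitrary families G_t the equivalence fails. The null set of times t in the pointwise inequality does not depend on μ, as otherwise the equivalence also fails. *)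

theory Defs
  imports "HOL-Probability.Probability"
begin

section \<open>Processes on \<open>[0, T] \<times> \<Omega>\<close>\<close>

abbreviation time_prod :: "real \<Rightarrow> 'w measure \<Rightarrow> (real \<times> 'w) measure" where
  "time_prod T M \<equiv> restrict_space lborel {0..T} \<Otimes>\<^sub>M M"

definition adapted_process ::
  "'w measure \<Rightarrow> (real \<Rightarrow> 'w measure) \<Rightarrow> real \<Rightarrow> (real \<Rightarrow> 'w \<Rightarrow> 'a::topological_space) \<Rightarrow> bool" where
  "adapted_process M F T X \<longleftrightarrow>
     (\<lambda>(t, \<omega>). X t \<omega>) \<in> borel_measurable (time_prod T M) \<and>
     (\<forall>t\<in>{0..T}. X t \<in> borel_measurable (F t))"

definition B_infty_a ::
  "'w measure \<Rightarrow> (real \<Rightarrow> 'w measure) \<Rightarrow> real \<Rightarrow> (real \<Rightarrow> 'w \<Rightarrow> 'a::euclidean_space) set" where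
  "B_infty_a M F T = {X. adapted_process M F T X \<and>
     (\<forall>t\<in>{0..T}. integrable M (\<lambda>\<omega>. (norm (X t \<omega>))\<^sup>2)) \<and>
     bdd_above ((\<lambda>t. \<integral>\<omega>. (norm (X t \<omega>))\<^sup>2 \<partial>M) ` {0..T})}"

definition L2_a ::
  "'w measure \<Rightarrow> (real \<Rightarrow> 'w measure) \<Rightarrow> real \<Rightarrow> (real \<Rightarrow> 'w \<Rightarrow> 'a::euclidean_space) set" where
  "L2_a M F T = {X. adapted_process M F T X \<and>
     integrable (time_prod T M) (\<lambda>(t, \<omega>). (norm (X t \<omega>))\<^sup>2)}"

section \<open>Brownian motion and the Ito integral\<close>

text \<open>Only the values \<open>F t\<close> and \<open>W t\<close> for \<open>t \<ge> 0\<close> are relevant.\<close>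

definition complete_filtration :: "'w measure \<Rightarrow> (real \<Rightarrow> 'w measure) \<Rightarrow> bool" where
  "complete_filtration M F \<longleftrightarrow>
     complete_measure M \<and> null_sets M \<subseteq> sets (F 0) \<and>
     (\<forall>t\<ge>0. subalgebra M (F t)) \<and>
     (\<forall>s t. 0 \<le> s \<and> s \<le> t \<longrightarrow> subalgebra (F t) (F s))"

definition brownian_motion ::
  "'w measure \<Rightarrow> (real \<Rightarrow> 'w measure) \<Rightarrow> (real \<Rightarrow> 'w \<Rightarrow> real^'m) \<Rightarrow> bool" where
  "brownian_motion M F W \<longleftrightarrow>
     (AE \<omega> in M. W 0 \<omega> = 0) \<and>
     (AE \<omega> in M. continuous_on {0..} (\<lambda>t. W t \<omega>)) \<and>
     (\<forall>t\<ge>0. W t \<in> borel_measurable (F t)) \<and>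
     (\<forall>s t. 0 \<le> s \<and> s < t \<longrightarrow>
        prob_space.indep_set M (sets (F s))
          (sets (vimage_algebra (space M) (\<lambda>\<omega>. W t \<omega> - W s \<omega>) borel)) \<and>
        distributed M lborel (\<lambda>\<omega>. W t \<omega> - W s \<omega>)
          (\<lambda>x. ennreal (\<Prod>i\<in>UNIV. normal_density 0 (sqrt (t - s)) (x $ i))))"

text \<open>An elementary integrand is given by partition points \<open>\<tau> 0 \<le> \<dots> \<le> \<tau> N\<close> in \<open>[0, T]\<close>
  and bounded, \<open>F (\<tau> i)\<close>-measurable values \<open>\<xi> i\<close> on \<open>(\<tau> i, \<tau> (i + 1)]\<close>.\<close>

definition elementary_integrand ::
  "'w measure \<Rightarrow> (real \<Rightarrow> 'w measure) \<Rightarrow> real \<Rightarrow> nat \<Rightarrow> (nat \<Rightarrow> real) \<Rightarrow>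
   (nat \<Rightarrow> 'w \<Rightarrow> real^'m^'n) \<Rightarrow> bool" where
  "elementary_integrand M F T N \<tau> \<xi> \<longleftrightarrow>
     0 \<le> \<tau> 0 \<and> \<tau> N \<le> T \<and> (\<forall>i<N. \<tau> i \<le> \<tau> (Suc i)) \<and>
     (\<forall>i<N. \<xi> i \<in> borel_measurable (F (\<tau> i)) \<and> bounded (\<xi> i ` space M))"

definition elementary_process ::
  "nat \<Rightarrow> (nat \<Rightarrow> real) \<Rightarrow> (nat \<Rightarrow> 'w \<Rightarrow> real^'m^'n) \<Rightarrow> real \<Rightarrow> 'w \<Rightarrow> real^'m^'n" where
  "elementary_process N \<tau> \<xi> t \<omega> = (\<Sum>i<N. indicator {\<tau> i<..\<tau> (Suc i)} t *\<^sub>R \<xi> i \<omega>)"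

definition elementary_integral ::
  "(real \<Rightarrow> 'w \<Rightarrow> real^'m) \<Rightarrow> nat \<Rightarrow> (nat \<Rightarrow> real) \<Rightarrow> (nat \<Rightarrow> 'w \<Rightarrow> real^'m^'n) \<Rightarrow>
   real \<Rightarrow> 'w \<Rightarrow> real^'n" where
  "elementary_integral W N \<tau> \<xi> t \<omega> =
     (\<Sum>i<N. \<xi> i \<omega> *v (W (min t (\<tau> (Suc i))) \<omega> - W (min t (\<tau> i)) \<omega>))"

text \<open>\<open>Y\<close> is (a version of) \<open>\<integral>\<^sub>0\<^sup>\<cdot> Q dW\<close>: the \<open>L\<^sub>2\<close>-limit of the integrals of
  elementary integrands converging to \<open>Q\<close> in \<open>L\<^sub>2([0, T] \<times> \<Omega>)\<close>. By the Ito isometry every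
  \<open>Y t\<close> is determined almost surely and does not depend on the approximating sequence.\<close>

definition ito_integral ::
  "'w measure \<Rightarrow> (real \<Rightarrow> 'w measure) \<Rightarrow> (real \<Rightarrow> 'w \<Rightarrow> real^'m) \<Rightarrow> real \<Rightarrow>
   (real \<Rightarrow> 'w \<Rightarrow> real^'m^'n) \<Rightarrow> (real \<Rightarrow> 'w \<Rightarrow> real^'n) \<Rightarrow> bool" where
  "ito_integral M F W T Q Y \<longleftrightarrow>
     Q \<in> L2_a M F T \<and> (\<forall>t\<in>{0..T}. Y t \<in> borel_measurable M) \<and>
     (\<exists>N \<tau> \<xi>. (\<forall>k. elementary_integrand M F T (N k) (\<tau> k) (\<xi> k)) \<and>
        (\<lambda>k. \<integral>\<^sup>+(t, \<omega>). ennreal ((norm (Q t \<omega> - elementary_process (N k) (\<tau> k) (\<xi> k) t \<omega>))\<^sup>2)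
               \<partial>time_prod T M) \<longlonglongrightarrow> 0 \<and>
        (\<forall>t\<in>{0..T}.
          (\<lambda>k. \<integral>\<^sup>+\<omega>. ennreal ((norm (Y t \<omega> - elementary_integral W (N k) (\<tau> k) (\<xi> k) t \<omega>))\<^sup>2)
                 \<partial>M) \<longlonglongrightarrow> 0))"

text \<open>\<open>dX(t) = f(t) dt + g(t) dW(t)\<close> on \<open>[0, T]\<close>.\<close>

definition ito_differential ::
  "'w measure \<Rightarrow> (real \<Rightarrow> 'w measure) \<Rightarrow> (real \<Rightarrow> 'w \<Rightarrow> real^'m) \<Rightarrow> real \<Rightarrow>
   (real \<Rightarrow> 'w \<Rightarrow> real^'n) \<Rightarrow> (real \<Rightarrow> 'w \<Rightarrow> real^'n) \<Rightarrow> (real \<Rightarrow> 'w \<Rightarrow> real^'m^'n) \<Rightarrow> bool" where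
  "ito_differential M F W T X f g \<longleftrightarrow>
     (AE \<omega> in M. set_integrable lborel {0..T} (\<lambda>t. f t \<omega>)) \<and>
     (\<exists>Y. ito_integral M F W T g Y \<and>
        (\<forall>t\<in>{0..T}. AE \<omega> in M. X t \<omega> = X 0 \<omega> + (LINT s:{0..t}|lborel. f s \<omega>) + Y t \<omega>))"

section \<open>Relaxed controls\<close>

text \<open>Every finite Borel measure on a closed subset of a Euclidean space is regular, so no
  separate regularity condition is needed.\<close>

definition M1 :: "(real^'d) set \<Rightarrow> (real^'d) measure set" where
  "M1 U = space (prob_algebra (restrict_space borel U))"

text \<open>Weak-star measurable \<open>M1 U\<close>-valued processes adapted to \<open>G\<close>; essential boundedness
  holds since all values have total variation \<open>1\<close>.\<close>

definition relaxed_controls ::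
  "'w measure \<Rightarrow> (real \<Rightarrow> 'w measure) \<Rightarrow> real \<Rightarrow> (real^'d) set \<Rightarrow>
   (real \<Rightarrow> 'w \<Rightarrow> (real^'d) measure) set" where
  "relaxed_controls M G T U = {u.
     (\<forall>t\<in>{0..T}. \<forall>\<omega>\<in>space M. u t \<omega> \<in> M1 U) \<and>
     (\<forall>\<phi>::real^'d \<Rightarrow> real. continuous_on U \<phi> \<longrightarrow>
        adapted_process M G T (\<lambda>t \<omega>. \<integral>\<xi>. \<phi> \<xi> \<partial>u t \<omega>))}"

text \<open>Measurability in \<open>t\<close> of the information structure: conditional probabilities given
  \<open>G t\<close> can be chosen jointly measurable in \<open>(t, \<omega>)\<close> and adapted to \<open>G\<close>. If the
  \<open>\<sigma>\<close>-algebras \<open>G t\<close> vary with \<open>t\<close> in a non-measurable way, then measurable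
  \<open>G\<close>-adapted processes may all be deterministic although every \<open>G t\<close> is non-trivial, and
  the controls do not see the information in \<open>G t\<close>. Increasing families satisfy the condition;
  see \<open>measurable_information_mono\<close> below.\<close>

definition measurable_information :: "'w measure \<Rightarrow> (real \<Rightarrow> 'w measure) \<Rightarrow> real \<Rightarrow> bool" where
  "measurable_information M G T \<longleftrightarrow>
     (\<forall>A\<in>sets M. \<exists>Y::real \<Rightarrow> 'w \<Rightarrow> real. adapted_process M G T Y \<and>
        (AE t in lborel. t \<in> {0..T} \<longrightarrow>
          (AE \<omega> in M. Y t \<omega> = real_cond_exp M (G t) (indicator A) \<omega>)))"

lemma (in prob_space) measurable_information_mono:
  fixes G :: "real \<Rightarrow> 'a measure"
  assumes sub: "\<And>t. t \<in> {0..T} \<Longrightarrow> subalgebra M (G t)"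
    and mono: "\<And>s t. 0 \<le> s \<Longrightarrow> s \<le> t \<Longrightarrow> t \<le> T \<Longrightarrow> sets (G s) \<subseteq> sets (G t)"
  shows "measurable_information M G T"
proof (cases "0 \<le> T")
  case False
  then show ?thesis
    by (auto simp: measurable_information_def adapted_process_def intro!: exI[of _ "\<lambda>_ _. 0"])
next
  case True
  show ?thesis
    unfolding measurable_information_def
  proof
    fix A assume A [measurable]: "A \<in> sets M"
    define p where "p = (indicator A :: 'a \<Rightarrow> real)"
    have p: "integrable M p"
      unfolding p_def by (rule integrable_real_indicator) (auto simp: less_top[symmetric])
    have p01: "0 \<le> p \<omega>" "p \<omega> \<le> 1" for \<omega>
      by (auto simp: p_def indicator_def)
    have [measurable]: "p \<in> borel_measurable M"
      using p by auto
    define H where "H t = G (max 0 (min T t))" for t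
    have H_eq: "H t = G t" if "t \<in> {0..T}" for t
      using that by (auto simp: H_def)
    have subH: "subalgebra M (H t)" for t
      unfolding H_def using True by (intro sub) auto
    have monoH: "sets (H s) \<subseteq> sets (H t)" if "s \<le> t" for s t
      unfolding H_def using True that by (intro mono) auto
    have H_mono: "f \<in> borel_measurable (H t)"
      if "f \<in> borel_measurable (H s)" "s \<le> t" for f :: "'a \<Rightarrow> real" and s t
    proof -
      have "subalgebra (H t) (H s)"
        using monoH[OF that(2)] subH[of s] subH[of t] by (auto simp: subalgebra_def)
      then show ?thesis
        using measurable_from_subalg that(1) by blast
    qed
    have fin: "finite_measure_subalgebra M (H t)" for t
      using subH by unfold_locales auto
    interpret H: finite_measure_subalgebra M "H t" for t
      by (rule fin)
    define m where "m t = real_cond_exp M (H t) p" for t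
    have mH: "m t \<in> borel_measurable (H t)" for t
      by (simp add: m_def)
    have mM [measurable]: "m t \<in> borel_measurable M" for t
      by (rule measurable_from_subalg[OF subH mH])
    have m_bd: "AE \<omega> in M. \<bar>m t \<omega>\<bar> \<le> 1" for t
    proof -
      have "AE \<omega> in M. m t \<omega> \<ge> 0"
        unfolding m_def by (rule H.real_cond_exp_pos) (auto simp: p01)
      moreover have "AE \<omega> in M. m t \<omega> \<le> 1"
        unfolding m_def by (rule H.real_cond_exp_le_c) (auto simp: p p01)
      ultimately show ?thesis by eventually_elim auto
    qed
    have int_mm: "integrable M (\<lambda>\<omega>. m s \<omega> * m t \<omega>)" for s t
    proof (rule integrable_const_bound[where B = 1])
      show "AE \<omega> in M. norm (m s \<omega> * m t \<omega>) \<le> 1"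
        using m_bd[of s] m_bd[of t]
        by eventually_elim (auto simp: abs_mult intro: mult_le_one)
    qed auto
    have int_mp: "integrable M (\<lambda>\<omega>. m s \<omega> * p \<omega>)" for s
    proof (rule integrable_const_bound[where B = 1])
      show "AE \<omega> in M. norm (m s \<omega> * p \<omega>) \<le> 1"
        using m_bd[of s]
        by eventually_elim (use p01 in \<open>auto simp: abs_mult intro!: mult_le_one\<close>)
    qed auto
    have orth: "(\<integral>\<omega>. m s \<omega> * m t \<omega> \<partial>M) = (\<integral>\<omega>. m s \<omega> * p \<omega> \<partial>M)" if "s \<le> t" for s t
      unfolding m_def[of t]
      by (rule H.real_cond_exp_intg(2)[OF int_mp H_mono[OF mH that]]) auto
    define v where "v t = (\<integral>\<omega>. (m t \<omega>)\<^sup>2 \<partial>M)" for t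
    have diff: "(\<integral>\<omega>. (m t \<omega> - m s \<omega>)\<^sup>2 \<partial>M) = v t - v s" if "s \<le> t" for s t
    proof -
      have "(\<integral>\<omega>. (m t \<omega> - m s \<omega>)\<^sup>2 \<partial>M)
        = (\<integral>\<omega>. m t \<omega> * m t \<omega> - 2 * (m s \<omega> * m t \<omega>) + m s \<omega> * m s \<omega> \<partial>M)"
        by (simp add: power2_eq_square algebra_simps)
      also have "\<dots> = (\<integral>\<omega>. m t \<omega> * m t \<omega> \<partial>M) - 2 * (\<integral>\<omega>. m s \<omega> * m t \<omega> \<partial>M) + (\<integral>\<omega>. m s \<omega> * m s \<omega> \<partial>M)"
        using int_mm by simp
      also have "\<dots> = v t - v s"
        using orth[OF that] orth[of s s] by (simp add: v_def power2_eq_square)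
      finally show ?thesis .
    qed
    have int_d: "integrable M (\<lambda>\<omega>. (m t \<omega> - m s \<omega>)\<^sup>2)" for s t
    proof -
      have "(\<lambda>\<omega>. (m t \<omega> - m s \<omega>)\<^sup>2)
        = (\<lambda>\<omega>. m t \<omega> * m t \<omega> - 2 * (m s \<omega> * m t \<omega>) + m s \<omega> * m s \<omega>)"
        by (simp add: power2_eq_square algebra_simps fun_eq_iff)
      then show ?thesis using int_mm by simp
    qed
    have v_mono: "v s \<le> v t" if "s \<le> t" for s t
    proof -
      have "0 \<le> (\<integral>\<omega>. (m t \<omega> - m s \<omega>)\<^sup>2 \<partial>M)" by simp
      then show ?thesis using diff[OF that] by simp
    qed
    then have "mono v" by (auto simp: mono_def)
    then have [measurable]: "v \<in> borel_measurable borel"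
      by (rule borel_measurable_mono)
    have v01: "0 \<le> v t" "v t \<le> 1" for t
    proof -
      show "0 \<le> v t" by (simp add: v_def)
      have "v t \<le> (\<integral>\<omega>. 1 \<partial>M)"
        unfolding v_def
      proof (rule integral_mono_AE)
        show "AE \<omega> in M. (m t \<omega>)\<^sup>2 \<le> 1"
          using m_bd[of t] by eventually_elim (simp add: abs_square_le_1)
        show "integrable M (\<lambda>\<omega>. (m t \<omega>)\<^sup>2)"
          using int_mm[of t t] by (simp add: power2_eq_square)
      qed simp
      then show "v t \<le> 1" by (simp add: prob_space)
    qed
    define s where "s k t = real_of_int \<lfloor>t * 2 ^ k\<rfloor> / 2 ^ k" for k :: nat and t :: real
    have s_le: "s k t \<le> t" for k t
      by (simp add: s_def divide_le_eq)
    have s_gt: "t - s k t \<le> (1/2) ^ k" for k t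
    proof -
      have "t * 2 ^ k - real_of_int \<lfloor>t * 2 ^ k\<rfloor> \<le> 1"
        by linarith
      then have "(t * 2 ^ k - real_of_int \<lfloor>t * 2 ^ k\<rfloor>) / 2 ^ k \<le> 1 / 2 ^ k"
        by (intro divide_right_mono) auto
      then show ?thesis by (simp add: s_def diff_divide_distrib power_divide)
    qed
    have s_lim: "(\<lambda>k. s k t) \<longlonglongrightarrow> t" for t
    proof -
      have "(\<lambda>k. t - s k t) \<longlonglongrightarrow> 0"
        by (rule tendsto_sandwich[of "\<lambda>_. 0" _ _ "\<lambda>k. (1/2) ^ k"])
          (auto simp: s_le s_gt intro!: LIMSEQ_power_zero)
      from tendsto_diff[OF tendsto_const[of t] this] show ?thesis by simp
    qed
    have [measurable]: "s k \<in> borel_measurable borel" for k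
      unfolding s_def by measurable
    define L where "L = restrict_space lborel {0..T}"
    have L_fin: "finite_measure L"
      by (rule finite_measureI) (simp add: L_def emeasure_restrict_space space_restrict_space True)
    interpret L: finite_measure L by (rule L_fin)
    have L_meas: "f \<in> measurable L N" if "f \<in> measurable borel N" for f N
      using that unfolding L_def by (simp add: measurable_restrict_space1)
    have d_meas [measurable]: "(\<lambda>t. v t - v (s k t)) \<in> borel_measurable L" for k
      by (rule L_meas) measurable
    have L_AE: "AE t in L. isCont v t"
    proof -
      have "countable {t. \<not> isCont v t}"
        by (rule mono_ctble_discont[OF \<open>mono v\<close>])
      then have "{t. \<not> isCont v t} \<in> null_sets lborel"
        by (rule countable_imp_null_set_lborel)
      then have "AE t in lborel. isCont v t"
        by (rule AE_I') auto
      then show ?thesis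
        unfolding L_def by (simp add: AE_restrict_space_iff) (auto elim: eventually_mono)
    qed
    have "(\<lambda>k. \<integral>t. v t - v (s k t) \<partial>L) \<longlonglongrightarrow> (\<integral>t. 0 \<partial>L)"
    proof (rule integral_dominated_convergence[where w = "\<lambda>_. 1"])
      show "AE t in L. (\<lambda>k. v t - v (s k t)) \<longlonglongrightarrow> 0"
        using L_AE
      proof eventually_elim
        case (elim t)
        have "(\<lambda>k. v t - v (s k t)) \<longlonglongrightarrow> v t - v t"
          by (intro tendsto_diff tendsto_const isCont_tendsto_compose[OF elim s_lim])
        then show ?case by simp
      qed
      show "AE t in L. norm (v t - v (s k t)) \<le> 1" for k
        using v01 v_mono[OF s_le] by (intro AE_I2) (smt (verit) real_norm_def)
    qed auto
    then have lim0: "(\<lambda>k. \<integral>t. v t - v (s k t) \<partial>L) \<longlonglongrightarrow> 0" by simp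
    have "\<exists>k. (\<integral>t. v t - v (s k t) \<partial>L) < (1/2) ^ j" for j :: nat
      using order_tendstoD(2)[OF lim0, of "(1/2)^j"] by (auto simp: eventually_sequentially)
    then obtain r where r: "\<And>j. (\<integral>t. v t - v (s (r j) t) \<partial>L) < (1/2) ^ j" by metis
    have d_int: "integrable L (\<lambda>t. v t - v (s k t))" for k
      by (rule L.integrable_const_bound[where B = 1])
        (use v01 v_mono[OF s_le] in \<open>auto intro!: AE_I2, smt (verit)\<close>)
    have "(\<integral>\<^sup>+t. (\<Sum>j. ennreal (v t - v (s (r j) t))) \<partial>L) = (\<Sum>j. \<integral>\<^sup>+t. ennreal (v t - v (s (r j) t)) \<partial>L)"
      by (rule nn_integral_suminf) measurable
    also have "\<dots> \<le> (\<Sum>j. ennreal ((1/2) ^ j))"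
    proof (intro suminf_le)
      fix j
      have "(\<integral>\<^sup>+t. ennreal (v t - v (s (r j) t)) \<partial>L) = ennreal (\<integral>t. v t - v (s (r j) t) \<partial>L)"
        by (rule nn_integral_eq_integral[OF d_int]) (simp add: v_mono s_le)
      then show "(\<integral>\<^sup>+t. ennreal (v t - v (s (r j) t)) \<partial>L) \<le> ennreal ((1/2) ^ j)"
        using r[of j] by (simp add: ennreal_leI)
    qed auto
    also have "\<dots> = ennreal (\<Sum>j. (1/2) ^ j)"
      by (intro suminf_ennreal2) (auto intro: summable_geometric)
    also have "\<dots> < \<infinity>" by simp
    finally have "AE t in L. (\<Sum>j. ennreal (v t - v (s (r j) t))) \<noteq> \<infinity>"
      by (intro nn_integral_noteq_infinite) auto
    then have sum_fin: "AE t in lborel. t \<in> {0..T} \<longrightarrow> (\<Sum>j. ennreal (v t - v (s (r j) t))) \<noteq> \<infinity>"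
      unfolding L_def by (simp add: AE_restrict_space_iff)
    define Y where "Y t \<omega> = lim (\<lambda>j. m (s (r j) t) \<omega>)" for t \<omega>
    have "adapted_process M G T Y"
      unfolding adapted_process_def
    proof (intro conjI ballI)
      have "(\<lambda>(t, \<omega>). m (s k t) \<omega>) \<in> borel_measurable (L \<Otimes>\<^sub>M M)" for k
      proof -
        have *: "(\<lambda>x. m (real_of_int i / 2 ^ k) (snd x)) \<in> borel_measurable (L \<Otimes>\<^sub>M M)" for i
          by measurable
        have fl: "(\<lambda>t. \<lfloor>t * 2 ^ k\<rfloor>) \<in> measurable L (count_space UNIV)"
          by (rule L_meas) measurable
        have "(\<lambda>x. m (real_of_int \<lfloor>fst x * 2 ^ k\<rfloor> / 2 ^ k) (snd x)) \<in> borel_measurable (L \<Otimes>\<^sub>M M)"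
          by (rule measurable_compose_countable[OF * measurable_compose[OF measurable_fst fl]])
        then show ?thesis by (simp add: s_def split_beta)
      qed
      then have "(\<lambda>x. lim (\<lambda>j. (\<lambda>(t, \<omega>). m (s (r j) t) \<omega>) x)) \<in> borel_measurable (L \<Otimes>\<^sub>M M)"
        by (intro borel_measurable_lim_metric) auto
      then show "(\<lambda>(t, \<omega>). Y t \<omega>) \<in> borel_measurable (time_prod T M)"
        by (simp add: Y_def L_def split_beta)
    next
      fix t assume t: "t \<in> {0..T}"
      have "(\<lambda>\<omega>. lim (\<lambda>j. m (s (r j) t) \<omega>)) \<in> borel_measurable (H t)"
        by (intro borel_measurable_lim_metric H_mono[OF mH s_le])
      then show "Y t \<in> borel_measurable (G t)"
        using H_eq[OF t] by (simp add: Y_def[abs_def])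
    qed
    moreover have "AE t in lborel. t \<in> {0..T} \<longrightarrow>
        (AE \<omega> in M. Y t \<omega> = real_cond_exp M (G t) (indicator A) \<omega>)"
      using sum_fin
    proof (rule eventually_mono, intro impI)
      fix t
      assume "t \<in> {0..T} \<longrightarrow> (\<Sum>j. ennreal (v t - v (s (r j) t))) \<noteq> \<infinity>"
        and "t \<in> {0..T}"
      then have fin: "(\<Sum>j. ennreal (v t - v (s (r j) t))) \<noteq> \<infinity>"
        by blast
      have "(\<integral>\<^sup>+\<omega>. (\<Sum>j. ennreal ((m t \<omega> - m (s (r j) t) \<omega>)\<^sup>2)) \<partial>M)
        = (\<Sum>j. \<integral>\<^sup>+\<omega>. ennreal ((m t \<omega> - m (s (r j) t) \<omega>)\<^sup>2) \<partial>M)"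
        by (rule nn_integral_suminf) measurable
      also have "\<dots> = (\<Sum>j. ennreal (v t - v (s (r j) t)))"
      proof -
        have "(\<integral>\<^sup>+\<omega>. ennreal ((m t \<omega> - m (s (r j) t) \<omega>)\<^sup>2) \<partial>M) = ennreal (v t - v (s (r j) t))" for j
          using nn_integral_eq_integral[OF int_d] diff[OF s_le] by simp
        then show ?thesis by simp
      qed
      finally have "AE \<omega> in M. (\<Sum>j. ennreal ((m t \<omega> - m (s (r j) t) \<omega>)\<^sup>2)) \<noteq> \<infinity>"
        using fin by (intro nn_integral_noteq_infinite) auto
      then show "AE \<omega> in M. Y t \<omega> = real_cond_exp M (G t) (indicator A) \<omega>"
      proof eventually_elim
        case (elim \<omega>)
        then have "summable (\<lambda>j. (m t \<omega> - m (s (r j) t) \<omega>)\<^sup>2)"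
          by (intro summable_suminf_not_top) auto
        then have "(\<lambda>j. (m t \<omega> - m (s (r j) t) \<omega>)\<^sup>2) \<longlonglongrightarrow> 0"
          by (rule summable_LIMSEQ_zero)
        then have "(\<lambda>j. m t \<omega> - m (s (r j) t) \<omega>) \<longlonglongrightarrow> 0"
          using tendsto_real_sqrt[of "\<lambda>j. (m t \<omega> - m (s (r j) t) \<omega>)\<^sup>2" 0] by (auto simp: tendsto_rabs_zero_iff)
        from tendsto_diff[OF tendsto_const[of "m t \<omega>"] this]
        have "(\<lambda>j. m (s (r j) t) \<omega>) \<longlonglongrightarrow> m t \<omega>" by simp
        then have "Y t \<omega> = m t \<omega>"
          unfolding Y_def by (rule limI)
        then show ?case
          using H_eq \<open>t \<in> {0..T}\<close> by (simp add: m_def p_def[symmetric])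
      qed
    qed
    ultimately show "\<exists>Y::real \<Rightarrow> 'a \<Rightarrow> real. adapted_process M G T Y \<and>
        (AE t in lborel. t \<in> {0..T} \<longrightarrow>
          (AE \<omega> in M. Y t \<omega> = real_cond_exp M (G t) (indicator A) \<omega>))"
      by blast
  qed
qed

section \<open>Coefficients\<close>

definition C1 :: "('a::euclidean_space \<Rightarrow> 'b::real_normed_vector) \<Rightarrow> bool" where
  "C1 f \<longleftrightarrow> (\<exists>f'. (\<forall>x. (f has_derivative blinfun_apply (f' x)) (at x)) \<and> continuous_on UNIV f')"

definition grad :: "(real^'n \<Rightarrow> real) \<Rightarrow> real^'n \<Rightarrow> real^'n" where
  "grad f x = (\<chi> i. frechet_derivative f (at x) (axis i 1))"

text \<open>\<open>real^'m^'n\<close> is the space of linear maps from \<open>real^'m\<close> to \<open>real^'n\<close>. The bounds on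
  \<open>ell\<close> and \<open>\<Phi>\<close> exclude the value \<open>\<infinity>\<close>, so both are real-valued.\<close>

locale partially_observed_control = prob_space M
  for M :: "'w measure" +
  fixes F G :: "real \<Rightarrow> 'w measure"
    and T :: real
    and W :: "real \<Rightarrow> 'w \<Rightarrow> real^'m"
    and U :: "(real^'d) set"
    and b :: "real \<Rightarrow> real^'n \<Rightarrow> real^'d \<Rightarrow> real^'n"
    and \<sigma> :: "real \<Rightarrow> real^'n \<Rightarrow> real^'d \<Rightarrow> real^'m^'n"
    and ell :: "real \<Rightarrow> real^'n \<Rightarrow> real^'d \<Rightarrow> real"
    and \<Phi> :: "real^'n \<Rightarrow> real"
    and x0 :: "'w \<Rightarrow> real^'n"
  assumes filtration: "complete_filtration M F"
    and horizon: "0 < T"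
    and noise: "brownian_motion M F W"
    and information: "\<And>t. 0 \<le> t \<Longrightarrow> subalgebra (F t) (G t)"
    and control_set: "closed U" "bounded U"
    and initial: "x0 \<in> borel_measurable (F 0)" "integrable M (\<lambda>\<omega>. (norm (x0 \<omega>))\<^sup>2)"
    and borel:
      "(\<lambda>(t, x, \<xi>). b t x \<xi>) \<in> borel_measurable (restrict_space borel ({0..T} \<times> UNIV \<times> UNIV))"
      "(\<lambda>(t, x, \<xi>). \<sigma> t x \<xi>) \<in> borel_measurable (restrict_space borel ({0..T} \<times> UNIV \<times> UNIV))"
      "(\<lambda>(t, x, \<xi>). ell t x \<xi>) \<in> borel_measurable (restrict_space borel ({0..T} \<times> UNIV \<times> U))"
      "\<Phi> \<in> borel_measurable borel"
    and A1_A4: "\<exists>K. set_borel_measurable lborel {0..T} K \<and>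
      set_integrable lborel {0..T} (\<lambda>t. (K t)\<^sup>2) \<and>
      (\<forall>t\<in>{0..T}. 0 \<le> K t \<and> (\<forall>\<xi>\<in>U. \<forall>x y.
         norm (b t x \<xi> - b t y \<xi>) \<le> K t * norm (x - y) \<and>
         norm (b t x \<xi>) \<le> K t * (1 + norm x) \<and>
         norm (\<sigma> t x \<xi> - \<sigma> t y \<xi>) \<le> K t * norm (x - y) \<and>
         norm (\<sigma> t x \<xi>) \<le> K t * (1 + norm x)))"
    and A5: "\<And>\<xi> e. \<xi> \<in> U \<Longrightarrow> 0 < e \<Longrightarrow> \<exists>\<delta>>0. \<forall>\<eta>\<in>U. dist \<eta> \<xi> < \<delta> \<longrightarrow>
      (\<forall>t\<in>{0..T}. \<forall>x. dist (b t x \<eta>) (b t x \<xi>) < e \<and> dist (\<sigma> t x \<eta>) (\<sigma> t x \<xi>) < e)"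
    and a1: "\<And>t x e. t \<in> {0..T} \<Longrightarrow> 0 < e \<Longrightarrow>
      \<exists>\<delta>>0. \<forall>y. dist y x < \<delta> \<longrightarrow> (\<forall>\<xi>\<in>U. dist (ell t y \<xi>) (ell t x \<xi>) < e)"
    and a2: "\<exists>h. set_integrable lborel {0..T} h \<and>
      (\<forall>t\<in>{0..T}. 0 \<le> h t \<and> (\<forall>\<xi>\<in>U. \<forall>x. \<bar>ell t x \<xi>\<bar> \<le> h t * (1 + (norm x)\<^sup>2)))"
    and a3: "\<And>x c. c < \<Phi> x \<Longrightarrow> \<forall>\<^sub>F y in nhds x. c < \<Phi> y"
      "\<exists>c0\<ge>0. \<exists>c1\<ge>0. \<forall>x. \<bar>\<Phi> x\<bar> \<le> c0 + c1 * (norm x)\<^sup>2"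
    and NC1: "\<And>t \<xi>. t \<in> {0..T} \<Longrightarrow> \<xi> \<in> U \<Longrightarrow>
        C1 (\<lambda>x. b t x \<xi>) \<and> C1 (\<lambda>x. \<sigma> t x \<xi>) \<and> C1 (\<lambda>x. ell t x \<xi>)"
      "C1 \<Phi>"
      "\<exists>C. \<forall>t\<in>{0..T}. \<forall>x. \<forall>\<xi>\<in>U.
        onorm (frechet_derivative (\<lambda>y. b t y \<xi>) (at x)) \<le> C \<and>
        onorm (frechet_derivative (\<lambda>y. \<sigma> t y \<xi>) (at x)) \<le> C"

section \<open>The Hamiltonian system\<close>

definition hamiltonian ::
  "(real \<Rightarrow> real^'n \<Rightarrow> real^'d \<Rightarrow> real^'n) \<Rightarrow> (real \<Rightarrow> real^'n \<Rightarrow> real^'d \<Rightarrow> real^'m^'n) \<Rightarrow>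
   (real \<Rightarrow> real^'n \<Rightarrow> real^'d \<Rightarrow> real) \<Rightarrow>
   real \<Rightarrow> real^'n \<Rightarrow> real^'n \<Rightarrow> real^'m^'n \<Rightarrow> (real^'d) measure \<Rightarrow> real" where
  "hamiltonian b \<sigma> ell t x \<psi> Q \<nu> =
     (\<integral>\<xi>. b t x \<xi> \<partial>\<nu>) \<bullet> \<psi> + trace (transpose Q ** (\<integral>\<xi>. \<sigma> t x \<xi> \<partial>\<nu>)) + (\<integral>\<xi>. ell t x \<xi> \<partial>\<nu>)"

definition hamiltonian_psi ::
  "(real \<Rightarrow> real^'n \<Rightarrow> real^'d \<Rightarrow> real^'n) \<Rightarrow> real \<Rightarrow> real^'n \<Rightarrow> (real^'d) measure \<Rightarrow> real^'n" where
  "hamiltonian_psi b t x \<nu> = (\<integral>\<xi>. b t x \<xi> \<partial>\<nu>)"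

lemma hamiltonian_psi_gradient:
  "GDERIV (\<lambda>\<psi>. hamiltonian b \<sigma> ell t x \<psi> Q \<nu>) \<psi> :> hamiltonian_psi b t x \<nu>"
  unfolding gderiv_def hamiltonian_def hamiltonian_psi_def
  by (auto intro!: derivative_eq_intros simp: inner_commute)

text \<open>The gradient in \<open>x\<close>, with the derivative taken under the integrals; the second summand is
  the vector \<open>V\<close> with \<open>V \<bullet> \<zeta> = trace (transpose Q ** \<sigma>\<^sub>x(t, x, \<nu>; \<zeta>))\<close>, given by its
  components.\<close>

definition hamiltonian_x ::
  "(real \<Rightarrow> real^'n \<Rightarrow> real^'d \<Rightarrow> real^'n) \<Rightarrow> (real \<Rightarrow> real^'n \<Rightarrow> real^'d \<Rightarrow> real^'m^'n) \<Rightarrow>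
   (real \<Rightarrow> real^'n \<Rightarrow> real^'d \<Rightarrow> real) \<Rightarrow>
   real \<Rightarrow> real^'n \<Rightarrow> real^'n \<Rightarrow> real^'m^'n \<Rightarrow> (real^'d) measure \<Rightarrow> real^'n" where
  "hamiltonian_x b \<sigma> ell t x \<psi> Q \<nu> =
     transpose (\<integral>\<xi>. jacobian (\<lambda>y. b t y \<xi>) (at x) \<partial>\<nu>) *v \<psi> +
     (\<chi> i. trace (transpose Q ** (\<integral>\<xi>. frechet_derivative (\<lambda>y. \<sigma> t y \<xi>) (at x) (axis i 1) \<partial>\<nu>))) +
     (\<integral>\<xi>. grad (\<lambda>y. ell t y \<xi>) x \<partial>\<nu>)"

text \<open>The first conjunct makes \<open>ell\<^sub>x(t, x(t), u\<^sub>t)\<close> a genuine integral: unlike for \<open>b\<close> and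
  \<open>\<sigma>\<close>, the standing assumptions do not bound \<open>ell\<^sub>x\<close> in \<open>\<xi>\<close>.\<close>

definition hamiltonian_system ::
  "'w measure \<Rightarrow> (real \<Rightarrow> 'w measure) \<Rightarrow> real \<Rightarrow> (real \<Rightarrow> 'w \<Rightarrow> real^'m) \<Rightarrow>
   (real \<Rightarrow> real^'n \<Rightarrow> real^'d \<Rightarrow> real^'n) \<Rightarrow> (real \<Rightarrow> real^'n \<Rightarrow> real^'d \<Rightarrow> real^'m^'n) \<Rightarrow>
   (real \<Rightarrow> real^'n \<Rightarrow> real^'d \<Rightarrow> real) \<Rightarrow> (real^'n \<Rightarrow> real) \<Rightarrow> ('w \<Rightarrow> real^'n) \<Rightarrow>
   (real \<Rightarrow> 'w \<Rightarrow> (real^'d) measure) \<Rightarrow>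
   (real \<Rightarrow> 'w \<Rightarrow> real^'n) \<Rightarrow> (real \<Rightarrow> 'w \<Rightarrow> real^'n) \<Rightarrow> (real \<Rightarrow> 'w \<Rightarrow> real^'m^'n) \<Rightarrow> bool" where
  "hamiltonian_system M F T W b \<sigma> ell \<Phi> x0 u x \<psi> Q \<longleftrightarrow>
     (AE (t, \<omega>) in time_prod T M. integrable (u t \<omega>) (\<lambda>\<xi>. grad (\<lambda>y. ell t y \<xi>) (x t \<omega>))) \<and>
     ito_differential M F W T x
       (\<lambda>t \<omega>. hamiltonian_psi b t (x t \<omega>) (u t \<omega>))
       (\<lambda>t \<omega>. \<integral>\<xi>. \<sigma> t (x t \<omega>) \<xi> \<partial>u t \<omega>) \<and>
     (AE \<omega> in M. x 0 \<omega> = x0 \<omega>) \<and>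
     ito_differential M F W T \<psi>
       (\<lambda>t \<omega>. - hamiltonian_x b \<sigma> ell t (x t \<omega>) (\<psi> t \<omega>) (Q t \<omega>) (u t \<omega>)) Q \<and>
     (AE \<omega> in M. \<psi> T \<omega> = grad \<Phi> (x T \<omega>))"

end

theory Submission
  imports Defs
begin

text \<open>Along the given processes the Hamiltonian is \<open>\<integral> h(t, \<omega>, \<xi>) \<nu>(d\<xi>)\<close> with an
  integrand dominated by an integrable \<open>D(t, \<omega>)\<close>. As \<open>ell\<close> is only Borel in \<open>\<xi>\<close>, the
  integrand need not be continuous in \<open>\<xi>\<close>.

  Pointwise to integrated: for fixed \<open>t\<close> the integrand is \<open>\<gamma>(Z(\<omega>), \<xi>)\<close> with \<open>\<gamma>(z, \<cdot>)\<close>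
  depending continuously on \<open>z\<close> uniformly in \<open>\<xi>\<close>. Up to small errors only finitely many
  functions \<open>\<gamma>(z\<^sub>j, \<cdot>)\<close> occur, and a \<open>G t\<close>-measurable control may be replaced by a countably
  valued one with nearly the same integrals of these functions. For countably valued controls
  the pointwise inequality can be applied on each piece.

  Integrated to pointwise: the set \<open>B\<close> of those \<open>(t, \<xi>)\<close> at which the conditional inequality
  fails for the Dirac measure at \<open>\<xi>\<close> is Borel. If its projection to the time axis were not
  null, a measurable selection \<open>s\<close> of \<open>B\<close> over a set of times of positive measure would exist,
  and changing the control to the Dirac measure at \<open>s(t)\<close> where the conditional expectation is
  negative would decrease the cost. As the exceptional times do not depend on \<open>\<xi>\<close>, integration
  over \<open>\<xi>\<close> gives the inequality for all \<open>\<mu>\<close> at once.\<close>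

section \<open>Measurable selection\<close>

text \<open>Two obstacles shape the argument. In both directions an inequality that holds almost
  surely for each fixed measure has to be used for a family of measures, while the null set may
  change with the measure. As \<open>ell\<close> need not be continuous in \<xi>, the map from \<nu>
  to the Hamiltonian need not be weak-star continuous, and checking the inequality on a countable
  dense family of measures need not suffice. Hence Borel test functions on one side, and on the
  other a version of the conditional expectation that is jointly measurable in time, \<xi> and
  \<omega>. Such versions come from \<open>measurable_information\<close>, which provides them for
  events; a monotone class argument extends them to integrands. The second obstacle is that the set
  of bad times is a projection of a Borel set and need not be Borel. It is therefore measured by
  outer measure, and \<open>B\<close> is replaced by a compact subset whose projection still has
  positive measure; over a compact set a Borel selector can be constructed explicitly.\<close>

lemma closed_reindex:
  fixes C :: "('a::topological_space \<times> (nat \<Rightarrow> nat)) set"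
  assumes "closed C"
  shows "closed {(x, s :: nat \<Rightarrow> nat). (x, \<lambda>i. s (f i)) \<in> C}"
proof -
  have *: "continuous_on UNIV (\<lambda>p :: 'a \<times> (nat \<Rightarrow> nat). (fst p, \<lambda>i. snd p (f i)))"
    by (intro continuous_intros continuous_on_product_then_coordinatewise)
  have "closed ((\<lambda>p :: 'a \<times> (nat \<Rightarrow> nat). (fst p, \<lambda>i. snd p (f i))) -` C)"
    by (intro closed_vimage assms *)
  also have "(\<lambda>p :: 'a \<times> (nat \<Rightarrow> nat). (fst p, \<lambda>i. snd p (f i))) -` C = {(x, s). (x, \<lambda>i. s (f i)) \<in> C}"
    by auto
  finally show ?thesis .
qed

lemma closed_coordinate:
  fixes N :: "nat set"
  shows "closed {(x::'a::topological_space, s::nat \<Rightarrow> nat). s k \<in> N}"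
proof -
  have *: "continuous_on UNIV (\<lambda>p :: 'a \<times> (nat \<Rightarrow> nat). snd p k)"
    by (intro continuous_intros continuous_on_product_then_coordinatewise)
  have "closed ((\<lambda>p :: 'a \<times> (nat \<Rightarrow> nat). snd p k) -` N)"
    by (intro closed_vimage *) (simp add: closed_def discrete_topology_class.open_discrete)
  also have "(\<lambda>p :: 'a \<times> (nat \<Rightarrow> nat). snd p k) -` N = {(x, s). s k \<in> N}"
    by auto
  finally show ?thesis .
qed

text \<open>The first entry of the code is spent on the index: \<open>s 0 = n\<close> announces that
  the remaining entries are a code in \<open>C n\<close>. For every other \<open>n\<close> the
  condition is void, so \<open>D\<close> is an intersection of closed sets.\<close>

lemma projection_closed_UN:
  fixes C :: "nat \<Rightarrow> ('a::topological_space \<times> (nat \<Rightarrow> nat)) set"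
  assumes "\<And>n. closed (C n)"
  shows "\<exists>D::('a \<times> (nat \<Rightarrow> nat)) set. closed D \<and> (\<Union>n. fst ` C n) = fst ` D"
proof (intro exI conjI)
  define D where "D = (\<Inter>n. {(x::'a, s::nat \<Rightarrow> nat). s 0 \<in> - {n}} \<union> {(x, s). (x, \<lambda>i. s (Suc i)) \<in> C n})"
  show "closed D"
    unfolding D_def by (intro closed_INT ballI closed_Un closed_coordinate closed_reindex assms)
  show "(\<Union>n. fst ` C n) = fst ` D"
  proof safe
    fix n x s assume "(x, s) \<in> C n"
    then have "(x, case_nat n s) \<in> D" by (auto simp: D_def)
    then show "fst (x, s) \<in> fst ` D" by force
  next
    fix x s assume "(x, s) \<in> D"
    then have "(x, \<lambda>i. s (Suc i)) \<in> C (s 0)" by (auto simp: D_def)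
    then show "fst (x, s) \<in> (\<Union>n. fst ` C n)" by force
  qed
qed

text \<open>A point of the intersection has one code for each \<open>n\<close>; the pairing function
  \<open>prod_encode\<close> interleaves these countably many sequences into a single one.\<close>

lemma projection_closed_INT:
  fixes C :: "nat \<Rightarrow> ('a::topological_space \<times> (nat \<Rightarrow> nat)) set"
  assumes "\<And>n. closed (C n)"
  shows "\<exists>D::('a \<times> (nat \<Rightarrow> nat)) set. closed D \<and> (\<Inter>n. fst ` C n) = fst ` D"
proof (intro exI conjI)
  define D where "D = (\<Inter>n. {(x::'a, s::nat \<Rightarrow> nat). (x, \<lambda>i. s (prod_encode (n, i))) \<in> C n})"
  show "closed D"
    unfolding D_def by (intro closed_INT ballI closed_reindex assms)
  show "(\<Inter>n. fst ` C n) = fst ` D"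
  proof (intro equalityI subsetI)
    fix x assume "x \<in> (\<Inter>n. fst ` C n)"
    then have "x \<in> fst ` C n" for n by blast
    then have "\<exists>s. (x, s) \<in> C n" for n by (metis imageE prod.collapse)
    then obtain s where "\<And>n. (x, s n) \<in> C n" by metis
    then have "(x, \<lambda>k. case prod_decode k of (n, i) \<Rightarrow> s n i) \<in> D" by (simp add: D_def)
    then show "x \<in> fst ` D" by (metis fst_conv image_eqI)
  next
    fix x assume "x \<in> fst ` D"
    then obtain s where "(x, s) \<in> D" by auto
    then have "(x, \<lambda>i. s (prod_encode (n, i))) \<in> C n" for n by (simp add: D_def)
    then show "x \<in> (\<Inter>n. fst ` C n)" by (metis INT_I fst_conv image_eqI)
  qed
qed

text \<open>This is the Souslin representation of Borel sets: a code in Baire space witnesses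
  membership. It makes compactness arguments available for sets of arbitrary Borel class.\<close>

lemma borel_projection_closed:
  fixes A :: "'a::metric_space set"
  assumes "A \<in> sets borel"
  shows "\<exists>C::('a \<times> (nat \<Rightarrow> nat)) set. closed C \<and> A = fst ` C"
proof -
  define P where "P A \<longleftrightarrow> (\<exists>C::('a \<times> (nat \<Rightarrow> nat)) set. closed C \<and> A = fst ` C)" for A
  have closed: "P A" if "closed A" for A
    unfolding P_def by (rule exI[of _ "A \<times> UNIV"]) (auto intro!: closed_Times that)
  have UN: "P (\<Union>n::nat. A n)" if "\<And>n. P (A n)" for A
  proof -
    from that have "\<forall>n. \<exists>C::('a \<times> (nat \<Rightarrow> nat)) set. closed C \<and> A n = fst ` C"
      by (simp add: P_def)
    then obtain C where "\<forall>n. closed (C n) \<and> A n = fst ` (C n :: ('a \<times> (nat \<Rightarrow> nat)) set)"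
      by (rule choice[THEN exE])
    then show ?thesis
      using projection_closed_UN[of C] by (simp add: P_def)
  qed
  have INT: "P (\<Inter>n::nat. A n)" if "\<And>n. P (A n)" for A
  proof -
    from that have "\<forall>n. \<exists>C::('a \<times> (nat \<Rightarrow> nat)) set. closed C \<and> A n = fst ` C"
      by (simp add: P_def)
    then obtain C where "\<forall>n. closed (C n) \<and> A n = fst ` (C n :: ('a \<times> (nat \<Rightarrow> nat)) set)"
      by (rule choice[THEN exE])
    then show ?thesis
      using projection_closed_INT[of C] by (simp add: P_def)
  qed
  have open_P: "P A" if "open A" for A
  \<comment> \<open>\<open>infdist\<close> to the empty set is 0 by convention, so
    \<open>A = UNIV\<close> is treated apart. Otherwise an open set is exhausted by the closed sets
    of points at distance at least 1/(n+1) from its complement.\<close>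
  proof (cases "A = UNIV")
    case False
    have "A = (\<Union>n. {x. 1 / real (Suc n) \<le> infdist x (- A)})"
    proof safe
      fix x assume "x \<in> A"
      then have "infdist x (- A) > 0"
        using False \<open>open A\<close> in_closed_iff_infdist_zero[of "- A" x] infdist_nonneg[of x "- A"]
        by (auto simp: less_le)
      then obtain n where "1 / real (Suc n) < infdist x (- A)"
        using nat_approx_posE by blast
      then show "x \<in> (\<Union>n. {x. 1 / real (Suc n) \<le> infdist x (- A)})"
        by (auto intro!: exI[of _ n])
    next
      fix x n assume "1 / real (Suc n) \<le> infdist x (- A)"
      then show "x \<in> A"
        using infdist_zero[of x "- A"] by (cases "x \<in> A") (auto simp: field_simps)
    qed
    moreover have "closed {x. 1 / real (Suc n) \<le> infdist x (- A)}" for n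
      by (intro closed_Collect_le continuous_intros)
    ultimately show ?thesis
      using UN[of "\<lambda>n. {x. 1 / real (Suc n) \<le> infdist x (- A)}"] closed by metis
  qed (simp add: closed)
  have "A \<in> sigma_sets UNIV {S. open S}"
    using assms by (simp add: borel_def)
  then have "P A \<and> P (- A)"
  proof induction
    case (Basic a)
    then show ?case by (auto intro: closed open_P)
  next
    case (Compl a)
    then show ?case by (simp add: Compl_eq_Diff_UNIV[symmetric])
  next
    case (Union a)
    then show ?case by (auto intro!: UN INT)
  qed (auto intro: closed)
  then show ?thesis by (simp add: P_def)
qed


text \<open>Tychonoff with finite factors. Bounding every entry confines the codes to a compact
  set.\<close>

lemma compact_bounded_sequences:
  fixes n :: "nat \<Rightarrow> nat"
  shows "compact {s. \<forall>i. s i \<le> n i}"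
proof -
  have "compactin (product_topology (\<lambda>i::nat. euclidean::nat topology) UNIV) (\<Pi>\<^sub>E i\<in>UNIV. {..n i})"
    by (subst compactin_PiE) (simp add: compactin_euclidean_iff finite_imp_compact)
  then show ?thesis
    by (simp add: euclidean_product_topology compactin_euclidean_iff PiE_UNIV_domain Pi_def)
qed

text \<open>Choquet's capacitability argument: the outer measure is continuous along increasing
  unions, so the coordinates of the code \<open>s\<close> can be bounded one after the other without
  losing the positive outer measure of the projection.\<close>

lemma compact_subset_positive_projection:
  fixes B :: "(real \<times> 'b::euclidean_space) set"
  assumes B: "B \<in> sets borel" "bounded B" and pos: "0 < outer_measure_of lborel (fst ` B)"
  shows "\<exists>K\<subseteq>B. compact K \<and> 0 < emeasure lborel (fst ` K)"
proof -
  obtain C :: "((real \<times> 'b) \<times> (nat \<Rightarrow> nat)) set" where C: "closed C" "B = fst ` C"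
    using borel_projection_closed[OF B(1)] by blast
  obtain R where R: "compact R" "B \<subseteq> R"
    using B(2) compact_closure closure_subset by blast
  \<comment> \<open>A level strictly below the outer measure: all truncations stay above
    \<open>c\<close>, and in the limit at least the bound by \<open>c\<close> survives.\<close>
  obtain c where c: "0 < c" "c < outer_measure_of lborel (fst ` B)"
    using dense[OF pos] by blast
  \<comment> \<open>The list \<open>l\<close> bounds only the entries fixed so far; appending a
    bound \<open>j\<close> and letting \<open>j\<close> grow exhausts \<open>D l\<close>.\<close>
  define D where "D l = {t. \<exists>x s. ((t, x), s) \<in> C \<and> (\<forall>i<length l. s i \<le> l ! i)}" for l :: "nat list"
  have D_Nil: "D [] = fst ` B"
    by (force simp: D_def C(2))
  have D_snoc: "D (l @ [j]) = {t. \<exists>x s. ((t, x), s) \<in> C \<and> (\<forall>i<length l. s i \<le> l ! i) \<and> s (length l) \<le> j}" for l j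
  proof -
    have "(\<forall>i<length (l @ [j]). s i \<le> (l @ [j]) ! i) \<longleftrightarrow> (\<forall>i<length l. s i \<le> l ! i) \<and> s (length l) \<le> j" for s
      by (auto simp: nth_append All_less_Suc)
    then show ?thesis unfolding D_def by simp
  qed
  have D_UN: "(\<Union>j. D (l @ [j])) = D l" for l
    unfolding D_snoc unfolding D_def by auto
  have D_inc: "incseq (\<lambda>j. D (l @ [j]))" for l
    unfolding D_snoc incseq_def by (auto intro: order_trans)
  have step: "\<exists>j. c < outer_measure_of lborel (D (l @ [j]))" if "c < outer_measure_of lborel (D l)" for l
  proof -
    have "c < (SUP j. outer_measure_of lborel (D (l @ [j])))"
      using that SUP_outer_measure_of_incseq[OF _ D_inc[of l], of lborel] by (simp add: D_UN)
    then show ?thesis by (simp add: less_SUP_iff)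
  qed
  have "\<exists>L. \<forall>k. (length (L k) = k \<and> c < outer_measure_of lborel (D (L k))) \<and> (\<exists>j. L (Suc k) = L k @ [j])"
  proof (rule dependent_nat_choice)
    show "\<exists>l. length l = 0 \<and> c < outer_measure_of lborel (D l)"
      using c D_Nil by auto
  next
    fix l k assume "length l = k \<and> c < outer_measure_of lborel (D l)"
    then show "\<exists>l'. (length l' = Suc k \<and> c < outer_measure_of lborel (D l')) \<and> (\<exists>j. l' = l @ [j])"
      using step[of l] by (metis length_append_singleton)
  qed
  then obtain L where L: "\<And>k. length (L k) = k" "\<And>k. c < outer_measure_of lborel (D (L k))"
    "\<And>k. \<exists>j. L (Suc k) = L k @ [j]" by blast
  define n where "n i = L (Suc i) ! i" for i
  have L_nth: "L k ! i = n i" if "i < k" for i k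
    using that
  proof (induction k)
    case (Suc k)
    then show ?case
      using L(3)[of k] L(1)[of k] by (auto simp: nth_append n_def less_Suc_eq)
  qed simp
  define A where "A k = closure (D (L k))" for k
  have D_sub: "D l \<subseteq> fst ` R" for l
    using R(2) by (force simp: D_def C(2))
  have compR: "compact (fst ` R)"
    using R(1) by (intro compact_continuous_image continuous_intros)
  have A_sub: "A k \<subseteq> fst ` R" for k
    unfolding A_def by (intro closure_minimal D_sub compact_imp_closed compR)
  have A_borel: "A k \<in> sets lborel" for k
    by (simp add: A_def)
  have A_c: "c \<le> emeasure lborel (A k)" for k
    using L(2)[of k] outer_measure_of_mono[OF closure_subset, of lborel "D (L k)"] A_borel[of k]
    by (simp add: A_def)
  have "A (Suc k) \<subseteq> A k" for k
    unfolding A_def using L(3)[of k] D_UN[of "L k"] by (intro closure_mono) auto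
  then have A_dec: "decseq A" by (rule decseq_SucI)
  \<comment> \<open>Continuity from above requires finite measure, which the compact set
    \<open>R\<close> supplies.\<close>
  have fin: "emeasure lborel (A k) \<noteq> \<infinity>" for k
    using emeasure_mono[OF A_sub[of k], of lborel] emeasure_compact_finite[OF compR]
      borel_compact[OF compR] by (auto simp: top_unique)
  have "emeasure lborel (\<Inter>k. A k) = (INF k. emeasure lborel (A k))"
    using A_borel A_dec fin by (intro INF_emeasure_decseq[symmetric]) auto
  also have "\<dots> \<ge> c"
    by (intro INF_greatest A_c)
  finally have A_pos: "0 < emeasure lborel (\<Inter>k. A k)"
    using c(1) by auto
  define S where "S = {s. \<forall>i. s i \<le> n i}"
  have compS: "compact (R \<times> S)"
    unfolding S_def by (intro compact_Times R compact_bounded_sequences)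
  define K where "K = fst ` (C \<inter> R \<times> S)"
  have compK: "compact K"
    unfolding K_def
    by (intro compact_continuous_image continuous_intros closed_Int_compact C compS)
  have "t \<in> fst ` K" if t: "t \<in> (\<Inter>k. A k)" for t
  proof -
    have "\<exists>x s. dist (fst x) t < 1 / Suc k \<and> (x, s) \<in> C \<and> (\<forall>i<k. s i \<le> n i)" for k
    proof -
      have "t \<in> closure (D (L k))" using t by (auto simp: A_def)
      then obtain t' where "t' \<in> D (L k)" "dist t' t < 1 / Suc k"
        unfolding closure_approachable by (meson zero_less_divide_1_iff of_nat_0_less_iff zero_less_Suc)
      then show ?thesis
        using L(1) L_nth by (force simp: D_def)
    qed
    then obtain x s where xs: "\<And>k. dist (fst (x k)) t < 1 / Suc k" "\<And>k. (x k, s k) \<in> C"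
      "\<And>k i. i < k \<Longrightarrow> s k i \<le> n i" by metis
    \<comment> \<open>The code of \<open>x k\<close> is controlled only in the entries below
      \<open>k\<close>. Cutting off the others moves it into the compact set \<open>S\<close>, and
      each single entry is eventually unaffected. A subsequential limit of \<open>s'\<close> is
      therefore also one of \<open>s\<close>, to which closedness of \<open>C\<close>
      applies.\<close>
    define s' where "s' k = (\<lambda>i. min (s k i) (n i))" for k
    have "(x k, s' k) \<in> R \<times> S" for k
      using xs(2)[of k] R(2) C(2) by (force simp: S_def s'_def)
    then obtain y r where y: "y \<in> R \<times> S" "strict_mono r" "((\<lambda>k. (x k, s' k)) \<circ> r) \<longlonglongrightarrow> y"
      using seq_compactE[OF compact_imp_seq_compact[OF compS], of "\<lambda>k. (x k, s' k)"] by blast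
    have x_lim: "(\<lambda>k. x (r k)) \<longlonglongrightarrow> fst y" and s_lim: "(\<lambda>k. s' (r k)) \<longlonglongrightarrow> snd y"
      using tendsto_fst[OF y(3)] tendsto_snd[OF y(3)] by (auto simp: o_def)
    have "(\<lambda>k. s (r k)) \<longlonglongrightarrow> snd y"
    proof -
      have "(\<lambda>k. s (r k) i) \<longlonglongrightarrow> snd y i" for i
      proof -
        have "(\<lambda>k. s' (r k) i) \<longlonglongrightarrow> snd y i"
          using s_lim by (rule tendsto_compose[rotated])
            (use continuous_on_product_coordinates[of i] in \<open>auto simp: continuous_on_def\<close>)
        moreover have "\<forall>\<^sub>F k in sequentially. s' (r k) i = s (r k) i"
          using eventually_gt_at_top[of i]
        proof eventually_elim
          case (elim k)
          then have "i < r k" using seq_suble[OF y(2), of k] by linarith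
          then show ?case using xs(3) by (simp add: s'_def min_def)
        qed
        ultimately show ?thesis by (rule Lim_transform_eventually)
      qed
      then show ?thesis
        unfolding limitin_canonical_iff[symmetric] euclidean_product_topology[symmetric]
        by (simp add: limitin_componentwise)
    qed
    then have "(\<lambda>k. (x (r k), s (r k))) \<longlonglongrightarrow> (fst y, snd y)"
      by (intro tendsto_Pair x_lim)
    then have "y \<in> C"
      using closed_sequentially[OF C(1), of "\<lambda>k. (x (r k), s (r k))"] xs(2) by simp
    then have "fst y \<in> K" using y(1) by (auto simp: K_def)
    moreover have "fst (fst y) = t"
    proof (rule LIMSEQ_unique)
      show "(\<lambda>k. fst (x (r k))) \<longlonglongrightarrow> fst (fst y)" by (intro tendsto_fst x_lim)
      have "(\<lambda>k. fst (x k)) \<longlonglongrightarrow> t"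
      proof (rule metric_tendsto_imp_tendsto[OF LIMSEQ_inverse_real_of_nat, of _ t])
        show "\<forall>\<^sub>F k in sequentially. dist (fst (x k)) t \<le> dist (inverse (real (Suc k))) 0"
          using xs(1) by (intro always_eventually allI) (simp add: inverse_eq_divide less_imp_le)
      qed
      then show "(\<lambda>k. fst (x (r k))) \<longlonglongrightarrow> t"
        using LIMSEQ_subseq_LIMSEQ[OF _ y(2)] by (auto simp: o_def)
    qed
    ultimately show ?thesis by force
  qed
  then have "emeasure lborel (\<Inter>k. A k) \<le> emeasure lborel (fst ` K)"
    using compK by (intro emeasure_mono)
      (auto intro!: borel_compact compact_continuous_image continuous_intros)
  moreover have "K \<subseteq> B" by (auto simp: K_def C(2))
  ultimately show ?thesis using A_pos compK by (intro exI[of _ K]) auto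
qed


text \<open>A point of the fibre is found by successive approximation: at stage \<open>n\<close> the
  first centre \<open>q j\<close> is taken whose ball of radius \<open>1 / 2 ^ n\<close> still meets
  the part of the fibre retained so far. Since \<open>E l\<close> is the projection of a compact
  set, each choice depends on \<open>t\<close> in a Borel way, and by compactness the nested fibres
  have a common point.\<close>

lemma compact_selection:
  fixes K :: "(real \<times> 'b::euclidean_space) set"
  assumes K: "compact K"
  shows "\<exists>s\<in>borel_measurable borel. \<forall>t\<in>fst ` K. (t, s t) \<in> K"
proof -
  obtain Q :: "'b set" where Q: "countable Q" "\<And>X. open X \<Longrightarrow> X \<noteq> {} \<Longrightarrow> \<exists>q\<in>Q. q \<in> X"
    using countable_dense_exists[where 'a='b] by blast
  have "Q \<noteq> {}" using Q(2)[of UNIV] by auto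
  define q where "q = from_nat_into Q"
  have q: "\<exists>j. x \<in> cball (q j) (1 / 2 ^ n)" for x and n :: nat
  proof -
    obtain y where "y \<in> Q" "y \<in> ball x (1 / 2 ^ n)"
      using Q(2)[of "ball x (1 / 2 ^ n)"] by (auto simp: not_le)
    then show ?thesis
      using from_nat_into_surj[OF Q(1)] by (force simp: q_def dist_commute intro: less_imp_le)
  qed
  define V where "V l = (\<Inter>m<length l. cball (q (l ! m)) (1 / 2 ^ m))" for l :: "nat list"
  define E where "E l = fst ` (K \<inter> UNIV \<times> V l)" for l
  have V_snoc: "V (l @ [j]) = V l \<inter> cball (q j) (1 / 2 ^ length l)" for l j
    by (auto simp: V_def nth_append lessThan_Suc)
  have closed_V: "closed (V l)" for l
    unfolding V_def by (intro closed_INT ballI) auto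
  have E_borel [measurable]: "E l \<in> sets borel" for l
    unfolding E_def
    by (intro borel_compact compact_continuous_image continuous_intros compact_Int_closed K closed_Times closed_V closed_UNIV)
  \<comment> \<open>Over times outside the projection of \<open>K\<close> the choice is meaningless
    but still measurable.\<close>
  define p where "p t n = rec_nat [] (\<lambda>_ l. l @ [LEAST j. t \<in> E (l @ [j])]) n" for t n
  have p_0: "p t 0 = []" and p_Suc: "p t (Suc n) = p t n @ [LEAST j. t \<in> E (p t n @ [j])]" for t n
    by (simp_all add: p_def)
  have len: "length (p t n) = n" for t n
    by (induction n) (simp_all add: p_0 p_Suc)
  have p_E: "t \<in> E (p t n)" if "t \<in> fst ` K" for t n
  proof (induction n)
    case 0
    then show ?case using that by (simp add: p_0 E_def V_def)
  next
    case (Suc n)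
    then obtain x where x: "(t, x) \<in> K" "x \<in> V (p t n)" by (auto simp: E_def)
    obtain j where "x \<in> cball (q j) (1 / 2 ^ n)" using q by blast
    with x have "t \<in> E (p t n @ [j])"
      unfolding E_def V_snoc len by force
    then show ?case unfolding p_Suc by (rule LeastI)
  qed
  have p_meas: "(\<lambda>t. p t n) \<in> measurable borel (count_space UNIV)" for n
  proof (induction n)
    case (Suc n)
    have "(\<lambda>t. l @ [LEAST j. t \<in> E (l @ [j])]) \<in> measurable borel (count_space UNIV)" for l
    proof -
      have "(\<lambda>t. LEAST j. t \<in> E (l @ [j])) \<in> measurable borel (count_space UNIV)"
        by (intro measurable_Least pred_sets2[OF E_borel]) auto
      then show ?thesis by (rule measurable_compose) auto
    qed
    from measurable_compose_countable[OF this Suc.IH] show ?case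
      by (simp add: p_Suc)
  qed (simp add: p_0)
  \<comment> \<open>The centre of stage \<open>n\<close> is the last entry of the list of length
    \<open>Suc n\<close>; it lies within \<open>1 / 2 ^ n\<close> of the selected point.\<close>
  define c where "c n t = q (last (p t (Suc n)))" for n t
  define s where "s t = lim (\<lambda>n. c n t)" for t
  have c_meas: "c n \<in> borel_measurable borel" for n
    unfolding c_def by (rule measurable_compose[OF p_meas]) auto
  have "s \<in> borel_measurable borel"
    unfolding s_def by (intro borel_measurable_lim_metric c_meas)
  moreover have "(t, s t) \<in> K" if t: "t \<in> fst ` K" for t
  proof -
    define Z where "Z n = K \<inter> {t} \<times> V (p t n)" for n
    have "(\<Inter>n. Z n) \<noteq> {}"
    proof (rule compact_nest)
      show "compact (Z n)" for n
        unfolding Z_def by (intro compact_Int_closed K closed_Times closed_V closed_singleton)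
      show "Z n \<noteq> {}" for n
        using p_E[OF t, of n] by (auto simp: Z_def E_def)
      have "Z (Suc n) \<subseteq> Z n" for n
        by (auto simp: Z_def p_Suc V_snoc)
      then have "decseq Z" by (rule decseq_SucI)
      then show "Z n \<subseteq> Z m" if "m \<le> n" for m n
        using that by (rule decseqD)
    qed
    then obtain x where x: "(t, x) \<in> Z n" for n by (auto simp: Z_def)
    have "dist (c n t) x \<le> (1 / 2) ^ n" for n
      using x[of "Suc n"] by (simp add: Z_def p_Suc V_snoc len c_def power_divide)
    then have "(\<lambda>n. c n t) \<longlonglongrightarrow> x"
      by (intro metric_tendsto_imp_tendsto[OF LIMSEQ_power_zero[of "1/2 :: real"], of _ x])
        (auto intro!: always_eventually)
    then have "s t = x" by (simp add: s_def limI)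
    then show ?thesis using x[of 0] by (simp add: Z_def)
  qed
  ultimately show ?thesis by blast
qed

text \<open>The hypothesis \<open>pos\<close> says that no null set contains the projection, which
  is meaningful although the projection need not be measurable. Passing to a compact subset yields a
  measurable set of times together with a Borel selector.\<close>

lemma borel_selection:
  fixes B :: "(real \<times> 'b::euclidean_space) set"
  assumes B: "B \<in> sets borel" "bounded B" and pos: "\<not> (AE t in lborel. t \<notin> fst ` B)"
  shows "\<exists>P s. P \<in> sets borel \<and> 0 < emeasure lborel P \<and> s \<in> borel_measurable borel \<and> (\<forall>t\<in>P. (t, s t) \<in> B)"
proof -
  have "outer_measure_of lborel (fst ` B) \<noteq> 0"
  proof
    assume *: "outer_measure_of lborel (fst ` B) = 0"
    \<comment> \<open>A measurable hull: outer measure zero would put the projection inside a null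
      set.\<close>
    obtain N where "N \<in> sets lborel" "fst ` B \<subseteq> N" "outer_measure_of lborel (fst ` B) = emeasure lborel N"
      using outer_measure_of_attain[of "fst ` B" lborel] by auto
    with * have "AE t in lborel. t \<notin> fst ` B"
      by (intro AE_I[of _ _ N]) auto
    with pos show False by simp
  qed
  then obtain K where K: "K \<subseteq> B" "compact K" "0 < emeasure lborel (fst ` K)"
    using compact_subset_positive_projection[OF B] by (auto simp: zero_less_iff_neq_zero)
  obtain s where s: "s \<in> borel_measurable borel" "\<forall>t\<in>fst ` K. (t, s t) \<in> K"
    using compact_selection[OF K(2)] by blast
  have "fst ` K \<in> sets borel"
    by (intro borel_compact compact_continuous_image continuous_intros K)
  with K s show ?thesis by (intro exI[of _ "fst ` K"] exI[of _ s]) auto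
qed

section \<open>Kernels and relaxed controls\<close>

lemma M1_D:
  assumes "\<mu> \<in> M1 U"
  shows "prob_space \<mu>" "sets \<mu> = sets (restrict_space borel U)" "space \<mu> = U"
    "\<mu> \<in> space (prob_algebra (restrict_space borel U))"
proof -
  show "prob_space \<mu>" "\<mu> \<in> space (prob_algebra (restrict_space borel U))"
    and *: "sets \<mu> = sets (restrict_space borel U)"
    using assms by (auto simp: M1_def space_prob_algebra)
  show "space \<mu> = U"
    using sets_eq_imp_space_eq[OF *] by (simp add: space_restrict_space)
qed

text \<open>Weak-star measurability tests a kernel against continuous functions only. The indicator
  of a closed set is a bounded limit of continuous functions, and the traces of closed sets form an
  intersection-stable generator.\<close>

lemma kernel_from_continuous:
  fixes U :: "'a::metric_space set"
  assumes U: "U \<in> sets borel"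
    and k: "\<And>x. x \<in> space N \<Longrightarrow> k x \<in> space (prob_algebra (restrict_space borel U))"
    and int: "\<And>\<phi>::'a \<Rightarrow> real. continuous_on U \<phi> \<Longrightarrow> (\<lambda>x. \<integral>\<xi>. \<phi> \<xi> \<partial>k x) \<in> borel_measurable N"
  shows "k \<in> measurable N (prob_algebra (restrict_space borel U))"
proof (rule measurable_prob_algebra_generated[where \<Omega> = U and G = "(\<inter>) U ` Collect closed"])
  show "sets (restrict_space borel U) = sigma_sets U ((\<inter>) U ` Collect closed)"
    using U by (simp add: sets_restrict_space borel_eq_closed sigma_sets_Int)
  show "Int_stable ((\<inter>) U ` Collect closed)"
  proof (rule Int_stableI)
    fix A B assume "A \<in> (\<inter>) U ` Collect closed" "B \<in> (\<inter>) U ` Collect closed"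
    then obtain C D where "closed C" "closed D" "A = U \<inter> C" "B = U \<inter> D" by auto
    then show "A \<inter> B \<in> (\<inter>) U ` Collect closed"
      by (intro image_eqI[of _ _ "C \<inter> D"]) auto
  qed
  show "prob_space (k a)" "sets (k a) = sets (restrict_space borel U)" if "a \<in> space N" for a
    using k[OF that] by (auto simp: space_prob_algebra)
next
  fix A assume "A \<in> (\<inter>) U ` Collect closed"
  then obtain C where C: "closed C" "A = U \<inter> C" by auto
  show "(\<lambda>a. emeasure (k a) A) \<in> borel_measurable N"
  \<comment> \<open>For empty \<open>C\<close> the convention \<open>infdist \<xi> {} = 0\<close>
    would make every \<open>\<phi> n\<close> equal to 1, hence the separate case.\<close>
  proof (cases "C = {}")
    case False
    define \<phi> where "\<phi> n \<xi> = max 0 (1 - real n * infdist \<xi> C)" for n :: nat and \<xi> :: 'a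
    have \<phi>_cont: "continuous_on S (\<phi> n)" for n S
      unfolding \<phi>_def by (intro continuous_intros)
    have \<phi>_lim: "(\<lambda>n. \<phi> n \<xi>) \<longlonglongrightarrow> indicator C \<xi>" for \<xi>
    proof (cases "\<xi> \<in> C")
      case True
      then show ?thesis by (simp add: \<phi>_def)
    next
      case notin: False
      then have "0 < infdist \<xi> C"
        using C(1) False in_closed_iff_infdist_zero[of C \<xi>] infdist_nonneg[of \<xi> C] by (auto simp: less_le)
      then obtain m where m: "1 < real m * infdist \<xi> C"
        using reals_Archimedean3 by blast
      have "\<phi> n \<xi> = 0" if "n \<ge> m" for n
      proof -
        have "real m * infdist \<xi> C \<le> real n * infdist \<xi> C"
          using that by (intro mult_right_mono) (auto simp: infdist_nonneg)
        with m show ?thesis by (simp add: \<phi>_def)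
      qed
      then have "\<forall>\<^sub>F n in sequentially. \<phi> n \<xi> = indicator C \<xi>"
        using notin by (auto simp: eventually_sequentially)
      then show ?thesis by (rule tendsto_eventually)
    qed
    have lim: "(\<lambda>n. \<integral>\<xi>. \<phi> n \<xi> \<partial>k x) \<longlonglongrightarrow> measure (k x) A" if x: "x \<in> space N" for x
    proof -
      interpret kx: prob_space "k x" using k[OF x] by (simp add: space_prob_algebra)
      have sets: "sets (k x) = sets (restrict_space borel U)"
        using k[OF x] by (simp add: space_prob_algebra)
      have sp: "space (k x) = U"
        using sets_eq_imp_space_eq[OF sets] by (simp add: space_restrict_space)
      have A: "A \<in> sets (k x)"
        unfolding sets using C by (auto simp: sets_restrict_space)
      have meas: "\<phi> n \<in> borel_measurable (k x)" for n
        unfolding measurable_cong_sets[OF sets refl]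
        by (intro borel_measurable_continuous_on_restrict \<phi>_cont)
      have "(\<lambda>n. \<integral>\<xi>. \<phi> n \<xi> \<partial>k x) \<longlonglongrightarrow> (\<integral>\<xi>. indicator A \<xi> \<partial>k x)"
      proof (rule integral_dominated_convergence[where w = "\<lambda>_. 1"])
        show "AE \<xi> in k x. (\<lambda>n. \<phi> n \<xi>) \<longlonglongrightarrow> indicator A \<xi>"
        proof (rule AE_I2)
          fix \<xi> assume "\<xi> \<in> space (k x)"
          then have "indicator A \<xi> = (indicator C \<xi> :: real)"
            by (simp add: sp C(2) indicator_def)
          then show "(\<lambda>n. \<phi> n \<xi>) \<longlonglongrightarrow> indicator A \<xi>" using \<phi>_lim by simp
        qed
        show "AE \<xi> in k x. norm (\<phi> n \<xi>) \<le> 1" for n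
          by (intro AE_I2) (simp add: \<phi>_def infdist_nonneg)
      qed (use A meas in auto)
      also have "(\<integral>\<xi>. indicator A \<xi> \<partial>k x) = measure (k x) A"
        using A by simp
      finally show ?thesis .
    qed
    have "(\<lambda>x. measure (k x) A) \<in> borel_measurable N"
      by (rule borel_measurable_LIMSEQ_metric[OF int[OF \<phi>_cont] lim])
    then have "(\<lambda>x. ennreal (measure (k x) A)) \<in> borel_measurable N" by simp
    also have "?this \<longleftrightarrow> (\<lambda>x. emeasure (k x) A) \<in> borel_measurable N"
      using k by (intro measurable_cong)
        (simp add: space_prob_algebra finite_measure.emeasure_eq_measure prob_space.finite_measure)
    finally show ?thesis .
  qed (simp add: C)
qed auto

text \<open>Kernel measurability is available for nonnegative integrands; integrability of each
  \<open>f x\<close> makes the integral a difference of two such integrals.\<close>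

lemma integral_kernel_measurable:
  fixes f :: "'a \<Rightarrow> 'b \<Rightarrow> real"
  assumes [measurable]: "(\<lambda>(x, y). f x y) \<in> borel_measurable (N \<Otimes>\<^sub>M S)"
    and k: "k \<in> measurable N (prob_algebra S)"
    and int: "\<And>x. x \<in> space N \<Longrightarrow> integrable (k x) (f x)"
  shows "(\<lambda>x. \<integral>y. f x y \<partial>k x) \<in> borel_measurable N"
proof -
  have [measurable]: "k \<in> measurable N (subprob_algebra S)"
    by (rule measurable_prob_algebraD[OF k])
  have "(\<lambda>x. enn2real (\<integral>\<^sup>+y. ennreal (f x y) \<partial>k x) - enn2real (\<integral>\<^sup>+y. ennreal (- f x y) \<partial>k x)) \<in> borel_measurable N"
    by (intro borel_measurable_diff borel_measurable_enn2real nn_integral_measurable_subprob_algebra2[where N = S])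
      measurable
  also have "?this \<longleftrightarrow> ?thesis"
    using int by (intro measurable_cong) (simp add: real_lebesgue_integral_def)
  finally show ?thesis .
qed

text \<open>Controls are defined through continuous test functions. As kernels, jointly in time and
  scenario and for \<open>G t\<close> at each time, they can be integrated against Borel functions
  such as \<open>ell\<close>.\<close>

lemma relaxed_controls_kernel:
  assumes U: "U \<in> sets borel" and u: "u \<in> relaxed_controls M G T U"
    and G: "\<And>t. t \<in> {0..T} \<Longrightarrow> space (G t) = space M"
  shows "(\<lambda>(t, \<omega>). u t \<omega>) \<in> measurable (time_prod T M) (prob_algebra (restrict_space borel U))"
    and "t \<in> {0..T} \<Longrightarrow> u t \<in> measurable (G t) (prob_algebra (restrict_space borel U))"
proof -
  have uM1: "u t \<omega> \<in> M1 U" if "t \<in> {0..T}" "\<omega> \<in> space M" for t \<omega>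
    using u that by (auto simp: relaxed_controls_def)
  have ad: "adapted_process M G T (\<lambda>t \<omega>. \<integral>\<xi>. \<phi> \<xi> \<partial>u t \<omega>)" if "continuous_on U \<phi>" for \<phi> :: "_ \<Rightarrow> real"
    using u that by (auto simp: relaxed_controls_def)
  show "(\<lambda>(t, \<omega>). u t \<omega>) \<in> measurable (time_prod T M) (prob_algebra (restrict_space borel U))"
  proof (rule kernel_from_continuous[OF U])
    fix x assume "x \<in> space (time_prod T M)"
    then show "(\<lambda>(t, \<omega>). u t \<omega>) x \<in> space (prob_algebra (restrict_space borel U))"
      using uM1 by (auto simp: space_pair_measure space_restrict_space M1_def)
  next
    fix \<phi> :: "_ \<Rightarrow> real" assume "continuous_on U \<phi>"
    from ad[OF this] show "(\<lambda>x. \<integral>\<xi>. \<phi> \<xi> \<partial>((\<lambda>(t, \<omega>). u t \<omega>) x)) \<in> borel_measurable (time_prod T M)"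
      by (simp add: adapted_process_def case_prod_beta')
  qed
  show "u t \<in> measurable (G t) (prob_algebra (restrict_space borel U))" if t: "t \<in> {0..T}"
  proof (rule kernel_from_continuous[OF U])
    show "u t \<omega> \<in> space (prob_algebra (restrict_space borel U))" if "\<omega> \<in> space (G t)" for \<omega>
      using uM1[OF t] that G[OF t] by (simp add: M1_def)
    show "(\<lambda>\<omega>. \<integral>\<xi>. \<phi> \<xi> \<partial>u t \<omega>) \<in> borel_measurable (G t)" if "continuous_on U \<phi>" for \<phi> :: "_ \<Rightarrow> real"
      using ad[OF that] t by (simp add: adapted_process_def)
  qed
qed

text \<open>A control pasted from several pieces is easier to check as a kernel than against each
  test function.\<close>

lemma relaxed_controlsI:
  assumes joint: "(\<lambda>(t, \<omega>). u t \<omega>) \<in> measurable (time_prod T M) (prob_algebra (restrict_space borel U))"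
    and ad: "\<And>t. t \<in> {0..T} \<Longrightarrow> u t \<in> measurable (G t) (prob_algebra (restrict_space borel U))"
  shows "u \<in> relaxed_controls M G T U"
  unfolding relaxed_controls_def adapted_process_def
proof safe
  fix t \<omega> assume "t \<in> {0..T}" "\<omega> \<in> space M"
  then have "(t, \<omega>) \<in> space (time_prod T M)" by (simp add: space_pair_measure space_restrict_space)
  from measurable_space[OF joint this] show "u t \<omega> \<in> M1 U" by (simp add: M1_def)
next
  fix \<phi> :: "_ \<Rightarrow> real" assume "continuous_on U \<phi>"
  then have "\<phi> \<in> borel_measurable (restrict_space borel U)"
    by (rule borel_measurable_continuous_on_restrict)
  note meas = integral_measurable_subprob_algebra[OF this]
  show "(\<lambda>(t, \<omega>). \<integral>\<xi>. \<phi> \<xi> \<partial>u t \<omega>) \<in> borel_measurable (time_prod T M)"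
    using measurable_compose[OF measurable_prob_algebraD[OF joint] meas] by (simp add: case_prod_beta')
  show "(\<lambda>\<omega>. \<integral>\<xi>. \<phi> \<xi> \<partial>u t \<omega>) \<in> borel_measurable (G t)" if "t \<in> {0..T}" for t
    using measurable_compose[OF measurable_prob_algebraD[OF ad[OF that]] meas] .
qed

text \<open>Integrals over sets of \<open>F\<close> replace versions: in this form the inequality
  can be used on the cells of a partition and combined with Fubini. Conversely, the difference of
  the conditional expectations is \<open>F\<close>-measurable with nonnegative integral over every
  set of \<open>F\<close>.\<close>

lemma (in prob_space) real_cond_exp_le_iff:
  assumes sub: "subalgebra M F" and f: "integrable M f" and g: "integrable M g"
  shows "(AE x in M. real_cond_exp M F f x \<le> real_cond_exp M F g x)
    \<longleftrightarrow> (\<forall>A\<in>sets F. (LINT x:A|M. f x) \<le> (LINT x:A|M. g x))"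
proof -
  interpret finite_measure_subalgebra M F using sub by unfold_locales
  have int: "set_integrable M A (real_cond_exp M F h)" if "A \<in> sets F" "integrable M h" for A h
    unfolding set_integrable_def using sub that
    by (intro integrable_mult_indicator real_cond_exp_int) (auto simp: subalgebra_def)
  show ?thesis
  proof
    assume "AE x in M. real_cond_exp M F f x \<le> real_cond_exp M F g x"
    then show "\<forall>A\<in>sets F. (LINT x:A|M. f x) \<le> (LINT x:A|M. g x)"
      using int f g by (auto simp: real_cond_exp_intA intro!: set_integral_mono_AE)
  next
    assume le: "\<forall>A\<in>sets F. (LINT x:A|M. f x) \<le> (LINT x:A|M. g x)"
    let ?d = "\<lambda>x. real_cond_exp M F g x - real_cond_exp M F f x"
    have d: "integrable M ?d" "?d \<in> borel_measurable F"
      using f g by (auto intro: real_cond_exp_int)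
    have "AE x in restr_to_subalg M F. 0 \<le> ?d x"
    proof (rule sigma_finite_measure.density_nonneg[OF sigma_fin_subalg])
      show "integrable (restr_to_subalg M F) ?d"
        by (rule integrable_in_subalg[OF sub d(2,1)])
      fix A assume "A \<in> sets (restr_to_subalg M F)"
      then have A [measurable]: "A \<in> sets F" by (simp add: sets_restr_to_subalg[OF sub])
      have "(LINT x:A|restr_to_subalg M F. ?d x) = (LINT x:A|M. ?d x)"
        unfolding set_lebesgue_integral_def by (intro integral_subalgebra2 sub) measurable
      also have "\<dots> = (LINT x:A|M. g x) - (LINT x:A|M. f x)"
        using int[OF A] f g A by (simp add: real_cond_exp_intA set_integral_diff)
      also have "\<dots> \<ge> 0" using le A by simp
      finally show "0 \<le> (LINT x:A|restr_to_subalg M F. ?d x)" .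
    qed
    from AE_restr_to_subalg[OF sub this]
    show "AE x in M. real_cond_exp M F f x \<le> real_cond_exp M F g x" by simp
  qed
qed

section \<open>Approximation by countably valued kernels\<close>

lemma integrable_imp_set_integrable:
  fixes f :: "'a \<Rightarrow> real"
  shows "integrable M f \<Longrightarrow> A \<in> sets M \<Longrightarrow> set_integrable M A f"
  unfolding set_integrable_def by (rule integrable_mult_indicator)

text \<open>The level sets of \<open>\<kappa>\<close> partition the space; dominated convergence
  sums their contributions.\<close>

lemma (in finite_measure) integral_partition_nonneg:
  fixes f :: "'a \<Rightarrow> real" and \<kappa> :: "'a \<Rightarrow> nat"
  assumes f: "integrable M f" and \<kappa> [measurable]: "\<kappa> \<in> measurable M (count_space UNIV)"
    and pos: "\<And>i. 0 \<le> (\<integral>x. indicator {i} (\<kappa> x) * f x \<partial>M)"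
  shows "0 \<le> (\<integral>x. f x \<partial>M)"
proof (rule LIMSEQ_le_const)
  have f_meas [measurable]: "f \<in> borel_measurable M" using f by auto
  show "(\<lambda>n. \<integral>x. indicator {..<n} (\<kappa> x) * f x \<partial>M) \<longlonglongrightarrow> (\<integral>x. f x \<partial>M)"
  proof (rule integral_dominated_convergence[where w = "\<lambda>x. \<bar>f x\<bar>"])
    show "AE x in M. (\<lambda>n. indicator {..<n} (\<kappa> x) * f x) \<longlonglongrightarrow> f x"
    proof (rule AE_I2)
      fix x
      have "\<forall>\<^sub>F n in sequentially. indicator {..<n} (\<kappa> x) * f x = f x"
        using eventually_gt_at_top[of "\<kappa> x"] by eventually_elim simp
      then show "(\<lambda>n. indicator {..<n} (\<kappa> x) * f x) \<longlonglongrightarrow> f x" by (rule tendsto_eventually)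
    qed
  qed (use f in \<open>auto simp: indicator_def intro!: AE_I2\<close>)
  have int: "integrable M (\<lambda>x. indicator {i} (\<kappa> x) * f x)" for i
    using f by (rule Bochner_Integration.integrable_bound) (auto simp: indicator_def)
  have "0 \<le> (\<integral>x. indicator {..<n} (\<kappa> x) * f x \<partial>M)" for n
  proof -
    have "indicator {..<n} (\<kappa> x) * f x = (\<Sum>i<n. indicator {i} (\<kappa> x) * f x)" for x
    proof -
      have "(\<Sum>i<n. indicator {i} (\<kappa> x) * f x) = (\<Sum>i<n. if \<kappa> x = i then f x else 0)"
        by (intro sum.cong) auto
      then show ?thesis by simp
    qed
    then have "(\<integral>x. indicator {..<n} (\<kappa> x) * f x \<partial>M) = (\<Sum>i<n. \<integral>x. indicator {i} (\<kappa> x) * f x \<partial>M)"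
      using int by (simp only: Bochner_Integration.integral_sum)
    also have "\<dots> \<ge> 0" by (intro sum_nonneg pos)
    finally show ?thesis .
  qed
  then show "\<exists>N. \<forall>n\<ge>N. 0 \<le> (\<integral>x. indicator {..<n} (\<kappa> x) * f x \<partial>M)" by blast
qed

text \<open>Each \<open>z\<close> has a ball on which \<open>\<gamma>\<close> moves by less than
  \<open>e\<close> uniformly on \<open>X\<close>, and by Lindelof countably many of these balls
  cover the space.\<close>

lemma countable_uniform_cover:
  fixes \<gamma> :: "'z::{metric_space, second_countable_topology} \<Rightarrow> 'x \<Rightarrow> real"
  assumes cont: "\<And>z e. 0 < e \<Longrightarrow> \<exists>\<delta>>0. \<forall>z'. dist z' z < \<delta> \<longrightarrow> (\<forall>\<xi>\<in>X. \<bar>\<gamma> z' \<xi> - \<gamma> z \<xi>\<bar> < e)"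
    and e: "0 < e"
  shows "\<exists>(a :: nat \<Rightarrow> 'z) V. (\<forall>k. open (V k)) \<and> (\<forall>z. \<exists>k. z \<in> V k) \<and>
    (\<forall>k. \<forall>z\<in>V k. \<forall>\<xi>\<in>X. \<bar>\<gamma> z \<xi> - \<gamma> (a k) \<xi>\<bar> < e)"
proof -
  obtain \<delta> where \<delta>: "\<And>z. 0 < \<delta> z" "\<And>z z'. dist z' z < \<delta> z \<Longrightarrow> \<forall>\<xi>\<in>X. \<bar>\<gamma> z' \<xi> - \<gamma> z \<xi>\<bar> < e"
    using cont[OF e] by metis
  obtain F' where F': "F' \<subseteq> range (\<lambda>z. ball z (\<delta> z))" "countable F'" "\<Union>F' = \<Union>(range (\<lambda>z. ball z (\<delta> z)))"
    using Lindelof[of "range (\<lambda>z. ball z (\<delta> z))"] by blast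
  have cover: "\<Union>F' = UNIV"
    unfolding F'(3) using \<delta>(1) centre_in_ball by blast
  then have "F' \<noteq> {}" by auto
  define V where "V = from_nat_into F'"
  have V_in: "V k \<in> F'" for k
    unfolding V_def by (rule from_nat_into[OF \<open>F' \<noteq> {}\<close>])
  then have "\<exists>z. V k = ball z (\<delta> z)" for k
    using F'(1) by blast
  then obtain a where a: "\<And>k. V k = ball (a k) (\<delta> (a k))" by metis
  have "\<exists>k. z \<in> V k" for z
  proof -
    obtain B where "B \<in> F'" "z \<in> B" using cover by blast
    then show ?thesis
      using from_nat_into_surj[OF F'(2)] unfolding V_def by metis
  qed
  moreover have "\<bar>\<gamma> z \<xi> - \<gamma> (a k) \<xi>\<bar> < e" if "z \<in> V k" "\<xi> \<in> X" for z k \<xi>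
    using \<delta>(2)[of z "a k"] that by (simp add: a dist_commute)
  ultimately show ?thesis
    by (intro exI[of _ a] exI[of _ V]) (auto simp: a)
qed

text \<open>Here \<open>c\<close> stands for the cost of the reference control, and
  \<open>le\<close> is the conditional inequality in integrated form, for constant measures only.
  The partition on which \<open>k\<close> is replaced is built from finitely many integrals with
  respect to \<open>k \<omega>\<close>; these are \<open>F\<close>-measurable although
  \<open>Z\<close> need not be.\<close>

lemma (in prob_space) kernel_integral_le:
  fixes \<gamma> :: "'z::{metric_space, second_countable_topology} \<Rightarrow> 'x \<Rightarrow> real"
  assumes sub: "subalgebra M F"
    and Z [measurable]: "Z \<in> borel_measurable M"
    and \<gamma>_meas: "\<And>z. \<gamma> z \<in> borel_measurable S"
    and \<gamma>_bd: "\<And>z. \<exists>B. \<forall>\<xi>\<in>space S. \<bar>\<gamma> z \<xi>\<bar> \<le> B"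
    and joint [measurable]: "(\<lambda>(\<omega>, \<xi>). \<gamma> (Z \<omega>) \<xi>) \<in> borel_measurable (M \<Otimes>\<^sub>M S)"
    and cont: "\<And>z e. 0 < e \<Longrightarrow> \<exists>\<delta>>0. \<forall>z'. dist z' z < \<delta> \<longrightarrow> (\<forall>\<xi>\<in>space S. \<bar>\<gamma> z' \<xi> - \<gamma> z \<xi>\<bar> < e)"
    and D: "integrable M D" "\<And>\<omega> \<xi>. \<omega> \<in> space M \<Longrightarrow> \<xi> \<in> space S \<Longrightarrow> \<bar>\<gamma> (Z \<omega>) \<xi>\<bar> \<le> D \<omega>"
    and c: "integrable M c"
    and le: "\<And>\<mu> A. \<mu> \<in> space (prob_algebra S) \<Longrightarrow> A \<in> sets F \<Longrightarrow>
      (LINT \<omega>:A|M. c \<omega>) \<le> (LINT \<omega>:A|M. \<integral>\<xi>. \<gamma> (Z \<omega>) \<xi> \<partial>\<mu>)"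
    and k: "k \<in> measurable F (prob_algebra S)"
  shows "(\<integral>\<omega>. c \<omega> \<partial>M) \<le> (\<integral>\<omega>. (\<integral>\<xi>. \<gamma> (Z \<omega>) \<xi> \<partial>k \<omega>) \<partial>M)"
proof (rule field_le_epsilon)
  fix e' :: real assume "0 < e'"
  \<comment> \<open>The error budget has five parts: two for replacing \<open>Z \<omega>\<close> by
    a centre \<open>a j\<close>, one for rounding, and two for the scenarios with
    \<open>\<kappa> \<omega> \<ge> n\<close>, where both integrals are bounded by
    \<open>D \<omega>\<close>.\<close>
  define e where "e = e' / 5"
  have e: "0 < e" using \<open>0 < e'\<close> by (simp add: e_def)
  have spF: "space F = space M" and setsF: "sets F \<subseteq> sets M"
    using sub by (auto simp: subalgebra_def)
  have kM: "k \<in> measurable M (prob_algebra S)"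
    by (rule measurable_from_subalg[OF sub k])
  define \<Gamma> where "\<Gamma> z \<nu> = (\<integral>\<xi>. \<gamma> z \<xi> \<partial>\<nu>)" for z \<nu>
  have int\<gamma>: "integrable \<nu> (\<gamma> z)" if "\<nu> \<in> space (prob_algebra S)" for z \<nu>
  proof -
    interpret \<nu>: prob_space \<nu> using that by (simp add: space_prob_algebra)
    have sets: "sets \<nu> = sets S" using that by (simp add: space_prob_algebra)
    obtain B where "\<forall>\<xi>\<in>space S. \<bar>\<gamma> z \<xi>\<bar> \<le> B" using \<gamma>_bd by blast
    then show ?thesis
      using \<gamma>_meas sets_eq_imp_space_eq[OF sets] sets
      by (intro \<nu>.integrable_const_bound[where B = B]) (auto cong: measurable_cong_sets)
  qed
  have \<Gamma>_le: "\<bar>\<Gamma> z \<nu> - \<Gamma> z' \<nu>\<bar> \<le> b"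
    if "\<nu> \<in> space (prob_algebra S)" "\<And>\<xi>. \<xi> \<in> space S \<Longrightarrow> \<bar>\<gamma> z \<xi> - \<gamma> z' \<xi>\<bar> \<le> b" for z z' \<nu> b
  proof -
    interpret \<nu>: prob_space \<nu> using that by (simp add: space_prob_algebra)
    have sets: "sets \<nu> = sets S" using that by (simp add: space_prob_algebra)
    have "\<bar>\<Gamma> z \<nu> - \<Gamma> z' \<nu>\<bar> = \<bar>\<integral>\<xi>. \<gamma> z \<xi> - \<gamma> z' \<xi> \<partial>\<nu>\<bar>"
      unfolding \<Gamma>_def using int\<gamma>[OF that(1)] by simp
    also have "\<dots> \<le> (\<integral>\<xi>. \<bar>\<gamma> z \<xi> - \<gamma> z' \<xi>\<bar> \<partial>\<nu>)"
      by (rule integral_abs_bound)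
    also have "\<dots> \<le> (\<integral>\<xi>. b \<partial>\<nu>)"
      using int\<gamma>[OF that(1)] that(2) sets_eq_imp_space_eq[OF sets]
      by (intro integral_mono) auto
    finally show ?thesis by (simp add: \<nu>.prob_space)
  qed
  have \<Gamma>_D: "\<bar>\<Gamma> (Z \<omega>) \<nu>\<bar> \<le> D \<omega>" if "\<nu> \<in> space (prob_algebra S)" "\<omega> \<in> space M" for \<nu> \<omega>
  proof -
    interpret \<nu>: prob_space \<nu> using that by (simp add: space_prob_algebra)
    have sets: "sets \<nu> = sets S" using that by (simp add: space_prob_algebra)
    have "\<bar>\<Gamma> (Z \<omega>) \<nu>\<bar> \<le> (\<integral>\<xi>. \<bar>\<gamma> (Z \<omega>) \<xi>\<bar> \<partial>\<nu>)"
      unfolding \<Gamma>_def by (rule integral_abs_bound)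
    also have "\<dots> \<le> (\<integral>\<xi>. D \<omega> \<partial>\<nu>)"
      using int\<gamma>[OF that(1)] D(2)[OF that(2)] sets_eq_imp_space_eq[OF sets]
      by (intro integral_mono) auto
    finally show ?thesis by (simp add: \<nu>.prob_space)
  qed
  have \<Gamma>_meas: "(\<lambda>\<omega>. \<Gamma> (Z \<omega>) (l \<omega>)) \<in> borel_measurable M" if l: "l \<in> measurable M (prob_algebra S)" for l
    unfolding \<Gamma>_def
    by (rule integral_kernel_measurable[OF joint l]) (rule int\<gamma>[OF measurable_space[OF l]])
  have \<Gamma>_int: "integrable M (\<lambda>\<omega>. \<Gamma> (Z \<omega>) (l \<omega>))" if l: "l \<in> measurable M (prob_algebra S)" for l
    using D(1) \<Gamma>_meas[OF l]
  proof (rule Bochner_Integration.integrable_bound)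
    show "AE \<omega> in M. norm (\<Gamma> (Z \<omega>) (l \<omega>)) \<le> norm (D \<omega>)"
      using \<Gamma>_D[OF measurable_space[OF l]] by (intro AE_I2) (fastforce intro: order_trans)
  qed
  obtain a :: "nat \<Rightarrow> 'z" and V where V: "\<And>j. open (V j)" "\<And>z. \<exists>j. z \<in> V j"
    "\<And>j z \<xi>. z \<in> V j \<Longrightarrow> \<xi> \<in> space S \<Longrightarrow> \<bar>\<gamma> z \<xi> - \<gamma> (a j) \<xi>\<bar> < e"
    using countable_uniform_cover[OF cont e] by blast
  \<comment> \<open>Taking the least index makes the choice of the centre measurable, for
    \<open>M\<close> rather than for \<open>F\<close>.\<close>
  define \<kappa> where "\<kappa> \<omega> = (LEAST j. Z \<omega> \<in> V j)" for \<omega>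
  have [measurable]: "\<kappa> \<in> measurable M (count_space UNIV)"
    unfolding \<kappa>_def using V(1) by (intro measurable_Least pred_sets2[OF _ Z]) auto
  have \<kappa>: "\<bar>\<gamma> (Z \<omega>) \<xi> - \<gamma> (a (\<kappa> \<omega>)) \<xi>\<bar> \<le> e" if "\<xi> \<in> space S" for \<omega> \<xi>
    using V(3)[OF LeastI_ex[OF V(2)] that] by (simp add: \<kappa>_def less_imp_le)
  have [measurable]: "D \<in> borel_measurable M" using D(1) by auto
  have "(\<lambda>n. \<integral>\<omega>. indicator {n..} (\<kappa> \<omega>) * D \<omega> \<partial>M) \<longlonglongrightarrow> (\<integral>\<omega>. 0 \<partial>M)"
  proof (rule integral_dominated_convergence[where w = "\<lambda>\<omega>. \<bar>D \<omega>\<bar>"])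
    show "AE \<omega> in M. (\<lambda>n. indicator {n..} (\<kappa> \<omega>) * D \<omega>) \<longlonglongrightarrow> 0"
    proof (rule AE_I2)
      fix \<omega>
      have "\<forall>\<^sub>F n in sequentially. indicator {n..} (\<kappa> \<omega>) * D \<omega> = 0"
        using eventually_gt_at_top[of "\<kappa> \<omega>"] by eventually_elim simp
      then show "(\<lambda>n. indicator {n..} (\<kappa> \<omega>) * D \<omega>) \<longlonglongrightarrow> 0" by (rule tendsto_eventually)
    qed
  qed (use D(1) in \<open>auto simp: indicator_def intro!: AE_I2\<close>)
  then have "\<forall>\<^sub>F n in sequentially. (\<integral>\<omega>. indicator {n..} (\<kappa> \<omega>) * D \<omega> \<partial>M) < e"
    using e by (intro order_tendstoD(2)[where a = e]) auto
  \<comment> \<open>Only the centres with index below \<open>n\<close> have to be controlled; on the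
    remaining scenarios the majorant has integral less than \<open>e\<close>.\<close>
  then obtain n where n: "(\<integral>\<omega>. indicator {n..} (\<kappa> \<omega>) * D \<omega> \<partial>M) < e"
    by (auto simp: eventually_sequentially)
  \<comment> \<open>Rounding the integrals of \<open>\<gamma> (a j)\<close> for \<open>j < n\<close>
    leaves countably many keys, and two kernel values with equal keys have integrals of each of
    these functions that differ by less than \<open>e\<close>.\<close>
  define key where "key \<omega> = map (\<lambda>j. \<lfloor>\<Gamma> (a j) (k \<omega>) / e\<rfloor>) [0..<n]" for \<omega>
  have key_meas: "key \<in> measurable F (count_space UNIV)"
  proof -
    have [measurable]: "(\<lambda>\<omega>. \<Gamma> (a j) (k \<omega>)) \<in> borel_measurable F" for j
      unfolding \<Gamma>_def
      by (rule measurable_compose[OF measurable_prob_algebraD[OF k] integral_measurable_subprob_algebra[OF \<gamma>_meas]])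
    have fl: "(\<lambda>\<omega>. \<lfloor>\<Gamma> (a j) (k \<omega>) / e\<rfloor>) \<in> measurable F (count_space UNIV)" for j
      by measurable
    have "{\<omega>\<in>space F. \<lfloor>\<Gamma> (a j) (k \<omega>) / e\<rfloor> = l ! j} \<in> sets F" for j l
      using measurable_sets[OF fl, of "{l ! j}" j] by (simp add: vimage_def Int_def conj_commute)
    then have "{\<omega>\<in>space F. \<forall>j\<in>{..<n}. \<lfloor>\<Gamma> (a j) (k \<omega>) / e\<rfloor> = l ! j} \<in> sets F" for l
      by (intro sets.sets_Collect_finite_All) auto
    moreover have map_eq: "map g [0..<n] = l \<longleftrightarrow> length l = n \<and> (\<forall>j\<in>{..<n}. g j = l ! j)" for g :: "nat \<Rightarrow> int" and l
      by (auto simp: list_eq_iff_nth_eq)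
    ultimately have "{\<omega>\<in>space F. key \<omega> = l} \<in> sets F" for l
      unfolding key_def map_eq by (cases "length l = n") simp_all
    moreover have "key -` {l} \<inter> space F = {\<omega>\<in>space F. key \<omega> = l}" for l
      by blast
    ultimately have "key -` {l} \<inter> space F \<in> sets F" for l by simp
    then show ?thesis by (subst measurable_count_space_eq2_countable) auto
  qed
  \<comment> \<open>On each cell the kernel is frozen at the value it takes at one scenario of that
    cell.\<close>
  define r where "r l = k (SOME \<omega>. \<omega> \<in> space M \<and> key \<omega> = l)" for l
  have r: "\<exists>\<omega>'\<in>space M. key \<omega>' = key \<omega> \<and> r (key \<omega>) = k \<omega>'" if "\<omega> \<in> space M" for \<omega>
    unfolding r_def using someI[of "\<lambda>\<omega>'. \<omega>' \<in> space M \<and> key \<omega>' = key \<omega>" \<omega>] that by auto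
  have r_space: "r (key \<omega>) \<in> space (prob_algebra S)" if "\<omega> \<in> space M" for \<omega>
    using r[OF that] measurable_space[OF kM] by metis
  have key_M: "key \<in> measurable M (count_space UNIV)"
    by (rule measurable_from_subalg[OF sub key_meas])
  have rM: "(\<lambda>\<omega>. r (key \<omega>)) \<in> measurable M (prob_algebra S)"
  proof -
    \<comment> \<open>For a key that never occurs, \<open>r\<close> may fail to be a probability
      measure on \<open>S\<close>, while composition through \<open>count_space UNIV\<close>
      requires an admissible value at every list; a fixed value of \<open>k\<close> fills
      in.\<close>
    define r' where "r' l = (if r l \<in> space (prob_algebra S) then r l else k (SOME \<omega>. \<omega> \<in> space M))" for l
    have "(SOME \<omega>. \<omega> \<in> space M) \<in> space M"
      using not_empty by (simp add: some_in_eq)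
    then have "r' l \<in> space (prob_algebra S)" for l
      using measurable_space[OF kM] by (simp add: r'_def)
    then have "(\<lambda>\<omega>. r' (key \<omega>)) \<in> measurable M (prob_algebra S)"
      by (intro measurable_compose[OF key_M]) auto
    also have "?this \<longleftrightarrow> ?thesis"
      using r_space by (intro measurable_cong) (simp add: r'_def)
    finally show ?thesis .
  qed
  \<comment> \<open>For \<open>\<kappa> \<omega> < n\<close> three errors of size \<open>e\<close>
    add up: from \<open>Z \<omega>\<close> to the centre, between the two kernel values, and back.
    Otherwise both integrals are bounded by \<open>D \<omega>\<close>, whence the factor 2.\<close>
  have close: "\<Gamma> (Z \<omega>) (r (key \<omega>)) \<le> \<Gamma> (Z \<omega>) (k \<omega>) + 3 * e + 2 * (indicator {n..} (\<kappa> \<omega>) * D \<omega>)"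
    if \<omega>: "\<omega> \<in> space M" for \<omega>
  proof (cases "\<kappa> \<omega> < n")
    case True
    obtain \<omega>' where \<omega>': "\<omega>' \<in> space M" "key \<omega>' = key \<omega>" "r (key \<omega>) = k \<omega>'"
      using r[OF \<omega>] by blast
    have "\<lfloor>\<Gamma> (a (\<kappa> \<omega>)) (k \<omega>') / e\<rfloor> = \<lfloor>\<Gamma> (a (\<kappa> \<omega>)) (k \<omega>) / e\<rfloor>"
      using \<omega>'(2) True by (auto simp: key_def)
    then have "\<Gamma> (a (\<kappa> \<omega>)) (k \<omega>') / e < \<Gamma> (a (\<kappa> \<omega>)) (k \<omega>) / e + 1"
      by linarith
    then have "\<Gamma> (a (\<kappa> \<omega>)) (k \<omega>') < \<Gamma> (a (\<kappa> \<omega>)) (k \<omega>) + e"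
      using e by (simp add: field_simps)
    moreover have "\<bar>\<Gamma> (Z \<omega>) \<nu> - \<Gamma> (a (\<kappa> \<omega>)) \<nu>\<bar> \<le> e" if "\<nu> \<in> space (prob_algebra S)" for \<nu>
      using \<Gamma>_le[OF that \<kappa>] .
    from this[OF measurable_space[OF kM \<omega>]] this[OF measurable_space[OF kM \<omega>'(1)]]
    have "\<bar>\<Gamma> (Z \<omega>) (k \<omega>) - \<Gamma> (a (\<kappa> \<omega>)) (k \<omega>)\<bar> \<le> e" "\<bar>\<Gamma> (Z \<omega>) (k \<omega>') - \<Gamma> (a (\<kappa> \<omega>)) (k \<omega>')\<bar> \<le> e" .
    ultimately show ?thesis
      using True by (simp add: \<omega>'(3))
  next
    case False
    then show ?thesis
      using \<Gamma>_D[OF measurable_space[OF kM \<omega>] \<omega>] \<Gamma>_D[OF r_space[OF \<omega>] \<omega>] e by simp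
  qed
  have "0 \<le> (\<integral>\<omega>. \<Gamma> (Z \<omega>) (r (key \<omega>)) - c \<omega> \<partial>M)"
  proof (rule integral_partition_nonneg[where \<kappa> = "\<lambda>\<omega>. to_nat (key \<omega>)"])
    show "integrable M (\<lambda>\<omega>. \<Gamma> (Z \<omega>) (r (key \<omega>)) - c \<omega>)"
      using \<Gamma>_int[OF rM] c by simp
    show "(\<lambda>\<omega>. to_nat (key \<omega>)) \<in> measurable M (count_space UNIV)"
      by (rule measurable_compose[OF key_M]) auto
    fix i
    let ?A = "{\<omega>\<in>space M. to_nat (key \<omega>) = i}"
    show "0 \<le> (\<integral>\<omega>. indicator {i} (to_nat (key \<omega>)) * (\<Gamma> (Z \<omega>) (r (key \<omega>)) - c \<omega>) \<partial>M)"
    proof (cases "?A = {}")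
      case True
      then have "(\<integral>\<omega>. indicator {i} (to_nat (key \<omega>)) * (\<Gamma> (Z \<omega>) (r (key \<omega>)) - c \<omega>) \<partial>M) = (\<integral>\<omega>. 0 \<partial>M)"
        by (intro Bochner_Integration.integral_cong) auto
      then show ?thesis by simp
    next
      case False
      then obtain \<omega>0 where \<omega>0: "\<omega>0 \<in> space M" "to_nat (key \<omega>0) = i" by auto
      define \<mu> where "\<mu> = r (key \<omega>0)"
      have \<mu>: "\<mu> \<in> space (prob_algebra S)" unfolding \<mu>_def by (rule r_space[OF \<omega>0(1)])
      have key_eq: "key \<omega> = key \<omega>0" if "to_nat (key \<omega>) = i" for \<omega>
        using that \<omega>0(2) by (metis from_nat_to_nat)
      have A: "?A \<in> sets F"
        using measurable_sets[OF key_meas, of "to_nat -` {i}"] by (simp add: spF vimage_def Int_def conj_commute)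
      have "(\<integral>\<omega>. indicator {i} (to_nat (key \<omega>)) * (\<Gamma> (Z \<omega>) (r (key \<omega>)) - c \<omega>) \<partial>M)
        = (LINT \<omega>:?A|M. \<Gamma> (Z \<omega>) \<mu> - c \<omega>)"
        unfolding set_lebesgue_integral_def
        by (intro Bochner_Integration.integral_cong) (auto simp: \<mu>_def indicator_def dest!: key_eq[OF sym])
      also have "\<dots> = (LINT \<omega>:?A|M. \<Gamma> (Z \<omega>) \<mu>) - (LINT \<omega>:?A|M. c \<omega>)"
      proof (rule set_integral_diff)
        have "?A \<in> sets M" using A setsF by blast
        moreover have "integrable M (\<lambda>\<omega>. \<Gamma> (Z \<omega>) \<mu>)"
          using \<mu> by (intro \<Gamma>_int) simp
        ultimately show "set_integrable M ?A (\<lambda>\<omega>. \<Gamma> (Z \<omega>) \<mu>)" "set_integrable M ?A c"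
          using c by (auto intro: integrable_imp_set_integrable)
      qed
      also have "\<dots> \<ge> 0"
        using le[OF \<mu> A] by (simp add: \<Gamma>_def)
      finally show ?thesis .
    qed
  qed
  then have "(\<integral>\<omega>. c \<omega> \<partial>M) \<le> (\<integral>\<omega>. \<Gamma> (Z \<omega>) (r (key \<omega>)) \<partial>M)"
    using \<Gamma>_int[OF rM] c by simp
  also have "\<dots> \<le> (\<integral>\<omega>. \<Gamma> (Z \<omega>) (k \<omega>) + 3 * e + 2 * (indicator {n..} (\<kappa> \<omega>) * D \<omega>) \<partial>M)"
  proof (rule integral_mono)
    have "integrable M (\<lambda>\<omega>. indicator {n..} (\<kappa> \<omega>) * D \<omega>)"
      using D(1) by (rule Bochner_Integration.integrable_bound) (auto simp: indicator_def)
    then show "integrable M (\<lambda>\<omega>. \<Gamma> (Z \<omega>) (k \<omega>) + 3 * e + 2 * (indicator {n..} (\<kappa> \<omega>) * D \<omega>))"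
      using \<Gamma>_int[OF kM] by simp
  qed (use \<Gamma>_int[OF rM] close in auto)
  also have "\<dots> = (\<integral>\<omega>. \<Gamma> (Z \<omega>) (k \<omega>) \<partial>M) + 3 * e + 2 * (\<integral>\<omega>. indicator {n..} (\<kappa> \<omega>) * D \<omega> \<partial>M)"
  proof -
    have "integrable M (\<lambda>\<omega>. indicator {n..} (\<kappa> \<omega>) * D \<omega>)"
      using D(1) by (rule Bochner_Integration.integrable_bound) (auto simp: indicator_def)
    then show ?thesis
      using \<Gamma>_int[OF kM] by (simp add: prob_space)
  qed
  also have "\<dots> \<le> (\<integral>\<omega>. \<Gamma> (Z \<omega>) (k \<omega>) \<partial>M) + e'"
    using n by (simp add: e_def)
  finally show "(\<integral>\<omega>. c \<omega> \<partial>M) \<le> (\<integral>\<omega>. (\<integral>\<xi>. \<gamma> (Z \<omega>) \<xi> \<partial>k \<omega>) \<partial>M) + e'"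
    by (simp add: \<Gamma>_def)
qed

section \<open>Jointly measurable conditional expectations\<close>

text \<open>Tested on a set of \<open>F\<close>, the claim is monotone convergence, used for
  \<open>f\<close> and for the conditional expectations, whose monotonicity is known almost
  everywhere.\<close>

lemma (in sigma_finite_subalgebra) nn_cond_exp_SUP:
  fixes f :: "nat \<Rightarrow> 'a \<Rightarrow> ennreal"
  assumes [measurable]: "\<And>i. f i \<in> borel_measurable M" and inc: "\<And>i x. x \<in> space M \<Longrightarrow> f i x \<le> f (Suc i) x"
  shows "AE x in M. (SUP i. nn_cond_exp M F (f i) x) = nn_cond_exp M F (\<lambda>x. SUP i. f i x) x"
proof (rule nn_cond_exp_charact)
  fix A assume [measurable]: "A \<in> sets F"
  then have [measurable]: "A \<in> sets M" using subalg by (auto simp: subalgebra_def)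
  have mono: "AE x in M. nn_cond_exp M F (f i) x \<le> nn_cond_exp M F (f (Suc i)) x" for i
    using inc by (intro nn_cond_exp_mono) auto
  have "(\<integral>\<^sup>+x\<in>A. (SUP i. f i x) \<partial>M) = (\<integral>\<^sup>+x. (SUP i. indicator A x * f i x) \<partial>M)"
    by (simp add: SUP_mult_left_ennreal mult.commute)
  also have "\<dots> = (SUP i. \<integral>\<^sup>+x. indicator A x * f i x \<partial>M)"
    using inc by (intro nn_integral_monotone_convergence_SUP_AE) (auto intro!: mult_left_mono)
  also have "\<dots> = (SUP i. \<integral>\<^sup>+x. indicator A x * nn_cond_exp M F (f i) x \<partial>M)"
    by (simp add: nn_cond_exp_intg)
  also have "\<dots> = (\<integral>\<^sup>+x. (SUP i. indicator A x * nn_cond_exp M F (f i) x) \<partial>M)"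
  proof (rule nn_integral_monotone_convergence_SUP_AE[symmetric])
    show "AE x in M. indicator A x * nn_cond_exp M F (f i) x \<le> indicator A x * nn_cond_exp M F (f (Suc i)) x" for i
      using mono[of i] by eventually_elim (rule mult_left_mono, auto)
  qed auto
  also have "\<dots> = (\<integral>\<^sup>+x\<in>A. (SUP i. nn_cond_exp M F (f i) x) \<partial>M)"
    by (simp add: SUP_mult_left_ennreal mult.commute)
  finally show "(\<integral>\<^sup>+x\<in>A. (SUP i. f i x) \<partial>M) = (\<integral>\<^sup>+x\<in>A. (SUP i. nn_cond_exp M F (f i) x) \<partial>M)" .
qed auto

text \<open>The exceptional null set of times in the last clause does not depend on \<open>\<xi>\<close>.\<close>

definition cond_version ::
  "'w measure \<Rightarrow> (real \<Rightarrow> 'w measure) \<Rightarrow> real \<Rightarrow> 'x measure \<Rightarrow>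
   ((real \<times> 'x) \<times> 'w \<Rightarrow> ennreal) \<Rightarrow> ((real \<times> 'x) \<times> 'w \<Rightarrow> ennreal) \<Rightarrow> bool" where
  "cond_version M G T S g f \<longleftrightarrow>
     f \<in> borel_measurable ((restrict_space lborel {0..T} \<Otimes>\<^sub>M S) \<Otimes>\<^sub>M M) \<and>
     (\<forall>t\<in>{0..T}. \<forall>\<xi>\<in>space S. (\<lambda>\<omega>. f ((t, \<xi>), \<omega>)) \<in> borel_measurable (G t)) \<and>
     (AE t in lborel. t \<in> {0..T} \<longrightarrow> (\<forall>\<xi>\<in>space S. AE \<omega> in M.
        f ((t, \<xi>), \<omega>) = nn_cond_exp M (G t) (\<lambda>\<omega>. g ((t, \<xi>), \<omega>)) \<omega>))"

lemma cond_versionD: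
  assumes "cond_version M G T S g f"
  shows "f \<in> borel_measurable ((restrict_space lborel {0..T} \<Otimes>\<^sub>M S) \<Otimes>\<^sub>M M)"
    and "\<And>t \<xi>. t \<in> {0..T} \<Longrightarrow> \<xi> \<in> space S \<Longrightarrow> (\<lambda>\<omega>. f ((t, \<xi>), \<omega>)) \<in> borel_measurable (G t)"
    and "AE t in lborel. t \<in> {0..T} \<longrightarrow> (\<forall>\<xi>\<in>space S. AE \<omega> in M.
        f ((t, \<xi>), \<omega>) = nn_cond_exp M (G t) (\<lambda>\<omega>. g ((t, \<xi>), \<omega>)) \<omega>)"
  using assms unfolding cond_version_def by blast+

lemma cond_versionI:
  assumes "f \<in> borel_measurable ((restrict_space lborel {0..T} \<Otimes>\<^sub>M S) \<Otimes>\<^sub>M M)"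
    and "\<And>t \<xi>. t \<in> {0..T} \<Longrightarrow> \<xi> \<in> space S \<Longrightarrow> (\<lambda>\<omega>. f ((t, \<xi>), \<omega>)) \<in> borel_measurable (G t)"
    and "AE t in lborel. t \<in> {0..T} \<longrightarrow> (\<forall>\<xi>\<in>space S. AE \<omega> in M.
        f ((t, \<xi>), \<omega>) = nn_cond_exp M (G t) (\<lambda>\<omega>. g ((t, \<xi>), \<omega>)) \<omega>)"
  shows "cond_version M G T S g f"
  using assms unfolding cond_version_def by blast

context prob_space
begin

lemma subalgebra_sigma_finite: "subalgebra M F \<Longrightarrow> sigma_finite_subalgebra M F"
  by (rule finite_measure_subalgebra_is_sigma_finite) unfold_locales

context
  fixes G :: "real \<Rightarrow> 'a measure" and T :: real and S :: "'x measure"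
  assumes sub: "\<And>t. t \<in> {0..T} \<Longrightarrow> subalgebra M (G t)"
begin

abbreviation "\<Theta> \<equiv> restrict_space lborel {0..T} \<Otimes>\<^sub>M S"

section \<open>Closure properties of versions that are measurable in all variables\<close>

lemma section_measurable:
  assumes "g \<in> borel_measurable (\<Theta> \<Otimes>\<^sub>M M)" "t \<in> {0..T}" "\<xi> \<in> space S"
  shows "(\<lambda>\<omega>. g ((t, \<xi>), \<omega>)) \<in> borel_measurable M"
proof -
  have "(t, \<xi>) \<in> space \<Theta>" using assms by (simp add: space_pair_measure space_restrict_space)
  from measurable_compose[OF measurable_Pair1'[OF this] assms(1)] show ?thesis .
qed

lemma cond_version_cong:
  assumes "cond_version M G T S g f" and "\<And>x. x \<in> space (\<Theta> \<Otimes>\<^sub>M M) \<Longrightarrow> g' x = g x"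
    and g: "g \<in> borel_measurable (\<Theta> \<Otimes>\<^sub>M M)" and g': "g' \<in> borel_measurable (\<Theta> \<Otimes>\<^sub>M M)"
  shows "cond_version M G T S g' f"
proof -
  have "AE \<omega> in M. nn_cond_exp M (G t) (\<lambda>\<omega>. g ((t, \<xi>), \<omega>)) \<omega> = nn_cond_exp M (G t) (\<lambda>\<omega>. g' ((t, \<xi>), \<omega>)) \<omega>"
    if "t \<in> {0..T}" "\<xi> \<in> space S" for t \<xi>
    using assms(2) that
    by (intro sigma_finite_subalgebra.nn_cond_exp_cong[OF subalgebra_sigma_finite[OF sub]]
        section_measurable g g') (auto simp: space_pair_measure space_restrict_space)
  note cong = this
  have "AE t in lborel. t \<in> {0..T} \<longrightarrow> (\<forall>\<xi>\<in>space S. AE \<omega> in M.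
        f ((t, \<xi>), \<omega>) = nn_cond_exp M (G t) (\<lambda>\<omega>. g' ((t, \<xi>), \<omega>)) \<omega>)"
    using cond_versionD(3)[OF assms(1)]
  proof eventually_elim
    case (elim t)
    show ?case
    proof (intro impI ballI)
      fix \<xi> assume t: "t \<in> {0..T}" "\<xi> \<in> space S"
      from elim t have "AE \<omega> in M. f ((t, \<xi>), \<omega>) = nn_cond_exp M (G t) (\<lambda>\<omega>. g ((t, \<xi>), \<omega>)) \<omega>" by blast
      with cong[OF t] show "AE \<omega> in M. f ((t, \<xi>), \<omega>) = nn_cond_exp M (G t) (\<lambda>\<omega>. g' ((t, \<xi>), \<omega>)) \<omega>"
        by eventually_elim simp
    qed
  qed
  then show ?thesis
    by (intro cond_versionI cond_versionD[OF assms(1)])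
qed

lemma cond_version_add:
  assumes "cond_version M G T S g f" "cond_version M G T S g' f'"
    and g: "g \<in> borel_measurable (\<Theta> \<Otimes>\<^sub>M M)" and g': "g' \<in> borel_measurable (\<Theta> \<Otimes>\<^sub>M M)"
  shows "cond_version M G T S (\<lambda>x. g x + g' x) (\<lambda>x. f x + f' x)"
proof -
  have add: "AE \<omega> in M. nn_cond_exp M (G t) (\<lambda>\<omega>. g ((t, \<xi>), \<omega>)) \<omega> + nn_cond_exp M (G t) (\<lambda>\<omega>. g' ((t, \<xi>), \<omega>)) \<omega>
      = nn_cond_exp M (G t) (\<lambda>\<omega>. g ((t, \<xi>), \<omega>) + g' ((t, \<xi>), \<omega>)) \<omega>"
    if "t \<in> {0..T}" "\<xi> \<in> space S" for t \<xi>
    using that by (intro sigma_finite_subalgebra.nn_cond_exp_sum[OF subalgebra_sigma_finite[OF sub]]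
        section_measurable g g')
  have f: "AE t in lborel. t \<in> {0..T} \<longrightarrow> (\<forall>\<xi>\<in>space S. AE \<omega> in M.
        f ((t, \<xi>), \<omega>) = nn_cond_exp M (G t) (\<lambda>\<omega>. g ((t, \<xi>), \<omega>)) \<omega>)"
    and f': "AE t in lborel. t \<in> {0..T} \<longrightarrow> (\<forall>\<xi>\<in>space S. AE \<omega> in M.
        f' ((t, \<xi>), \<omega>) = nn_cond_exp M (G t) (\<lambda>\<omega>. g' ((t, \<xi>), \<omega>)) \<omega>)"
    using assms(1,2) by (blast dest: cond_versionD(3))+
  have "AE t in lborel. t \<in> {0..T} \<longrightarrow> (\<forall>\<xi>\<in>space S. AE \<omega> in M.
        f ((t, \<xi>), \<omega>) + f' ((t, \<xi>), \<omega>)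
        = nn_cond_exp M (G t) (\<lambda>\<omega>. g ((t, \<xi>), \<omega>) + g' ((t, \<xi>), \<omega>)) \<omega>)"
    using f f'
  proof eventually_elim
    case (elim t)
    show ?case
    proof (intro impI ballI)
      fix \<xi> assume t: "t \<in> {0..T}" "\<xi> \<in> space S"
      from elim t have "AE \<omega> in M. f ((t, \<xi>), \<omega>) = nn_cond_exp M (G t) (\<lambda>\<omega>. g ((t, \<xi>), \<omega>)) \<omega>"
        "AE \<omega> in M. f' ((t, \<xi>), \<omega>) = nn_cond_exp M (G t) (\<lambda>\<omega>. g' ((t, \<xi>), \<omega>)) \<omega>" by blast+
      with add[OF t] show "AE \<omega> in M. f ((t, \<xi>), \<omega>) + f' ((t, \<xi>), \<omega>)
        = nn_cond_exp M (G t) (\<lambda>\<omega>. g ((t, \<xi>), \<omega>) + g' ((t, \<xi>), \<omega>)) \<omega>"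
        by eventually_elim simp
    qed
  qed
  then show ?thesis
    by (intro cond_versionI borel_measurable_add cond_versionD(1,2)[OF assms(1)] cond_versionD(1,2)[OF assms(2)])
qed

lemma cond_version_mult:
  assumes "cond_version M G T S g f" and g: "g \<in> borel_measurable (\<Theta> \<Otimes>\<^sub>M M)"
  shows "cond_version M G T S (\<lambda>x. c * g x) (\<lambda>x. c * f x)"
proof -
  have mult: "AE \<omega> in M. c * nn_cond_exp M (G t) (\<lambda>\<omega>. g ((t, \<xi>), \<omega>)) \<omega>
      = nn_cond_exp M (G t) (\<lambda>\<omega>. c * g ((t, \<xi>), \<omega>)) \<omega>"
    if "t \<in> {0..T}" "\<xi> \<in> space S" for t \<xi>
    using that by (intro sigma_finite_subalgebra.nn_cond_exp_prod[OF subalgebra_sigma_finite[OF sub]]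
        section_measurable g) auto
  have "AE t in lborel. t \<in> {0..T} \<longrightarrow> (\<forall>\<xi>\<in>space S. AE \<omega> in M.
        f ((t, \<xi>), \<omega>) = nn_cond_exp M (G t) (\<lambda>\<omega>. g ((t, \<xi>), \<omega>)) \<omega>)"
    using assms(1) by (blast dest: cond_versionD(3))
  then have "AE t in lborel. t \<in> {0..T} \<longrightarrow> (\<forall>\<xi>\<in>space S. AE \<omega> in M.
        c * f ((t, \<xi>), \<omega>) = nn_cond_exp M (G t) (\<lambda>\<omega>. c * g ((t, \<xi>), \<omega>)) \<omega>)"
  proof eventually_elim
    case (elim t)
    show ?case
    proof (intro impI ballI)
      fix \<xi> assume t: "t \<in> {0..T}" "\<xi> \<in> space S"
      from elim t have "AE \<omega> in M. f ((t, \<xi>), \<omega>) = nn_cond_exp M (G t) (\<lambda>\<omega>. g ((t, \<xi>), \<omega>)) \<omega>" by blast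
      with mult[OF t] show "AE \<omega> in M. c * f ((t, \<xi>), \<omega>) = nn_cond_exp M (G t) (\<lambda>\<omega>. c * g ((t, \<xi>), \<omega>)) \<omega>"
        by eventually_elim simp
    qed
  qed
  then show ?thesis
    by (intro cond_versionI borel_measurable_times_ennreal borel_measurable_const cond_versionD(1,2)[OF assms(1)])
qed

text \<open>Countably many exceptional sets of times may be united, and so may the null sets of
  scenarios at a fixed time and \<xi>. No union over \<xi> is formed, so the exceptional times
  remain independent of \<xi>.\<close>

lemma cond_version_SUP:
  assumes "\<And>i::nat. cond_version M G T S (g i) (f i)"
    and g: "\<And>i. g i \<in> borel_measurable (\<Theta> \<Otimes>\<^sub>M M)"
    and inc: "\<And>i x. x \<in> space (\<Theta> \<Otimes>\<^sub>M M) \<Longrightarrow> g i x \<le> g (Suc i) x"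
  shows "cond_version M G T S (\<lambda>x. SUP i. g i x) (\<lambda>x. SUP i. f i x)"
proof -
  have SUP: "AE \<omega> in M. (SUP i. nn_cond_exp M (G t) (\<lambda>\<omega>. g i ((t, \<xi>), \<omega>)) \<omega>)
      = nn_cond_exp M (G t) (\<lambda>\<omega>. SUP i. g i ((t, \<xi>), \<omega>)) \<omega>"
    if "t \<in> {0..T}" "\<xi> \<in> space S" for t \<xi>
    using that by (intro sigma_finite_subalgebra.nn_cond_exp_SUP[OF subalgebra_sigma_finite[OF sub]]
        section_measurable g inc) (auto simp: space_pair_measure space_restrict_space)
  have "AE t in lborel. \<forall>i. t \<in> {0..T} \<longrightarrow> (\<forall>\<xi>\<in>space S. AE \<omega> in M.
        f i ((t, \<xi>), \<omega>) = nn_cond_exp M (G t) (\<lambda>\<omega>. g i ((t, \<xi>), \<omega>)) \<omega>)"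
    unfolding AE_all_countable using assms(1) by (blast dest: cond_versionD(3))
  then have "AE t in lborel. t \<in> {0..T} \<longrightarrow> (\<forall>\<xi>\<in>space S. AE \<omega> in M.
        (SUP i. f i ((t, \<xi>), \<omega>)) = nn_cond_exp M (G t) (\<lambda>\<omega>. SUP i. g i ((t, \<xi>), \<omega>)) \<omega>)"
  proof eventually_elim
    case (elim t)
    show ?case
    proof (intro impI ballI)
      fix \<xi> assume t: "t \<in> {0..T}" "\<xi> \<in> space S"
      from elim t have "AE \<omega> in M. \<forall>i. f i ((t, \<xi>), \<omega>) = nn_cond_exp M (G t) (\<lambda>\<omega>. g i ((t, \<xi>), \<omega>)) \<omega>"
        by (simp add: AE_all_countable)
      with SUP[OF t] show "AE \<omega> in M. (SUP i. f i ((t, \<xi>), \<omega>)) = nn_cond_exp M (G t) (\<lambda>\<omega>. SUP i. g i ((t, \<xi>), \<omega>)) \<omega>"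
        by eventually_elim simp
    qed
  qed
  then show ?thesis
    by (intro cond_versionI borel_measurable_SUP cond_versionD(1,2)[OF assms(1)]) auto
qed

lemma cond_version_compl:
  assumes E: "cond_version M G T S (indicator E) f" and meas: "E \<in> sets (\<Theta> \<Otimes>\<^sub>M M)"
  shows "cond_version M G T S (indicator (space (\<Theta> \<Otimes>\<^sub>M M) - E)) (\<lambda>x. 1 - f x)"
proof -
  let ?E = "space (\<Theta> \<Otimes>\<^sub>M M) - E"
  have compl: "AE \<omega> in M. nn_cond_exp M (G t) (\<lambda>\<omega>. indicator ?E ((t, \<xi>), \<omega>)) \<omega>
      = 1 - nn_cond_exp M (G t) (\<lambda>\<omega>. indicator E ((t, \<xi>), \<omega>)) \<omega>"
    if t: "t \<in> {0..T}" "\<xi> \<in> space S" for t \<xi>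
  proof -
    interpret sigma_finite_subalgebra M "G t"
      by (rule subalgebra_sigma_finite[OF sub[OF t(1)]])
    have m: "(\<lambda>\<omega>. indicator E ((t, \<xi>), \<omega>) :: ennreal) \<in> borel_measurable M"
      "(\<lambda>\<omega>. indicator ?E ((t, \<xi>), \<omega>) :: ennreal) \<in> borel_measurable M"
      by (rule section_measurable[OF borel_measurable_indicator[OF meas] t])
        (rule section_measurable[OF borel_measurable_indicator[OF sets.compl_sets[OF meas]] t])
    have "AE \<omega> in M. 1 = nn_cond_exp M (G t) (\<lambda>\<omega>. 1) \<omega>"
      by (rule nn_cond_exp_F_meas) auto
    moreover have "AE \<omega> in M. nn_cond_exp M (G t) (\<lambda>\<omega>. 1) \<omega>
      = nn_cond_exp M (G t) (\<lambda>\<omega>. indicator E ((t, \<xi>), \<omega>) + indicator ?E ((t, \<xi>), \<omega>)) \<omega>"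
    proof (rule nn_cond_exp_cong)
      show "AE \<omega> in M. 1 = (indicator E ((t, \<xi>), \<omega>) + indicator ?E ((t, \<xi>), \<omega>) :: ennreal)"
      proof (rule AE_I2)
        fix \<omega> assume "\<omega> \<in> space M"
        then have "((t, \<xi>), \<omega>) \<in> space (\<Theta> \<Otimes>\<^sub>M M)"
          using t by (simp add: space_pair_measure space_restrict_space)
        then show "1 = (indicator E ((t, \<xi>), \<omega>) + indicator ?E ((t, \<xi>), \<omega>) :: ennreal)"
          by (cases "((t, \<xi>), \<omega>) \<in> E") simp_all
      qed
    qed (use m in simp_all)
    moreover note nn_cond_exp_sum[OF m]
    ultimately show ?thesis
    proof eventually_elim
      case (elim \<omega>)
      let ?a = "nn_cond_exp M (G t) (\<lambda>\<omega>. indicator E ((t, \<xi>), \<omega>)) \<omega>"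
      let ?b = "nn_cond_exp M (G t) (\<lambda>\<omega>. indicator ?E ((t, \<xi>), \<omega>)) \<omega>"
      have 1: "?a + ?b = 1" using elim by simp
      \<comment> \<open>Subtraction in \<open>ennreal\<close> cancels only finite terms; finiteness
        holds since the two conditional expectations add up to 1.\<close>
      then have "?a \<noteq> \<infinity>" by auto
      then have "(?a + ?b) - ?a = ?b" by simp
      then show ?case using 1 by simp
    qed
  qed
  have "AE t in lborel. t \<in> {0..T} \<longrightarrow> (\<forall>\<xi>\<in>space S. AE \<omega> in M.
        f ((t, \<xi>), \<omega>) = nn_cond_exp M (G t) (\<lambda>\<omega>. indicator E ((t, \<xi>), \<omega>)) \<omega>)"
    using assms(1) by (blast dest: cond_versionD(3))
  then have "AE t in lborel. t \<in> {0..T} \<longrightarrow> (\<forall>\<xi>\<in>space S. AE \<omega> in M.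
        1 - f ((t, \<xi>), \<omega>) = nn_cond_exp M (G t) (\<lambda>\<omega>. indicator ?E ((t, \<xi>), \<omega>)) \<omega>)"
  proof eventually_elim
    case (elim t)
    show ?case
    proof (intro impI ballI)
      fix \<xi> assume t: "t \<in> {0..T}" "\<xi> \<in> space S"
      from elim t have "AE \<omega> in M. f ((t, \<xi>), \<omega>) = nn_cond_exp M (G t) (\<lambda>\<omega>. indicator E ((t, \<xi>), \<omega>)) \<omega>" by blast
      with compl[OF t] show "AE \<omega> in M. 1 - f ((t, \<xi>), \<omega>) = nn_cond_exp M (G t) (\<lambda>\<omega>. indicator ?E ((t, \<xi>), \<omega>)) \<omega>"
        by eventually_elim simp
    qed
  qed
  then show ?thesis
    by (intro cond_versionI borel_measurable_minus_ennreal borel_measurable_const cond_versionD(1,2)[OF E])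
qed

text \<open>The hypothesis \<open>measurable_information\<close> supplies an adapted, jointly
  measurable version for the event \<open>A\<close>. At a fixed time and \<xi> the other factor is a
  constant, so the exceptional times are those of \<open>A\<close> alone.\<close>

lemma cond_version_rectangle:
  assumes info: "measurable_information M G T" and E: "E \<in> sets \<Theta>" and A: "A \<in> sets M"
  shows "\<exists>f. cond_version M G T S (indicator (E \<times> A)) f"
proof -
  obtain Y :: "real \<Rightarrow> 'a \<Rightarrow> real" where Y: "adapted_process M G T Y"
    "AE t in lborel. t \<in> {0..T} \<longrightarrow> (AE \<omega> in M. Y t \<omega> = real_cond_exp M (G t) (indicator A) \<omega>)"
    using info A unfolding measurable_information_def by blast
  define f where "f = (\<lambda>((t, \<xi>), \<omega>). indicator E (t, \<xi>) * ennreal (Y t \<omega>))"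
  have Y1: "(\<lambda>(t, \<omega>). Y t \<omega>) \<in> borel_measurable (time_prod T M)"
    and Y2: "\<And>t. t \<in> {0..T} \<Longrightarrow> Y t \<in> borel_measurable (G t)"
    using Y(1) by (auto simp: adapted_process_def)
  have "(\<lambda>x. (fst (fst x), snd x)) \<in> measurable (\<Theta> \<Otimes>\<^sub>M M) (time_prod T M)"
    by measurable
  from measurable_compose[OF this Y1]
  have "(\<lambda>x. Y (fst (fst x)) (snd x)) \<in> borel_measurable (\<Theta> \<Otimes>\<^sub>M M)" by simp
  moreover have "(\<lambda>x. indicator E (fst x) :: ennreal) \<in> borel_measurable (\<Theta> \<Otimes>\<^sub>M M)"
    using E by (intro measurable_compose[OF measurable_fst] borel_measurable_indicator)
  ultimately have f1: "f \<in> borel_measurable (\<Theta> \<Otimes>\<^sub>M M)"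
    unfolding f_def by (simp add: case_prod_beta')
  \<comment> \<open>\<open>real_cond_exp\<close> subtracts the conditional expectations of positive
    and negative part; for an indicator the latter vanishes and the former is finite, so nothing is
    lost in returning to \<open>ennreal\<close>.\<close>
  have ind: "AE \<omega> in M. ennreal (real_cond_exp M (G t) (indicator A) \<omega>)
      = nn_cond_exp M (G t) (indicator A) \<omega>" if "t \<in> {0..T}" for t
  proof -
    interpret sigma_finite_subalgebra M "G t"
      by (rule subalgebra_sigma_finite[OF sub[OF that]])
    have "AE \<omega> in M. 0 = nn_cond_exp M (G t) (\<lambda>\<omega>. 0) \<omega>" "AE \<omega> in M. 1 = nn_cond_exp M (G t) (\<lambda>\<omega>. 1) \<omega>"
      by (rule nn_cond_exp_F_meas, simp)+
    moreover have "AE \<omega> in M. nn_cond_exp M (G t) (indicator A) \<omega> \<le> nn_cond_exp M (G t) (\<lambda>\<omega>. 1) \<omega>"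
      using A by (intro nn_cond_exp_mono) (auto simp: indicator_def)
    ultimately show ?thesis
    proof eventually_elim
      case (elim \<omega>)
      have "(\<lambda>x. ennreal (indicator A x)) = indicator A" "(\<lambda>x. ennreal (- indicator A x)) = (\<lambda>x. 0)"
        by (auto simp: fun_eq_iff indicator_def ennreal_neg)
      moreover have "nn_cond_exp M (G t) (indicator A) \<omega> < \<top>"
        using elim by (auto intro: le_less_trans)
      ultimately show ?case
        using elim(1) by (simp add: real_cond_exp_def flip: elim(1))
    qed
  qed
  have "AE t in lborel. t \<in> {0..T} \<longrightarrow> (\<forall>\<xi>\<in>space S. AE \<omega> in M.
        f ((t, \<xi>), \<omega>) = nn_cond_exp M (G t) (\<lambda>\<omega>. indicator (E \<times> A) ((t, \<xi>), \<omega>)) \<omega>)"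
    using Y(2)
  proof eventually_elim
    case (elim t)
    show ?case
    proof (intro impI ballI)
      fix \<xi> assume t: "t \<in> {0..T}" "\<xi> \<in> space S"
      interpret sigma_finite_subalgebra M "G t"
        by (rule subalgebra_sigma_finite[OF sub[OF t(1)]])
      have *: "(\<lambda>\<omega>. indicator (E \<times> A) ((t, \<xi>), \<omega>)) = (\<lambda>\<omega>. indicator E (t, \<xi>) * indicator A \<omega> :: ennreal)"
        by (simp add: indicator_times)
      have "AE \<omega> in M. indicator E (t, \<xi>) * nn_cond_exp M (G t) (indicator A) \<omega>
        = nn_cond_exp M (G t) (\<lambda>\<omega>. indicator E (t, \<xi>) * indicator A \<omega>) \<omega>"
        using A by (intro nn_cond_exp_prod) auto
      moreover have "AE \<omega> in M. Y t \<omega> = real_cond_exp M (G t) (indicator A) \<omega>"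
        using elim t by simp
      moreover note ind[OF t(1)]
      ultimately show "AE \<omega> in M. f ((t, \<xi>), \<omega>) = nn_cond_exp M (G t) (\<lambda>\<omega>. indicator (E \<times> A) ((t, \<xi>), \<omega>)) \<omega>"
        unfolding * by eventually_elim (simp add: f_def)
    qed
  qed
  moreover have "(\<lambda>\<omega>. f ((t, \<xi>), \<omega>)) \<in> borel_measurable (G t)" if "t \<in> {0..T}" for t \<xi>
    unfolding f_def using Y2[OF that] by simp
  ultimately have "cond_version M G T S (indicator (E \<times> A)) f"
    using f1 by (intro cond_versionI)
  then show ?thesis by blast
qed

text \<open>Rectangles generate the product and are stable under intersection, so complements and
  disjoint countable unions suffice. A disjoint union enters as the increasing limit of finite sums
  of indicators.\<close>

lemma cond_version_indicator:
  assumes info: "measurable_information M G T" and E: "E \<in> sets (\<Theta> \<Otimes>\<^sub>M M)"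
  shows "\<exists>f. cond_version M G T S (indicator E) f"
proof -
  let ?R = "{a \<times> b | a b. a \<in> sets \<Theta> \<and> b \<in> sets M}"
  have sets_eq: "sets (\<Theta> \<Otimes>\<^sub>M M) = sigma_sets (space \<Theta> \<times> space M) ?R"
    by (rule sets_pair_measure)
  have "?R \<subseteq> Pow (space \<Theta> \<times> space M)"
    by (rule pair_measure_closed)
  moreover have "E \<in> sigma_sets (space \<Theta> \<times> space M) ?R"
    using E sets_eq by simp
  ultimately show ?thesis
  proof (induction rule: sigma_sets_induct_disjoint[OF Int_stable_pair_measure_generator, consumes 2, case_names basic empty compl union])
    case (basic A)
    then show ?case using cond_version_rectangle[OF info] by fastforce
  next
    case empty
    show ?case using cond_version_rectangle[OF info sets.empty_sets sets.empty_sets] by (simp only: Sigma_empty1)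
  next
    case (compl A)
    then obtain f where "cond_version M G T S (indicator A) f" by blast
    from cond_version_compl[OF this] compl(1) show ?case
      unfolding sets_eq[symmetric] by (metis space_pair_measure)
  next
    case (union A)
    then have "\<forall>i. \<exists>f. cond_version M G T S (indicator (A i)) f" by blast
    then obtain f where f: "\<And>i. cond_version M G T S (indicator (A i)) (f i)" by metis
    have [measurable]: "A i \<in> sets (\<Theta> \<Otimes>\<^sub>M M)" for i
      using union(2) unfolding sets_eq by blast
    have "cond_version M G T S (\<lambda>x. \<Sum>i<n. indicator (A i) x) (\<lambda>x. \<Sum>i<n. f i x)" for n
    proof (induction n)
      case 0
      show ?case
        using cond_version_mult[OF f[of 0], of 0] by simp
    next
      case (Suc n)
      from cond_version_add[OF Suc.IH f[of n]] show ?case by simp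
    qed
    then have "cond_version M G T S (\<lambda>x. SUP n. \<Sum>i<n. indicator (A i) x) (\<lambda>x. SUP n. \<Sum>i<n. f i x)"
      by (rule cond_version_SUP) auto
    also have "(\<lambda>x. SUP n. \<Sum>i<n. indicator (A i) x) = (indicator (\<Union>i. A i) :: _ \<Rightarrow> ennreal)"
      using suminf_indicator[OF union(1)] by (simp add: suminf_eq_SUP fun_eq_iff)
    finally show ?case by blast
  qed
qed

text \<open>In \<open>ennreal\<close> every step of the induction is free of integrability
  conditions. Signed integrands are treated later through their positive and negative parts.\<close>

lemma cond_version_exists:
  assumes info: "measurable_information M G T" and g: "g \<in> borel_measurable (\<Theta> \<Otimes>\<^sub>M M)"
  shows "\<exists>f. cond_version M G T S g f"
  using g
proof (induction rule: borel_measurable_induct)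
  case (cong g g')
  then show ?case using cond_version_cong by metis
next
  case (set A)
  then show ?case by (rule cond_version_indicator[OF info])
next
  case (mult u c)
  then show ?case using cond_version_mult by blast
next
  case (add u v)
  then show ?case using cond_version_add by blast
next
  case (seq U)
  then obtain f where f: "\<And>i. cond_version M G T S (U i) (f i)" by metis
  have "cond_version M G T S (\<lambda>x. SUP i. U i x) (\<lambda>x. SUP i. f i x)"
    using seq by (intro cond_version_SUP f) (auto simp: incseq_Suc_iff le_fun_def)
  moreover have "(SUP i. U i) = (\<lambda>x. SUP i. U i x)" by (simp add: fun_eq_iff image_comp)
  ultimately have "cond_version M G T S (SUP i. U i) (\<lambda>x. SUP i. f i x)" by simp
  then show ?case by blast
qed

end

end

section \<open>Integrands with integrable majorant\<close>

context prob_space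
begin

lemma nn_set_integral_version:
  assumes sub: "subalgebra M F" and p: "p \<in> borel_measurable M" and f: "f \<in> borel_measurable F"
    and eq: "AE x in M. f x = nn_cond_exp M F p x" and A: "A \<in> sets F"
  shows "(\<integral>\<^sup>+x. indicator A x * f x \<partial>M) = (\<integral>\<^sup>+x. indicator A x * p x \<partial>M)"
proof -
  interpret sigma_finite_subalgebra M F by (rule subalgebra_sigma_finite[OF sub])
  have "(\<integral>\<^sup>+x. indicator A x * f x \<partial>M) = (\<integral>\<^sup>+x. indicator A x * nn_cond_exp M F p x \<partial>M)"
    using eq by (intro nn_integral_cong_AE) auto
  also have "\<dots> = (\<integral>\<^sup>+x. indicator A x * p x \<partial>M)"
    using A p by (intro nn_cond_exp_intg) auto
  finally show ?thesis .
qed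

text \<open>Conditionally on \<open>F\<close>, \<open>p\<close> and \<open>n\<close> are the
  expectations of the positive and negative part of \<open>g\<close>. As subtraction in
  \<open>ennreal\<close> is truncated, the integral of \<open>n - p\<close> is a single number that
  vanishes exactly when no set of \<open>F\<close> gives \<open>g\<close> a negative integral, and
  \<open>p < n\<close> defines a witness in \<open>F\<close>. Unlike an almost sure inequality, such
  a number can depend measurably on parameters.\<close>

lemma set_integral_version_sign:
  fixes g :: "'a \<Rightarrow> real"
  assumes sub: "subalgebra M F" and g: "integrable M g"
    and p: "p \<in> borel_measurable F" "AE x in M. p x = nn_cond_exp M F (\<lambda>x. ennreal (g x)) x"
    and n: "n \<in> borel_measurable F" "AE x in M. n x = nn_cond_exp M F (\<lambda>x. ennreal (- g x)) x"
  shows "(\<integral>\<^sup>+x. n x - p x \<partial>M) = 0 \<Longrightarrow> A \<in> sets F \<Longrightarrow> 0 \<le> (LINT x:A|M. g x)"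
    and "(\<integral>\<^sup>+x. n x - p x \<partial>M) \<noteq> 0 \<Longrightarrow> (LINT x:{x\<in>space M. p x < n x}|M. g x) < 0"
proof -
  have [measurable]: "g \<in> borel_measurable M" using g by auto
  have pM [measurable]: "p \<in> borel_measurable M" and nM [measurable]: "n \<in> borel_measurable M"
    using p n sub by (auto intro: measurable_from_subalg)
  have P: "(\<integral>\<^sup>+x. indicator A x * p x \<partial>M) = (\<integral>\<^sup>+x. ennreal (indicator A x * g x) \<partial>M)"
    and N: "(\<integral>\<^sup>+x. indicator A x * n x \<partial>M) = (\<integral>\<^sup>+x. ennreal (- (indicator A x * g x)) \<partial>M)"
    if "A \<in> sets F" for A
  proof -
    have "(\<integral>\<^sup>+x. indicator A x * p x \<partial>M) = (\<integral>\<^sup>+x. indicator A x * ennreal (g x) \<partial>M)"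
      by (rule nn_set_integral_version[OF sub _ p that]) measurable
    also have "\<dots> = (\<integral>\<^sup>+x. ennreal (indicator A x * g x) \<partial>M)"
      by (intro nn_integral_cong) (simp add: indicator_def)
    finally show "(\<integral>\<^sup>+x. indicator A x * p x \<partial>M) = (\<integral>\<^sup>+x. ennreal (indicator A x * g x) \<partial>M)" .
    have "(\<integral>\<^sup>+x. indicator A x * n x \<partial>M) = (\<integral>\<^sup>+x. indicator A x * ennreal (- g x) \<partial>M)"
      by (rule nn_set_integral_version[OF sub _ n that]) measurable
    also have "\<dots> = (\<integral>\<^sup>+x. ennreal (- (indicator A x * g x)) \<partial>M)"
      by (intro nn_integral_cong) (simp add: indicator_def)
    finally show "(\<integral>\<^sup>+x. indicator A x * n x \<partial>M) = (\<integral>\<^sup>+x. ennreal (- (indicator A x * g x)) \<partial>M)" .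
  qed
  have int: "integrable M (\<lambda>x. indicator A x * g x)" if "A \<in> sets F" for A
    using sub that g integrable_mult_indicator[of A M g] by (auto simp: subalgebra_def)
  have fin: "(\<integral>\<^sup>+x. indicator A x * p x \<partial>M) \<noteq> \<infinity>" "(\<integral>\<^sup>+x. indicator A x * n x \<partial>M) \<noteq> \<infinity>"
    if "A \<in> sets F" for A
    unfolding P[OF that] N[OF that] using int[OF that] by (auto simp: real_integrable_def)
  have set_int: "(LINT x:A|M. g x)
      = enn2real (\<integral>\<^sup>+x. indicator A x * p x \<partial>M) - enn2real (\<integral>\<^sup>+x. indicator A x * n x \<partial>M)"
    if "A \<in> sets F" for A
    unfolding P[OF that] N[OF that] set_lebesgue_integral_def
    using real_lebesgue_integral_def[OF int[OF that]] by simp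
  show "0 \<le> (LINT x:A|M. g x)" if 0: "(\<integral>\<^sup>+x. n x - p x \<partial>M) = 0" and A: "A \<in> sets F"
  proof -
    have "AE x in M. n x - p x = 0"
      using 0 by (subst (asm) nn_integral_0_iff_AE) auto
    then have "(\<integral>\<^sup>+x. indicator A x * n x \<partial>M) \<le> (\<integral>\<^sup>+x. indicator A x * p x \<partial>M)"
    proof (intro nn_integral_mono_AE, eventually_elim)
      case (elim x)
      then show ?case by (intro mult_left_mono) (auto simp: diff_eq_0_iff_ennreal)
    qed
    then show ?thesis
      unfolding set_int[OF A] using fin[OF A] by (simp add: enn2real_mono less_top)
  qed
  show "(LINT x:{x\<in>space M. p x < n x}|M. g x) < 0" if pos: "(\<integral>\<^sup>+x. n x - p x \<partial>M) \<noteq> 0"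
  proof -
    let ?A = "{x\<in>space M. p x < n x}"
    have "space F = space M" using sub by (simp add: subalgebra_def)
    moreover have "{x\<in>space F. p x < n x} \<in> sets F"
      using p n by measurable
    ultimately have A: "?A \<in> sets F" by simp
    then have [measurable]: "?A \<in> sets M" using sub by (auto simp: subalgebra_def)
    \<comment> \<open>As \<open>\<top> - \<top> = \<top>\<close> in \<open>ennreal\<close>,
      finiteness of \<open>n\<close> is required for \<open>n - p\<close> to vanish off
      \<open>?A\<close>.\<close>
    have "space F \<in> sets F" by simp
    from fin(2)[OF this] have "AE x in M. indicator (space F) x * n x \<noteq> \<infinity>"
      using \<open>space F = space M\<close> by (intro nn_integral_noteq_infinite) auto
    then have "AE x in M. n x \<noteq> \<infinity>"
      using AE_space by eventually_elim (simp add: \<open>space F = space M\<close>)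
    then have "AE x in M. n x - p x = indicator ?A x * n x - indicator ?A x * p x"
      using AE_space
    proof eventually_elim
      case (elim x)
      then show ?case
        by (cases "p x < n x") (auto simp: not_less less_top intro!: diff_eq_0_ennreal)
    qed
    then have "(\<integral>\<^sup>+x. n x - p x \<partial>M) = (\<integral>\<^sup>+x. indicator ?A x * n x - indicator ?A x * p x \<partial>M)"
      by (rule nn_integral_cong_AE)
    also have "\<dots> = (\<integral>\<^sup>+x. indicator ?A x * n x \<partial>M) - (\<integral>\<^sup>+x. indicator ?A x * p x \<partial>M)"
      using fin(1)[OF A] by (intro nn_integral_diff) (auto simp: indicator_def intro!: AE_I2)
    finally have eq: "(\<integral>\<^sup>+x. n x - p x \<partial>M)
      = (\<integral>\<^sup>+x. indicator ?A x * n x \<partial>M) - (\<integral>\<^sup>+x. indicator ?A x * p x \<partial>M)" .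
    have "(\<integral>\<^sup>+x. indicator ?A x * p x \<partial>M) < (\<integral>\<^sup>+x. indicator ?A x * n x \<partial>M)"
    proof (rule ccontr)
      assume "\<not> ?thesis"
      then have "(\<integral>\<^sup>+x. n x - p x \<partial>M) = 0"
        unfolding eq using fin(2)[OF A] by (intro diff_eq_0_ennreal) (simp_all add: not_less less_top)
      with pos show False by simp
    qed
    then show ?thesis
      unfolding set_int[OF A] using fin[OF A] by (simp add: enn2real_less_iff less_top)
  qed
qed

end

text \<open>Retained from the Hamiltonian are joint measurability and an integrable majorant that
  does not depend on \<xi>. Time and \<xi> are grouped before \<omega> because conditional
  expectations are taken in \<omega> with this pair as parameter. Regularity in the state is
  demanded separately, in the direction that uses it.\<close>

locale controlled_integrand = prob_space M
  for M :: "'w measure" +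
  fixes G :: "real \<Rightarrow> 'w measure" and T :: real and U :: "(real^'d) set"
    and h :: "real \<Rightarrow> 'w \<Rightarrow> real^'d \<Rightarrow> real" and D :: "real \<Rightarrow> 'w \<Rightarrow> real"
  assumes sub: "\<And>t. t \<in> {0..T} \<Longrightarrow> subalgebra M (G t)"
    and U: "closed U" "bounded U"
    and h_meas: "(\<lambda>((t, \<xi>), \<omega>). h t \<omega> \<xi>) \<in>
      borel_measurable ((restrict_space lborel {0..T} \<Otimes>\<^sub>M restrict_space borel U) \<Otimes>\<^sub>M M)"
    and D_int: "integrable (time_prod T M) (\<lambda>(t, \<omega>). D t \<omega>)"
    and h_le: "\<And>t \<omega> \<xi>. t \<in> {0..T} \<Longrightarrow> \<omega> \<in> space M \<Longrightarrow> \<xi> \<in> U \<Longrightarrow> \<bar>h t \<omega> \<xi>\<bar> \<le> D t \<omega>"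
begin

abbreviation "S \<equiv> restrict_space borel U"
abbreviation "L \<equiv> restrict_space lborel {0..T}"

definition Hm :: "real \<Rightarrow> 'w \<Rightarrow> (real^'d) measure \<Rightarrow> real" where
  "Hm t \<omega> \<nu> = (\<integral>\<xi>. h t \<omega> \<xi> \<partial>\<nu>)"

section \<open>Measurability and integrability of averages over the control set\<close>

lemma U_borel: "U \<in> sets borel" using U by simp

lemma space_S [simp]: "space S = U" by (simp add: space_restrict_space)

lemma space_G: "t \<in> {0..T} \<Longrightarrow> space (G t) = space M"
  using sub by (simp add: subalgebra_def)

lemma finite_L: "finite_measure L"
proof (rule finite_measureI)
  show "emeasure L (space L) \<noteq> \<infinity>"
    by (cases "0 \<le> T") (simp_all add: emeasure_restrict_space space_restrict_space)
qed

lemma pair_LM: "pair_sigma_finite L M"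
proof -
  interpret L: finite_measure L by (rule finite_L)
  show ?thesis by unfold_locales
qed

lemma AE_L: "(AE t in L. P t) \<longleftrightarrow> (AE t in lborel. t \<in> {0..T} \<longrightarrow> P t)"
  by (rule AE_restrict_space_iff) simp

lemma h_section_U:
  assumes "t \<in> {0..T}" "\<omega> \<in> space M"
  shows "h t \<omega> \<in> borel_measurable S"
proof -
  have "(\<lambda>\<xi>. ((t, \<xi>), \<omega>)) \<in> measurable S ((L \<Otimes>\<^sub>M S) \<Otimes>\<^sub>M M)"
    using assms by (intro measurable_Pair measurable_const) (auto simp: space_restrict_space)
  from measurable_compose[OF this h_meas] show ?thesis by simp
qed

lemma h_section_MU:
  assumes "t \<in> {0..T}"
  shows "(\<lambda>(\<omega>, \<xi>). h t \<omega> \<xi>) \<in> borel_measurable (M \<Otimes>\<^sub>M S)"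
proof -
  have "(\<lambda>x. ((t, snd x), fst x)) \<in> measurable (M \<Otimes>\<^sub>M S) ((L \<Otimes>\<^sub>M S) \<Otimes>\<^sub>M M)"
    using assms by (intro measurable_Pair measurable_const measurable_fst measurable_snd)
      (auto simp: space_restrict_space)
  from measurable_compose[OF this h_meas] show ?thesis by (simp add: case_prod_beta')
qed

lemma
  assumes "\<nu> \<in> space (prob_algebra S)" and t: "t \<in> {0..T}" "\<omega> \<in> space M"
  shows h_integrable: "integrable \<nu> (h t \<omega>)" and Hm_le: "\<bar>Hm t \<omega> \<nu>\<bar> \<le> D t \<omega>"
proof -
  interpret \<nu>: prob_space \<nu> using assms by (simp add: space_prob_algebra)
  have sets: "sets \<nu> = sets S" using assms by (simp add: space_prob_algebra)
  have space: "space \<nu> = U" using sets_eq_imp_space_eq[OF sets] by simp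
  show int: "integrable \<nu> (h t \<omega>)"
    using h_section_U[OF t] h_le[OF t] space sets
    by (intro \<nu>.integrable_const_bound[where B = "D t \<omega>"]) (auto cong: measurable_cong_sets)
  have "\<bar>Hm t \<omega> \<nu>\<bar> \<le> (\<integral>\<xi>. \<bar>h t \<omega> \<xi>\<bar> \<partial>\<nu>)"
    unfolding Hm_def by (rule integral_abs_bound)
  also have "\<dots> \<le> (\<integral>\<xi>. D t \<omega> \<partial>\<nu>)"
    using int h_le[OF t] space by (intro integral_mono) auto
  finally show "\<bar>Hm t \<omega> \<nu>\<bar> \<le> D t \<omega>" by (simp add: \<nu>.prob_space)
qed

lemma Hm_measurable:
  assumes k: "(\<lambda>(t, \<omega>). k t \<omega>) \<in> measurable (time_prod T M) (prob_algebra S)"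
  shows "(\<lambda>(t, \<omega>). Hm t \<omega> (k t \<omega>)) \<in> borel_measurable (time_prod T M)"
proof -
  have "(\<lambda>x. ((fst (fst x), snd x), snd (fst x))) \<in> measurable (time_prod T M \<Otimes>\<^sub>M S) ((L \<Otimes>\<^sub>M S) \<Otimes>\<^sub>M M)"
    by measurable
  from measurable_compose[OF this h_meas]
  have "(\<lambda>(x, \<xi>). h (fst x) (snd x) \<xi>) \<in> borel_measurable (time_prod T M \<Otimes>\<^sub>M S)"
    by (simp add: case_prod_beta')
  from integral_kernel_measurable[OF this k]
  show ?thesis
    using h_integrable[OF measurable_space[OF k]]
    by (auto simp: Hm_def case_prod_beta' space_pair_measure space_restrict_space)
qed

lemma Hm_integrable:
  assumes k: "(\<lambda>(t, \<omega>). k t \<omega>) \<in> measurable (time_prod T M) (prob_algebra S)"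
  shows "integrable (time_prod T M) (\<lambda>(t, \<omega>). Hm t \<omega> (k t \<omega>))"
  using D_int Hm_measurable[OF k]
proof (rule Bochner_Integration.integrable_bound)
  show "AE x in time_prod T M. norm (case x of (t, \<omega>) \<Rightarrow> Hm t \<omega> (k t \<omega>)) \<le> norm (case x of (t, \<omega>) \<Rightarrow> D t \<omega>)"
  proof (rule AE_I2)
    fix x assume x: "x \<in> space (time_prod T M)"
    obtain t \<omega> where [simp]: "x = (t, \<omega>)" by (cases x)
    have "\<bar>Hm t \<omega> (k t \<omega>)\<bar> \<le> D t \<omega>"
      using x measurable_space[OF k x] by (intro Hm_le) (auto simp: space_pair_measure space_restrict_space)
    then show "norm (case x of (t, \<omega>) \<Rightarrow> Hm t \<omega> (k t \<omega>)) \<le> norm (case x of (t, \<omega>) \<Rightarrow> D t \<omega>)" by simp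
  qed
qed

text \<open>Fubini, justified by the majorant, turns the cost into a time integral, so that controls
  can be compared at single times.\<close>

lemma cost_eq:
  assumes k: "(\<lambda>(t, \<omega>). k t \<omega>) \<in> measurable (time_prod T M) (prob_algebra S)"
  shows "(\<integral>\<omega>. (LINT t:{0..T}|lborel. Hm t \<omega> (k t \<omega>)) \<partial>M) = (\<integral>t. (\<integral>\<omega>. Hm t \<omega> (k t \<omega>) \<partial>M) \<partial>L)"
proof -
  interpret pair_sigma_finite L M by (rule pair_LM)
  have "(LINT t:{0..T}|lborel. f t) = (\<integral>t. f t \<partial>L)" for f :: "real \<Rightarrow> real"
    unfolding set_lebesgue_integral_def by (rule integral_restrict_space[symmetric]) simp
  then show ?thesis
    using Fubini_integral[OF Hm_integrable[OF k]] by simp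
qed

lemma cost_integrable:
  assumes k: "(\<lambda>(t, \<omega>). k t \<omega>) \<in> measurable (time_prod T M) (prob_algebra S)"
  shows "integrable L (\<lambda>t. \<integral>\<omega>. Hm t \<omega> (k t \<omega>) \<partial>M)"
  using pair_sigma_finite.integrable_fst'[OF pair_LM Hm_integrable[OF k]] by simp

lemma D_good: "AE t in L. t \<in> {0..T} \<and> integrable M (D t)"
proof -
  interpret pair_sigma_finite L M by (rule pair_LM)
  have "AE t in L. t \<in> {0..T}" by (rule AE_I2) (simp add: space_restrict_space)
  moreover have "AE t in L. integrable M (D t)"
    using AE_integrable_fst'[OF D_int] by simp
  ultimately show ?thesis by eventually_elim simp
qed

lemma Hm_section_measurable:
  assumes t: "t \<in> {0..T}" and k: "k \<in> measurable M (prob_algebra S)"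
  shows "(\<lambda>\<omega>. Hm t \<omega> (k \<omega>)) \<in> borel_measurable M"
  unfolding Hm_def
  by (rule integral_kernel_measurable[OF h_section_MU[OF t] k])
    (rule h_integrable[OF measurable_space[OF k] t])

lemma Hm_section_integrable:
  assumes t: "t \<in> {0..T}" "integrable M (D t)" and k: "k \<in> measurable M (prob_algebra S)"
  shows "integrable M (\<lambda>\<omega>. Hm t \<omega> (k \<omega>))"
  using t(2)
proof (rule Bochner_Integration.integrable_bound)
  show "(\<lambda>\<omega>. Hm t \<omega> (k \<omega>)) \<in> borel_measurable M"
    by (rule Hm_section_measurable[OF t(1) k])
  show "AE \<omega> in M. norm (Hm t \<omega> (k \<omega>)) \<le> norm (D t \<omega>)"
    using Hm_le[OF measurable_space[OF k] t(1)] by (intro AE_I2) (fastforce intro: order_trans)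
qed

lemma Hm_return: "\<xi> \<in> U \<Longrightarrow> t \<in> {0..T} \<Longrightarrow> \<omega> \<in> space M \<Longrightarrow> Hm t \<omega> (return S \<xi>) = h t \<omega> \<xi>"
  unfolding Hm_def using h_section_U by (intro integral_return) auto

lemma kernel_joint:
  "u \<in> relaxed_controls M G T U \<Longrightarrow> (\<lambda>(t, \<omega>). u t \<omega>) \<in> measurable (time_prod T M) (prob_algebra S)"
  by (rule relaxed_controls_kernel(1)[OF U_borel _ space_G])

lemma kernel_G:
  "u \<in> relaxed_controls M G T U \<Longrightarrow> t \<in> {0..T} \<Longrightarrow> u t \<in> measurable (G t) (prob_algebra S)"
  by (rule relaxed_controls_kernel(2)[OF U_borel _ space_G])

lemma kernel_section:
  assumes "u \<in> relaxed_controls M G T U" "t \<in> {0..T}"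
  shows "u t \<in> measurable M (prob_algebra S)"
  by (rule measurable_from_subalg[OF sub[OF assms(2)] kernel_G[OF assms]])

lemma const_kernel: "\<mu> \<in> M1 U \<Longrightarrow> (\<lambda>_. \<mu>) \<in> measurable N (prob_algebra S)"
  by (simp add: M1_def)

text \<open>At almost every fixed time the claim is \<open>kernel_integral_le\<close>, with the
  integrand under \<open>uo\<close> in the role of \<open>c\<close>. The hypothesis
  \<open>approx\<close> factors \<open>h\<close> at time \<open>t\<close> through a random state
  \<open>Z\<close> on which it depends continuously, uniformly in \<xi>.\<close>

theorem cost_le_if_conditional_le:
  assumes uo: "uo \<in> relaxed_controls M G T U" and u: "u \<in> relaxed_controls M G T U"
    and le: "AE t in lborel. t \<in> {0..T} \<longrightarrow> (\<forall>\<mu>\<in>M1 U. AE \<omega> in M.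
        real_cond_exp M (G t) (\<lambda>\<omega>. Hm t \<omega> (uo t \<omega>)) \<omega> \<le> real_cond_exp M (G t) (\<lambda>\<omega>. Hm t \<omega> \<mu>) \<omega>)"
    and approx: "\<And>t. t \<in> {0..T} \<Longrightarrow> \<exists>(Z::'w \<Rightarrow> 'z::{metric_space, second_countable_topology}) \<gamma>.
        Z \<in> borel_measurable M \<and> (\<forall>\<omega>\<in>space M. \<forall>\<xi>\<in>U. h t \<omega> \<xi> = \<gamma> (Z \<omega>) \<xi>) \<and>
        (\<forall>z. \<gamma> z \<in> borel_measurable S) \<and> (\<forall>z. \<exists>B. \<forall>\<xi>\<in>U. \<bar>\<gamma> z \<xi>\<bar> \<le> B) \<and>
        (\<forall>z. \<forall>e>0. \<exists>\<delta>>0. \<forall>z'. dist z' z < \<delta> \<longrightarrow> (\<forall>\<xi>\<in>U. \<bar>\<gamma> z' \<xi> - \<gamma> z \<xi>\<bar> < e))"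
  shows "(\<integral>\<omega>. (LINT t:{0..T}|lborel. Hm t \<omega> (uo t \<omega>)) \<partial>M) \<le> (\<integral>\<omega>. (LINT t:{0..T}|lborel. Hm t \<omega> (u t \<omega>)) \<partial>M)"
proof -
  note kuo = kernel_joint[OF uo] and ku = kernel_joint[OF u]
  have "(\<integral>t. (\<integral>\<omega>. Hm t \<omega> (uo t \<omega>) \<partial>M) \<partial>L) \<le> (\<integral>t. (\<integral>\<omega>. Hm t \<omega> (u t \<omega>) \<partial>M) \<partial>L)"
  proof (rule integral_mono_AE[OF cost_integrable[OF kuo] cost_integrable[OF ku]])
    show "AE t in L. (\<integral>\<omega>. Hm t \<omega> (uo t \<omega>) \<partial>M) \<le> (\<integral>\<omega>. Hm t \<omega> (u t \<omega>) \<partial>M)"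
      using le[unfolded AE_L[symmetric]] D_good
    proof eventually_elim
      case (elim t)
      then have t: "t \<in> {0..T}" "integrable M (D t)" by auto
      obtain Z :: "'w \<Rightarrow> 'z" and \<gamma> where Z\<gamma>: "Z \<in> borel_measurable M \<and> (\<forall>\<omega>\<in>space M. \<forall>\<xi>\<in>U. h t \<omega> \<xi> = \<gamma> (Z \<omega>) \<xi>) \<and>
        (\<forall>z. \<gamma> z \<in> borel_measurable S) \<and> (\<forall>z. \<exists>B. \<forall>\<xi>\<in>U. \<bar>\<gamma> z \<xi>\<bar> \<le> B) \<and>
        (\<forall>z. \<forall>e>0. \<exists>\<delta>>0. \<forall>z'. dist z' z < \<delta> \<longrightarrow> (\<forall>\<xi>\<in>U. \<bar>\<gamma> z' \<xi> - \<gamma> z \<xi>\<bar> < e))"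
        using approx[OF t(1)] by (elim exE) (rule that)
      then have Z: "Z \<in> borel_measurable M"
        "\<And>\<omega> \<xi>. \<omega> \<in> space M \<Longrightarrow> \<xi> \<in> U \<Longrightarrow> h t \<omega> \<xi> = \<gamma> (Z \<omega>) \<xi>"
        "\<And>z. \<gamma> z \<in> borel_measurable S" "\<And>z. \<exists>B. \<forall>\<xi>\<in>U. \<bar>\<gamma> z \<xi>\<bar> \<le> B"
        "\<And>z e. 0 < e \<Longrightarrow> \<exists>\<delta>>0. \<forall>z'. dist z' z < \<delta> \<longrightarrow> (\<forall>\<xi>\<in>U. \<bar>\<gamma> z' \<xi> - \<gamma> z \<xi>\<bar> < e)"
        by simp_all
      have Hm_\<gamma>: "(\<integral>\<xi>. \<gamma> (Z \<omega>) \<xi> \<partial>\<nu>) = Hm t \<omega> \<nu>" if "\<omega> \<in> space M" "sets \<nu> = sets S" for \<omega> \<nu>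
        unfolding Hm_def using Z(2)[OF that(1)] sets_eq_imp_space_eq[OF that(2)]
        by (intro Bochner_Integration.integral_cong) auto
      have "(\<integral>\<omega>. Hm t \<omega> (uo t \<omega>) \<partial>M) \<le> (\<integral>\<omega>. (\<integral>\<xi>. \<gamma> (Z \<omega>) \<xi> \<partial>u t \<omega>) \<partial>M)"
      proof (rule kernel_integral_le[OF sub[OF t(1)] Z(1) Z(3), where D = "D t"])
        have "(\<lambda>(\<omega>, \<xi>). h t \<omega> \<xi>) \<in> borel_measurable (M \<Otimes>\<^sub>M S) \<longleftrightarrow> (\<lambda>(\<omega>, \<xi>). \<gamma> (Z \<omega>) \<xi>) \<in> borel_measurable (M \<Otimes>\<^sub>M S)"
          using Z(2) by (intro measurable_cong) (auto simp: space_pair_measure)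
        then show "(\<lambda>(\<omega>, \<xi>). \<gamma> (Z \<omega>) \<xi>) \<in> borel_measurable (M \<Otimes>\<^sub>M S)"
          using h_section_MU[OF t(1)] by simp
        show "integrable M (\<lambda>\<omega>. Hm t \<omega> (uo t \<omega>))"
          by (rule Hm_section_integrable[OF t kernel_section[OF uo t(1)]])
        show "\<bar>\<gamma> (Z \<omega>) \<xi>\<bar> \<le> D t \<omega>" if "\<omega> \<in> space M" "\<xi> \<in> space S" for \<omega> \<xi>
          using h_le[OF t(1) that(1), of \<xi>] Z(2)[OF that(1), of \<xi>] that(2) by simp
        fix \<mu> A assume \<mu>: "\<mu> \<in> space (prob_algebra S)" and A: "A \<in> sets (G t)"
        then have "\<mu> \<in> M1 U" by (simp add: M1_def)
        with elim t have "AE \<omega> in M. real_cond_exp M (G t) (\<lambda>\<omega>. Hm t \<omega> (uo t \<omega>)) \<omega> \<le> real_cond_exp M (G t) (\<lambda>\<omega>. Hm t \<omega> \<mu>) \<omega>"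
          by blast
        then have "(LINT \<omega>:A|M. Hm t \<omega> (uo t \<omega>)) \<le> (LINT \<omega>:A|M. Hm t \<omega> \<mu>)"
          using A \<open>\<mu> \<in> M1 U\<close> uo
          by (subst (asm) real_cond_exp_le_iff[OF sub[OF t(1)]])
            (auto intro!: Hm_section_integrable[OF t] kernel_section t const_kernel)
        also have "\<dots> = (LINT \<omega>:A|M. \<integral>\<xi>. \<gamma> (Z \<omega>) \<xi> \<partial>\<mu>)"
          unfolding set_lebesgue_integral_def using \<mu>
          by (intro Bochner_Integration.integral_cong) (auto simp: Hm_\<gamma> space_prob_algebra)
        finally show "(LINT \<omega>:A|M. Hm t \<omega> (uo t \<omega>)) \<le> (LINT \<omega>:A|M. \<integral>\<xi>. \<gamma> (Z \<omega>) \<xi> \<partial>\<mu>)" .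
      next
        show "u t \<in> measurable (G t) (prob_algebra S)" by (rule kernel_G[OF u t(1)])
      qed (use t Z(4,5) in auto)
      also have "\<dots> = (\<integral>\<omega>. Hm t \<omega> (u t \<omega>) \<partial>M)"
        using measurable_space[OF kernel_section[OF u t(1)]]
        by (intro Bochner_Integration.integral_cong) (auto simp: Hm_\<gamma> space_prob_algebra)
      finally show ?case .
    qed
  qed
  then show ?thesis unfolding cost_eq[OF kuo] cost_eq[OF ku] .
qed

text \<open>Selection takes place in the full space, whereas \<open>B\<close> arises in a product of
  two trace \<sigma>-algebras; both traces are taken on Borel sets.\<close>

lemma sets_parameter_borel:
  assumes "B \<in> sets (L \<Otimes>\<^sub>M S)"
  shows "B \<in> sets borel"
proof -
  have "{a \<times> b | a b. a \<in> sets L \<and> b \<in> sets S} \<subseteq> sets (borel \<Otimes>\<^sub>M borel)"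
    using U_borel by (auto simp: sets_restrict_space intro!: pair_measureI sets.Int)
  then have "sets (L \<Otimes>\<^sub>M S) \<subseteq> sets (borel \<Otimes>\<^sub>M borel)"
    unfolding sets_pair_measure[of L S]
    by (intro sets.sigma_sets_subset') (use U_borel in \<open>auto simp: space_restrict_space intro!: pair_measureI\<close>)
  from subsetD[OF this assms] show ?thesis unfolding borel_prod .
qed

lemma parameter_section_measurable:
  assumes f: "f \<in> borel_measurable ((L \<Otimes>\<^sub>M S) \<Otimes>\<^sub>M M)" and s: "s \<in> measurable L S"
  shows "(\<lambda>(t, \<omega>). f ((t, s t), \<omega>)) \<in> borel_measurable (time_prod T M)"
proof -
  have "(\<lambda>x. ((fst x, s (fst x)), snd x)) \<in> measurable (time_prod T M) ((L \<Otimes>\<^sub>M S) \<Otimes>\<^sub>M M)"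
    using s by measurable
  from measurable_compose[OF this f] show ?thesis by (simp add: case_prod_beta')
qed

text \<open>The quantity \<open>neg\<close> condenses the failure of the conditional inequality at a
  time and a point \<xi> into one number that depends measurably on both. The competing control is
  admissible because at each time it switches on a set of \<open>G t\<close>.\<close>

theorem conditional_le_if_cost_le:
  assumes info: "measurable_information M G T" and uo: "uo \<in> relaxed_controls M G T U"
    and le: "\<And>u. u \<in> relaxed_controls M G T U \<Longrightarrow>
      (\<integral>\<omega>. (LINT t:{0..T}|lborel. Hm t \<omega> (uo t \<omega>)) \<partial>M) \<le> (\<integral>\<omega>. (LINT t:{0..T}|lborel. Hm t \<omega> (u t \<omega>)) \<partial>M)"
  shows "AE t in lborel. t \<in> {0..T} \<longrightarrow> (\<forall>\<mu>\<in>M1 U. AE \<omega> in M.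
        real_cond_exp M (G t) (\<lambda>\<omega>. Hm t \<omega> (uo t \<omega>)) \<omega> \<le> real_cond_exp M (G t) (\<lambda>\<omega>. Hm t \<omega> \<mu>) \<omega>)"
proof -
  note kuo = kernel_joint[OF uo]
  \<comment> \<open>\<open>g\<close> is the change of the integrand when \<open>uo\<close> is
    replaced by the Dirac measure at \<xi>.\<close>
  define g where "g t \<xi> \<omega> = h t \<omega> \<xi> - Hm t \<omega> (uo t \<omega>)" for t \<xi> \<omega>
  have "(\<lambda>x. (fst (fst x), snd x)) \<in> measurable ((L \<Otimes>\<^sub>M S) \<Otimes>\<^sub>M M) (time_prod T M)"
    by measurable
  from measurable_compose[OF this Hm_measurable[OF kuo]]
  have g_meas: "(\<lambda>((t, \<xi>), \<omega>). g t \<xi> \<omega>) \<in> borel_measurable ((L \<Otimes>\<^sub>M S) \<Otimes>\<^sub>M M)"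
    using h_meas by (simp add: g_def case_prod_beta')
  have g_int: "integrable M (g t \<xi>)" if "t \<in> {0..T}" "integrable M (D t)" "\<xi> \<in> U" for t \<xi>
  proof -
    have "integrable M (\<lambda>\<omega>. Hm t \<omega> (return S \<xi>) - Hm t \<omega> (uo t \<omega>))"
      using that by (intro Bochner_Integration.integrable_diff Hm_section_integrable kernel_section[OF uo])
        (auto intro!: measurable_const measurable_space[OF measurable_return_prob_space])
    then show ?thesis
      using that by (subst Bochner_Integration.integrable_cong[OF refl]) (auto simp: g_def Hm_return)
  qed
  \<comment> \<open>Two versions are taken because \<open>cond_version\<close> concerns
    \<open>ennreal\<close>-valued functions: \<open>p\<close> belongs to the positive part of
    \<open>g\<close> and \<open>n\<close> to the negative part.\<close>
  obtain p where p: "cond_version M G T S (\<lambda>((t, \<xi>), \<omega>). ennreal (g t \<xi> \<omega>)) p"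
    using cond_version_exists[OF sub info, of "\<lambda>((t, \<xi>), \<omega>). ennreal (g t \<xi> \<omega>)" S] g_meas
    by (auto simp: case_prod_beta')
  obtain n where n: "cond_version M G T S (\<lambda>((t, \<xi>), \<omega>). ennreal (- g t \<xi> \<omega>)) n"
    using cond_version_exists[OF sub info, of "\<lambda>((t, \<xi>), \<omega>). ennreal (- g t \<xi> \<omega>)" S] g_meas
    by (auto simp: case_prod_beta')
  note p_meas = cond_versionD(1)[OF p] and n_meas = cond_versionD(1)[OF n]
  have p_G: "(\<lambda>\<omega>. p ((t, \<xi>), \<omega>)) \<in> borel_measurable (G t)" and n_G: "(\<lambda>\<omega>. n ((t, \<xi>), \<omega>)) \<in> borel_measurable (G t)"
    if "t \<in> {0..T}" "\<xi> \<in> U" for t \<xi>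
    using that cond_versionD(2)[OF p] cond_versionD(2)[OF n] by simp_all
  define good where "good t \<longleftrightarrow> t \<in> {0..T} \<and> integrable M (D t) \<and>
    (\<forall>\<xi>\<in>U. AE \<omega> in M. p ((t, \<xi>), \<omega>) = nn_cond_exp M (G t) (\<lambda>\<omega>. ennreal (g t \<xi> \<omega>)) \<omega>) \<and>
    (\<forall>\<xi>\<in>U. AE \<omega> in M. n ((t, \<xi>), \<omega>) = nn_cond_exp M (G t) (\<lambda>\<omega>. ennreal (- g t \<xi> \<omega>)) \<omega>)" for t
  have good_AE: "AE t in L. good t"
    using D_good cond_versionD(3)[OF p, unfolded AE_L[symmetric]] cond_versionD(3)[OF n, unfolded AE_L[symmetric]]
    unfolding good_def by eventually_elim simp
  \<comment> \<open>The expected deficit: at good times, truncated subtraction counts only the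
    scenarios where the conditional expectation of \<open>g\<close> is negative.\<close>
  define neg where "neg t \<xi> = (\<integral>\<^sup>+\<omega>. n ((t, \<xi>), \<omega>) - p ((t, \<xi>), \<omega>) \<partial>M)" for t \<xi>
  have good_pos: "0 \<le> (LINT \<omega>:A|M. g t \<xi> \<omega>)" if "good t" "\<xi> \<in> U" "neg t \<xi> = 0" "A \<in> sets (G t)" for t \<xi> A
    using that by (intro set_integral_version_sign(1)[OF sub g_int p_G _ n_G]) (auto simp: good_def neg_def)
  have good_neg: "(LINT \<omega>:{\<omega>\<in>space M. p ((t, \<xi>), \<omega>) < n ((t, \<xi>), \<omega>)}|M. g t \<xi> \<omega>) < 0"
    if "good t" "\<xi> \<in> U" "neg t \<xi> \<noteq> 0" for t \<xi>
    using that by (intro set_integral_version_sign(2)[OF sub g_int p_G _ n_G]) (auto simp: good_def neg_def)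
  have neg_meas: "(\<lambda>x. neg (fst x) (snd x)) \<in> borel_measurable (L \<Otimes>\<^sub>M S)"
    unfolding neg_def using p_meas n_meas
    by (intro borel_measurable_nn_integral) (simp add: case_prod_beta' borel_measurable_minus_ennreal)
  define B where "B = {x\<in>space (L \<Otimes>\<^sub>M S). neg (fst x) (snd x) \<noteq> 0}"
  have B_sets: "B \<in> sets (L \<Otimes>\<^sub>M S)"
    unfolding B_def using neg_meas by measurable
  have B_D: "t \<in> {0..T}" "\<xi> \<in> U" "neg t \<xi> \<noteq> 0" if "(t, \<xi>) \<in> B" for t \<xi>
    using that by (auto simp: B_def space_pair_measure space_restrict_space)
  have "bounded B"
    by (rule bounded_subset[of "{0..T} \<times> U"])
      (auto simp: B_def space_pair_measure space_restrict_space intro!: bounded_Times U)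
  have null: "AE t in lborel. t \<notin> fst ` B"
  proof (rule ccontr)
    assume "\<not> (AE t in lborel. t \<notin> fst ` B)"
    then obtain P s where P: "P \<in> sets borel" "0 < emeasure lborel P"
      and s: "s \<in> borel_measurable borel" "\<And>t. t \<in> P \<Longrightarrow> (t, s t) \<in> B"
      using borel_selection[OF sets_parameter_borel[OF B_sets] \<open>bounded B\<close>] by blast
    have "P \<noteq> {}" using P(2) by auto
    then obtain t0 where t0: "t0 \<in> P" by blast
    \<comment> \<open>Outside \<open>P\<close> one fixed admissible value is used, so that
      \<open>s'\<close> maps into \<open>U\<close> and the Dirac measure lies in \<open>M1 U\<close>
      at every time.\<close>
    define s' where "s' t = (if t \<in> P then s t else s t0)" for t
    have s'_U: "s' t \<in> U" for t
      using B_D(2)[OF s(2)] t0 by (simp add: s'_def)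
    have s'_meas: "s' \<in> measurable L S"
    proof (intro measurable_restrict_space2 measurable_restrict_space1)
      show "s' \<in> borel_measurable lborel"
        unfolding s'_def using s(1) P(1) by measurable
    qed (use s'_U in auto)
    have P_T: "t \<in> {0..T}" if "t \<in> P" for t
      using B_D(1)[OF s(2)[OF that]] .
    define A where "A t = {\<omega>\<in>space M. p ((t, s' t), \<omega>) < n ((t, s' t), \<omega>)}" for t
    \<comment> \<open>At time \<open>t\<close> the switching set is defined through \<open>p\<close>
      and \<open>n\<close>, which are measurable for \<open>G t\<close>; this keeps the control
      adapted.\<close>
    define u where "u t \<omega> = (if t \<in> P \<and> p ((t, s' t), \<omega>) < n ((t, s' t), \<omega>) then return S (s' t) else uo t \<omega>)" for t \<omega>
    have u: "u \<in> relaxed_controls M G T U"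
    proof (rule relaxed_controlsI)
      have pred: "{x\<in>space (time_prod T M). fst x \<in> P \<and> p ((fst x, s' (fst x)), snd x) < n ((fst x, s' (fst x)), snd x)} \<in> sets (time_prod T M)"
      proof -
        have [measurable]: "(\<lambda>x. p ((fst x, s' (fst x)), snd x)) \<in> borel_measurable (time_prod T M)"
          "(\<lambda>x. n ((fst x, s' (fst x)), snd x)) \<in> borel_measurable (time_prod T M)"
          using parameter_section_measurable[OF p_meas s'_meas] parameter_section_measurable[OF n_meas s'_meas]
          by (simp_all add: case_prod_beta')
        have "(\<lambda>t. t \<in> P) \<in> measurable L (count_space UNIV)"
          using P(1) by (intro measurable_restrict_space1) simp
        from measurable_compose[OF measurable_fst this]
        have [measurable]: "Measurable.pred (time_prod T M) (\<lambda>x. fst x \<in> P)" .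
        show ?thesis by measurable
      qed
      have "(\<lambda>x. return S (s' (fst x))) \<in> measurable (time_prod T M) (prob_algebra S)"
        by (intro measurable_compose[OF measurable_fst] measurable_compose[OF s'_meas] measurable_return_prob_space)
      then have "(\<lambda>x. if fst x \<in> P \<and> p ((fst x, s' (fst x)), snd x) < n ((fst x, s' (fst x)), snd x)
          then return S (s' (fst x)) else uo (fst x) (snd x)) \<in> measurable (time_prod T M) (prob_algebra S)"
        using kuo pred by (intro measurable_If) (simp_all add: case_prod_beta')
      then show "(\<lambda>(t, \<omega>). u t \<omega>) \<in> measurable (time_prod T M) (prob_algebra S)"
        by (simp add: u_def case_prod_beta')
    next
      fix t assume t: "t \<in> {0..T}"
      have [measurable]: "(\<lambda>\<omega>. p ((t, s' t), \<omega>)) \<in> borel_measurable (G t)" "(\<lambda>\<omega>. n ((t, s' t), \<omega>)) \<in> borel_measurable (G t)"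
        using p_G n_G t s'_U by auto
      have "return S (s' t) \<in> space (prob_algebra S)"
        using s'_U by (intro measurable_space[OF measurable_return_prob_space]) simp
      then have "(\<lambda>\<omega>. return S (s' t)) \<in> measurable (G t) (prob_algebra S)" by simp
      moreover have "{\<omega>\<in>space (G t). t \<in> P \<and> p ((t, s' t), \<omega>) < n ((t, s' t), \<omega>)} \<in> sets (G t)"
        by measurable
      ultimately show "u t \<in> measurable (G t) (prob_algebra S)"
        unfolding u_def using kernel_G[OF uo t] by (intro measurable_If) auto
    qed
    note ku = kernel_joint[OF u]
    define q where "q t = (\<integral>\<omega>. Hm t \<omega> (u t \<omega>) \<partial>M) - (\<integral>\<omega>. Hm t \<omega> (uo t \<omega>) \<partial>M)" for t
    have q_int: "integrable L q"
      unfolding q_def by (intro Bochner_Integration.integrable_diff cost_integrable ku kuo)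
    have "0 \<le> (\<integral>t. q t \<partial>L)"
      using le[OF u, unfolded cost_eq[OF ku] cost_eq[OF kuo]] cost_integrable[OF ku] cost_integrable[OF kuo]
      unfolding q_def by (subst Bochner_Integration.integral_diff) auto
    \<comment> \<open>\<open>q\<close> is the change of cost per unit of time. Being nonpositive
      with nonnegative integral, by optimality of \<open>uo\<close>, it vanishes almost everywhere;
      since it is negative at almost every time of \<open>P\<close>, the set \<open>P\<close> is
      null.\<close>
    have q_sign: "AE t in L. q t \<le> 0 \<and> (t \<in> P \<longrightarrow> q t < 0)"
      using good_AE
    proof eventually_elim
      case (elim t)
      then have t: "t \<in> {0..T}" "integrable M (D t)" by (auto simp: good_def)
      have "q t = (\<integral>\<omega>. Hm t \<omega> (u t \<omega>) - Hm t \<omega> (uo t \<omega>) \<partial>M)"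
        unfolding q_def
        by (intro Bochner_Integration.integral_diff[symmetric] Hm_section_integrable[OF t] kernel_section[OF _ t(1)] u uo)
      also have "\<dots> = (\<integral>\<omega>. indicator P t * (indicator (A t) \<omega> * g t (s' t) \<omega>) \<partial>M)"
        using s'_U t(1) by (intro Bochner_Integration.integral_cong) (auto simp: u_def A_def g_def Hm_return)
      also have "\<dots> = indicator P t * (LINT \<omega>:A t|M. g t (s' t) \<omega>)"
        by (simp add: set_lebesgue_integral_def)
      finally have q_eq: "q t = indicator P t * (LINT \<omega>:A t|M. g t (s' t) \<omega>)" .
      show ?case
      proof (cases "t \<in> P")
        case True
        then have "neg t (s' t) \<noteq> 0" using B_D(3)[OF s(2)[OF True]] by (simp add: s'_def)
        from good_neg[OF elim s'_U this] show ?thesis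
          using True by (simp add: q_eq A_def)
      qed (simp add: q_eq)
    qed
    have "AE t in L. - q t = 0"
    proof -
      have "AE t in L. 0 \<le> - q t" using q_sign by eventually_elim simp
      moreover from this have "0 \<le> (\<integral>t. - q t \<partial>L)" by (rule integral_nonneg_AE)
      ultimately show ?thesis
        using q_int \<open>0 \<le> (\<integral>t. q t \<partial>L)\<close> integral_nonneg_eq_0_iff_AE[of L "\<lambda>t. - q t"] by simp
    qed
    with q_sign have "AE t in L. t \<notin> P" by eventually_elim auto
    then have "AE t in lborel. t \<notin> P"
      unfolding AE_L by eventually_elim (use P_T in blast)
    then have "P \<in> null_sets lborel" using P(1) by (simp add: AE_iff_null_sets)
    then show False using P(2) by auto
  qed
  have "AE t in L. t \<notin> fst ` B"
    unfolding AE_L using null by eventually_elim simp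
  with good_AE show ?thesis
    unfolding AE_L[symmetric]
  proof eventually_elim
    case (elim t)
    then have t: "t \<in> {0..T}" "integrable M (D t)" by (auto simp: good_def)
    show ?case
    proof
      fix \<mu> assume \<mu>: "\<mu> \<in> M1 U"
      interpret \<mu>: prob_space \<mu> by (rule M1_D(1)[OF \<mu>])
      interpret P: pair_sigma_finite M \<mu> by unfold_locales
      have sets_\<mu>: "sets \<mu> = sets S" and space_\<mu>: "space \<mu> = U"
        using M1_D[OF \<mu>] by auto
      have int_uo: "integrable M (\<lambda>\<omega>. Hm t \<omega> (uo t \<omega>))" and int_\<mu>: "integrable M (\<lambda>\<omega>. Hm t \<omega> \<mu>)"
        by (rule Hm_section_integrable[OF t kernel_section[OF uo t(1)]])
          (rule Hm_section_integrable[OF t const_kernel[OF \<mu>]])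
      have "(LINT \<omega>:A|M. Hm t \<omega> (uo t \<omega>)) \<le> (LINT \<omega>:A|M. Hm t \<omega> \<mu>)" if A: "A \<in> sets (G t)" for A
      proof -
        have AM: "A \<in> sets M" using A sub[OF t(1)] by (auto simp: subalgebra_def)
        have meas: "(\<lambda>(\<omega>, \<xi>). h t \<omega> \<xi>) \<in> borel_measurable (M \<Otimes>\<^sub>M \<mu>)"
          using h_section_MU[OF t(1)] sets_\<mu> by (simp cong: measurable_cong_sets sets_pair_measure_cong)
        \<comment> \<open>The majorant does not depend on \<xi>, so integrability on
          \<open>M\<close> carries over to the product with the probability measure
          \<open>\<mu>\<close>, and the order of integration may be exchanged.\<close>
        have int_h: "integrable (M \<Otimes>\<^sub>M \<mu>) (\<lambda>(\<omega>, \<xi>). indicator A \<omega> * g t \<xi> \<omega>)"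
        proof (rule Bochner_Integration.integrable_bound)
          have "integrable M (\<lambda>\<omega>. D t \<omega> + \<bar>Hm t \<omega> (uo t \<omega>)\<bar>)"
            using t(2) int_uo by simp
          then show "integrable (M \<Otimes>\<^sub>M \<mu>) (\<lambda>(\<omega>, \<xi>). D t \<omega> + \<bar>Hm t \<omega> (uo t \<omega>)\<bar>)"
            by (intro P.Fubini_integrable) (auto simp: case_prod_beta' \<mu>.prob_space)
          show "(\<lambda>(\<omega>, \<xi>). indicator A \<omega> * g t \<xi> \<omega>) \<in> borel_measurable (M \<Otimes>\<^sub>M \<mu>)"
            using meas int_uo AM unfolding g_def by (simp add: case_prod_beta')
          show "AE x in M \<Otimes>\<^sub>M \<mu>. norm (case x of (\<omega>, \<xi>) \<Rightarrow> indicator A \<omega> * g t \<xi> \<omega>)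
            \<le> norm (case x of (\<omega>, \<xi>) \<Rightarrow> D t \<omega> + \<bar>Hm t \<omega> (uo t \<omega>)\<bar>)"
          proof (rule AE_I2)
            fix x assume "x \<in> space (M \<Otimes>\<^sub>M \<mu>)"
            then have "\<bar>h t (fst x) (snd x)\<bar> \<le> D t (fst x)"
              using h_le[OF t(1)] by (auto simp: space_pair_measure space_\<mu>)
            then show "norm (case x of (\<omega>, \<xi>) \<Rightarrow> indicator A \<omega> * g t \<xi> \<omega>)
              \<le> norm (case x of (\<omega>, \<xi>) \<Rightarrow> D t \<omega> + \<bar>Hm t \<omega> (uo t \<omega>)\<bar>)"
              by (auto simp: case_prod_beta' indicator_def g_def)
          qed
        qed
        \<comment> \<open>The time \<open>t\<close> avoids the projection of \<open>B\<close>, which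
          excludes a deficit for every \<xi> in \<open>U\<close> simultaneously.\<close>
        have "neg t \<xi> = 0" if "\<xi> \<in> U" for \<xi>
          using elim(2) that t(1) by (force simp: B_def space_pair_measure space_restrict_space)
        then have pos: "0 \<le> (LINT \<omega>:A|M. g t \<xi> \<omega>)" if "\<xi> \<in> U" for \<xi>
          using good_pos[OF elim(1) that _ A] that by simp
        have "(LINT \<omega>:A|M. Hm t \<omega> \<mu>) - (LINT \<omega>:A|M. Hm t \<omega> (uo t \<omega>))
          = (LINT \<omega>:A|M. Hm t \<omega> \<mu> - Hm t \<omega> (uo t \<omega>))"
          using int_uo int_\<mu> AM by (intro set_integral_diff(2)[symmetric] integrable_imp_set_integrable)
        also have "\<dots> = (\<integral>\<omega>. (\<integral>\<xi>. indicator A \<omega> * g t \<xi> \<omega> \<partial>\<mu>) \<partial>M)"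
          unfolding set_lebesgue_integral_def
        proof (rule Bochner_Integration.integral_cong[OF refl])
          fix \<omega> assume \<omega>: "\<omega> \<in> space M"
          have "(\<integral>\<xi>. g t \<xi> \<omega> \<partial>\<mu>) = Hm t \<omega> \<mu> - Hm t \<omega> (uo t \<omega>)"
            using h_integrable[OF M1_D(4)[OF \<mu>] t(1) \<omega>] by (simp add: g_def Hm_def \<mu>.prob_space)
          then show "indicator A \<omega> *\<^sub>R (Hm t \<omega> \<mu> - Hm t \<omega> (uo t \<omega>)) = (\<integral>\<xi>. indicator A \<omega> * g t \<xi> \<omega> \<partial>\<mu>)"
            by simp
        qed
        also have "\<dots> = (\<integral>\<xi>. (\<integral>\<omega>. indicator A \<omega> * g t \<xi> \<omega> \<partial>M) \<partial>\<mu>)"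
          by (rule P.Fubini_integral[OF int_h, symmetric])
        also have "\<dots> \<ge> 0"
        proof (rule integral_nonneg_AE, rule AE_I2)
          fix \<xi> assume "\<xi> \<in> space \<mu>"
          then show "0 \<le> (\<integral>\<omega>. indicator A \<omega> * g t \<xi> \<omega> \<partial>M)"
            using pos[of \<xi>] by (simp add: space_\<mu> set_lebesgue_integral_def)
        qed
        finally show ?thesis by simp
      qed
      then show "AE \<omega> in M. real_cond_exp M (G t) (\<lambda>\<omega>. Hm t \<omega> (uo t \<omega>)) \<omega> \<le> real_cond_exp M (G t) (\<lambda>\<omega>. Hm t \<omega> \<mu>) \<omega>"
        by (subst real_cond_exp_le_iff[OF sub[OF t(1)] int_uo int_\<mu>]) blast
    qed
  qed
qed

end

section \<open>The Hamiltonian along the optimal pair\<close>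

text \<open>This is the Frobenius inner product; it gives the diffusion term the same form as the
  drift term.\<close>

lemma trace_transpose_mult:
  fixes Q A :: "real^'m^'n"
  shows "trace (transpose Q ** A) = Q \<bullet> A"
  by (simp add: trace_def transpose_def matrix_matrix_mult_def inner_vec_def) (rule sum.swap)

text \<open>State and adjoint pair are bundled into one point of a separable metric space; at a
  fixed time this function is the \<open>\<gamma>\<close> of the approximation argument.\<close>

definition integrand ::
  "(real \<Rightarrow> real^'n \<Rightarrow> real^'d \<Rightarrow> real^'n) \<Rightarrow> (real \<Rightarrow> real^'n \<Rightarrow> real^'d \<Rightarrow> real^'m^'n) \<Rightarrow>
   (real \<Rightarrow> real^'n \<Rightarrow> real^'d \<Rightarrow> real) \<Rightarrow>
   real \<Rightarrow> (real^'n) \<times> (real^'n) \<times> (real^'m^'n) \<Rightarrow> real^'d \<Rightarrow> real" where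
  "integrand b \<sigma> ell t = (\<lambda>(x, p, q) \<xi>. b t x \<xi> \<bullet> p + q \<bullet> \<sigma> t x \<xi> + ell t x \<xi>)"

context partially_observed_control
begin

section \<open>Bounds and continuity of the Hamiltonian density\<close>

lemma information_M: "0 \<le> t \<Longrightarrow> subalgebra M (G t)"
  using information[of t] filtration
  unfolding complete_filtration_def subalgebra_def by (metis subset_trans)

lemma filtration_measurable: "0 \<le> t \<Longrightarrow> f \<in> measurable (F t) N \<Longrightarrow> f \<in> measurable M N"
  using filtration measurable_from_subalg[of M "F t" f N] by (simp add: complete_filtration_def)

lemma coefficient_measurable:
  assumes "t \<in> {0..T}"
  shows "b t x \<in> borel_measurable (restrict_space borel U)"
    "\<sigma> t x \<in> borel_measurable (restrict_space borel U)"
    "ell t x \<in> borel_measurable (restrict_space borel U)"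
proof -
  \<comment> \<open>\<open>V\<close> is \<open>UNIV\<close> for \<open>b\<close> and
    \<open>\<sigma>\<close> but \<open>U\<close> for \<open>ell\<close>, whose measurability is
    given only on the control set.\<close>
  have *: "(\<lambda>\<xi>. (t, x, \<xi>)) \<in> measurable (restrict_space borel U) (restrict_space borel ({0..T} \<times> UNIV \<times> V))"
    if "U \<subseteq> V" for V
    using assms that
    by (intro measurable_restrict_space2 borel_measurable_Pair measurable_const measurable_restrict_space1)
      (auto simp: space_restrict_space)
  from measurable_compose[OF *[of UNIV] borel(1)] measurable_compose[OF *[of UNIV] borel(2)]
    measurable_compose[OF *[of U] borel(3)]
  show "b t x \<in> borel_measurable (restrict_space borel U)"
    "\<sigma> t x \<in> borel_measurable (restrict_space borel U)"
    "ell t x \<in> borel_measurable (restrict_space borel U)" by simp_all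
qed

lemma coefficient_bounds:
  obtains K h where
    "K \<in> borel_measurable (restrict_space lborel {0..T})"
    "integrable (restrict_space lborel {0..T}) (\<lambda>t. (K t)\<^sup>2)"
    "integrable (restrict_space lborel {0..T}) h"
    "\<And>t. t \<in> {0..T} \<Longrightarrow> 0 \<le> K t" "\<And>t. t \<in> {0..T} \<Longrightarrow> 0 \<le> h t"
    "\<And>t x y \<xi>. t \<in> {0..T} \<Longrightarrow> \<xi> \<in> U \<Longrightarrow> norm (b t x \<xi> - b t y \<xi>) \<le> K t * norm (x - y)"
    "\<And>t x \<xi>. t \<in> {0..T} \<Longrightarrow> \<xi> \<in> U \<Longrightarrow> norm (b t x \<xi>) \<le> K t * (1 + norm x)"
    "\<And>t x y \<xi>. t \<in> {0..T} \<Longrightarrow> \<xi> \<in> U \<Longrightarrow> norm (\<sigma> t x \<xi> - \<sigma> t y \<xi>) \<le> K t * norm (x - y)"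
    "\<And>t x \<xi>. t \<in> {0..T} \<Longrightarrow> \<xi> \<in> U \<Longrightarrow> norm (\<sigma> t x \<xi>) \<le> K t * (1 + norm x)"
    "\<And>t x \<xi>. t \<in> {0..T} \<Longrightarrow> \<xi> \<in> U \<Longrightarrow> \<bar>ell t x \<xi>\<bar> \<le> h t * (1 + (norm x)\<^sup>2)"
proof -
  obtain K where K: "set_borel_measurable lborel {0..T} K" "set_integrable lborel {0..T} (\<lambda>t. (K t)\<^sup>2)"
    "\<forall>t\<in>{0..T}. 0 \<le> K t \<and> (\<forall>\<xi>\<in>U. \<forall>x y.
         norm (b t x \<xi> - b t y \<xi>) \<le> K t * norm (x - y) \<and>
         norm (b t x \<xi>) \<le> K t * (1 + norm x) \<and>
         norm (\<sigma> t x \<xi> - \<sigma> t y \<xi>) \<le> K t * norm (x - y) \<and>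
         norm (\<sigma> t x \<xi>) \<le> K t * (1 + norm x))"
    using A1_A4 by blast
  obtain h where h: "set_integrable lborel {0..T} h"
    "\<forall>t\<in>{0..T}. 0 \<le> h t \<and> (\<forall>\<xi>\<in>U. \<forall>x. \<bar>ell t x \<xi>\<bar> \<le> h t * (1 + (norm x)\<^sup>2))"
    using a2 by blast
  show thesis
  proof (rule that[of K h])
    show "K \<in> borel_measurable (restrict_space lborel {0..T})"
      using K(1) by (simp add: set_borel_measurable_def borel_measurable_restrict_space_iff)
    show "integrable (restrict_space lborel {0..T}) (\<lambda>t. (K t)\<^sup>2)" "integrable (restrict_space lborel {0..T}) h"
      using K(2) h(1) by (simp_all add: set_integrable_def integrable_restrict_space)
  qed (use K(3) h(2) in blast)+
qed

text \<open>Uniformly on \<open>U\<close>, \<open>b\<close> and \<open>\<sigma>\<close> are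
  Lipschitz with constant \<open>K t\<close> and \<open>ell\<close> is continuous in the state;
  Cauchy-Schwarz controls the inner products. The radius may depend on the time, which is fixed
  here.\<close>

lemma integrand_approximation:
  assumes t: "t \<in> {0..T}"
  shows "integrand b \<sigma> ell t z \<in> borel_measurable (restrict_space borel U)"
    and "\<exists>B. \<forall>\<xi>\<in>U. \<bar>integrand b \<sigma> ell t z \<xi>\<bar> \<le> B"
    and "0 < e \<Longrightarrow> \<exists>\<delta>>0. \<forall>z'. dist z' z < \<delta> \<longrightarrow>
      (\<forall>\<xi>\<in>U. \<bar>integrand b \<sigma> ell t z' \<xi> - integrand b \<sigma> ell t z \<xi>\<bar> < e)"
proof -
  obtain K h where K: "0 \<le> K t"
    "\<And>x y \<xi>. \<xi> \<in> U \<Longrightarrow> norm (b t x \<xi> - b t y \<xi>) \<le> K t * norm (x - y)"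
    "\<And>x \<xi>. \<xi> \<in> U \<Longrightarrow> norm (b t x \<xi>) \<le> K t * (1 + norm x)"
    "\<And>x y \<xi>. \<xi> \<in> U \<Longrightarrow> norm (\<sigma> t x \<xi> - \<sigma> t y \<xi>) \<le> K t * norm (x - y)"
    "\<And>x \<xi>. \<xi> \<in> U \<Longrightarrow> norm (\<sigma> t x \<xi>) \<le> K t * (1 + norm x)"
    "\<And>x \<xi>. \<xi> \<in> U \<Longrightarrow> \<bar>ell t x \<xi>\<bar> \<le> h t * (1 + (norm x)\<^sup>2)"
    using coefficient_bounds t by metis
  obtain x p q where z: "z = (x, p, q)" by (cases z) auto
  show "integrand b \<sigma> ell t z \<in> borel_measurable (restrict_space borel U)"
    using coefficient_measurable[OF t, of x] by (simp add: integrand_def z)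
  have inner: "\<bar>v \<bullet> w\<bar> \<le> B * C" if "norm v \<le> B" "norm w \<le> C" for v w :: "'z::real_inner" and B C
    using that by (intro order_trans[OF Cauchy_Schwarz_ineq2] mult_mono order_trans[OF norm_ge_zero that(1)]) auto
  show "\<exists>B. \<forall>\<xi>\<in>U. \<bar>integrand b \<sigma> ell t z \<xi>\<bar> \<le> B"
  proof (intro exI ballI)
    fix \<xi> assume \<xi>: "\<xi> \<in> U"
    have "\<bar>b t x \<xi> \<bullet> p\<bar> \<le> K t * (1 + norm x) * norm p" "\<bar>q \<bullet> \<sigma> t x \<xi>\<bar> \<le> norm q * (K t * (1 + norm x))"
      using K(3,5)[OF \<xi>] by (intro inner; simp)+
    with K(6)[OF \<xi>, of x]
    show "\<bar>integrand b \<sigma> ell t z \<xi>\<bar> \<le> K t * (1 + norm x) * norm p + norm q * (K t * (1 + norm x)) + h t * (1 + (norm x)\<^sup>2)"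
      by (simp add: integrand_def z)
  qed
  assume e: "0 < e"
  obtain \<delta>1 where \<delta>1: "0 < \<delta>1" "\<And>y \<xi>. dist y x < \<delta>1 \<Longrightarrow> \<xi> \<in> U \<Longrightarrow> dist (ell t y \<xi>) (ell t x \<xi>) < e / 2"
    using a1[OF t, of "e / 2" x] e by auto
  \<comment> \<open>\<open>\<Psi>\<close> bounds the change of the drift and diffusion terms without
    reference to \<xi>. It is continuous in \<open>z'\<close> and vanishes at \<open>z\<close>,
    which yields the radius \<open>\<delta>2\<close>.\<close>
  define \<Psi> where "\<Psi> z' = K t * norm (fst z' - x) * norm (fst (snd z')) + K t * (1 + norm x) * norm (fst (snd z') - p)
    + (norm (snd (snd z')) * (K t * norm (fst z' - x)) + norm (snd (snd z') - q) * (K t * (1 + norm x)))"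
    for z' :: "(real^'n) \<times> (real^'n) \<times> (real^'m^'n)"
  have "open {z'. \<Psi> z' < e / 2}"
    unfolding \<Psi>_def by (intro open_Collect_less continuous_intros)
  moreover have "z \<in> {z'. \<Psi> z' < e / 2}" using e by (simp add: \<Psi>_def z)
  ultimately obtain \<delta>2 where \<delta>2: "0 < \<delta>2" "ball z \<delta>2 \<subseteq> {z'. \<Psi> z' < e / 2}"
    by (rule openE)
  show "\<exists>\<delta>>0. \<forall>z'. dist z' z < \<delta> \<longrightarrow> (\<forall>\<xi>\<in>U. \<bar>integrand b \<sigma> ell t z' \<xi> - integrand b \<sigma> ell t z \<xi>\<bar> < e)"
  proof (intro exI[of _ "min \<delta>1 \<delta>2"] conjI allI impI ballI)
    fix z' \<xi> assume z'_dist: "dist z' z < min \<delta>1 \<delta>2" and \<xi>: "\<xi> \<in> U"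
    obtain x' p' q' where z': "z' = (x', p', q')" by (cases z') auto
    have "dist x' x \<le> dist z' z" using dist_fst_le[of z' z] by (simp add: z z')
    then have l: "\<bar>ell t x' \<xi> - ell t x \<xi>\<bar> < e / 2"
      using \<delta>1(2)[of x' \<xi>] z'_dist \<xi> by (simp add: dist_real_def)
    have \<Psi>: "\<Psi> z' < e / 2"
      using \<delta>2(2) z'_dist by (auto simp: dist_commute)
    have "b t x' \<xi> \<bullet> p' - b t x \<xi> \<bullet> p = (b t x' \<xi> - b t x \<xi>) \<bullet> p' + b t x \<xi> \<bullet> (p' - p)"
      by (simp add: inner_diff_left inner_diff_right)
    moreover have "\<bar>(b t x' \<xi> - b t x \<xi>) \<bullet> p'\<bar> \<le> K t * norm (x' - x) * norm p'"
      "\<bar>b t x \<xi> \<bullet> (p' - p)\<bar> \<le> K t * (1 + norm x) * norm (p' - p)"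
      using K(2,3)[OF \<xi>] by (intro inner; simp)+
    moreover have "q' \<bullet> \<sigma> t x' \<xi> - q \<bullet> \<sigma> t x \<xi> = q' \<bullet> (\<sigma> t x' \<xi> - \<sigma> t x \<xi>) + (q' - q) \<bullet> \<sigma> t x \<xi>"
      by (simp add: inner_diff_left inner_diff_right)
    moreover have "\<bar>q' \<bullet> (\<sigma> t x' \<xi> - \<sigma> t x \<xi>)\<bar> \<le> norm q' * (K t * norm (x' - x))"
      "\<bar>(q' - q) \<bullet> \<sigma> t x \<xi>\<bar> \<le> norm (q' - q) * (K t * (1 + norm x))"
      using K(4,5)[OF \<xi>] by (intro inner; simp)+
    ultimately show "\<bar>integrand b \<sigma> ell t z' \<xi> - integrand b \<sigma> ell t z \<xi>\<bar> < e"
      using l \<Psi> unfolding integrand_def z z' \<Psi>_def prod.case fst_conv snd_conv by linarith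
  qed (use \<delta>1 \<delta>2 in auto)
qed

text \<open>The three averages may be merged because each coefficient is bounded on \<open>U\<close>
  at a fixed time and state.\<close>

lemma hamiltonian_eq_integral:
  assumes t: "t \<in> {0..T}" and \<nu>: "\<nu> \<in> M1 U"
  shows "hamiltonian b \<sigma> ell t x p q \<nu> = (\<integral>\<xi>. integrand b \<sigma> ell t (x, p, q) \<xi> \<partial>\<nu>)"
proof -
  interpret \<nu>: prob_space \<nu> by (rule M1_D(1)[OF \<nu>])
  obtain K h where K: "\<And>\<xi>. \<xi> \<in> U \<Longrightarrow> norm (b t x \<xi>) \<le> K t * (1 + norm x)"
    "\<And>\<xi>. \<xi> \<in> U \<Longrightarrow> norm (\<sigma> t x \<xi>) \<le> K t * (1 + norm x)"
    "\<And>\<xi>. \<xi> \<in> U \<Longrightarrow> \<bar>ell t x \<xi>\<bar> \<le> h t * (1 + (norm x)\<^sup>2)"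
    using coefficient_bounds t by metis
  have int: "integrable \<nu> (b t x)" "integrable \<nu> (\<sigma> t x)" "integrable \<nu> (ell t x)"
  proof -
    have "b t x \<in> borel_measurable \<nu>" "\<sigma> t x \<in> borel_measurable \<nu>" "ell t x \<in> borel_measurable \<nu>"
      using coefficient_measurable[OF t] M1_D(2)[OF \<nu>] by (simp_all cong: measurable_cong_sets)
    note meas = this
    show "integrable \<nu> (b t x)"
      by (rule \<nu>.integrable_const_bound[OF _ meas(1), of "K t * (1 + norm x)"])
        (use K(1) M1_D(3)[OF \<nu>] in auto)
    show "integrable \<nu> (\<sigma> t x)"
      by (rule \<nu>.integrable_const_bound[OF _ meas(2), of "K t * (1 + norm x)"])
        (use K(2) M1_D(3)[OF \<nu>] in auto)
    show "integrable \<nu> (ell t x)"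
      by (rule \<nu>.integrable_const_bound[OF _ meas(3), of "h t * (1 + (norm x)\<^sup>2)"])
        (use K(3) M1_D(3)[OF \<nu>] in auto)
  qed
  show ?thesis
    using int by (simp add: hamiltonian_def integrand_def trace_transpose_mult)
qed

context
  fixes xo \<psi> :: "real \<Rightarrow> 'w \<Rightarrow> real^'n" and Q :: "real \<Rightarrow> 'w \<Rightarrow> real^'m^'n"
  assumes xo: "xo \<in> B_infty_a M F T" and \<psi>: "\<psi> \<in> L2_a M F T" and Q: "Q \<in> L2_a M F T"
begin

lemma process_measurable:
  "(\<lambda>(t, \<omega>). xo t \<omega>) \<in> borel_measurable (time_prod T M)"
  "(\<lambda>(t, \<omega>). \<psi> t \<omega>) \<in> borel_measurable (time_prod T M)"
  "(\<lambda>(t, \<omega>). Q t \<omega>) \<in> borel_measurable (time_prod T M)"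
  using xo \<psi> Q by (simp_all add: B_infty_a_def L2_a_def adapted_process_def)

lemma process_section_measurable:
  assumes "t \<in> {0..T}"
  shows "(\<lambda>\<omega>. (xo t \<omega>, \<psi> t \<omega>, Q t \<omega>)) \<in> borel_measurable M"
  using xo \<psi> Q assms
  by (intro borel_measurable_Pair filtration_measurable[of t])
    (auto simp: B_infty_a_def L2_a_def adapted_process_def)

text \<open>The weight \<open>k\<close> is only integrable in time, so the second moment of
  \<open>xo\<close> has to be bounded uniformly in time; this is what \<open>B_infty_a\<close>
  provides.\<close>

lemma weighted_moment_integrable:
  assumes k: "integrable (restrict_space lborel {0..T}) k"
  shows "integrable (time_prod T M) (\<lambda>(t, \<omega>). k t * (1 + (norm (xo t \<omega>))\<^sup>2))"
proof -
  let ?L = "restrict_space lborel {0..T}"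
  interpret L: finite_measure ?L
    by (rule finite_measureI) (use horizon in \<open>simp add: emeasure_restrict_space space_restrict_space\<close>)
  interpret pair_sigma_finite ?L M by unfold_locales
  have k_meas [measurable]: "k \<in> borel_measurable ?L" using k by auto
  have int: "integrable M (\<lambda>\<omega>. (norm (xo t \<omega>))\<^sup>2)" if "t \<in> {0..T}" for t
    using xo that by (simp add: B_infty_a_def)
  obtain C where C: "\<And>t. t \<in> {0..T} \<Longrightarrow> (\<integral>\<omega>. (norm (xo t \<omega>))\<^sup>2 \<partial>M) \<le> C"
    using xo unfolding B_infty_a_def bdd_above_def by blast
  have [measurable]: "(\<lambda>x. xo (fst x) (snd x)) \<in> borel_measurable (?L \<Otimes>\<^sub>M M)"
    using process_measurable(1) by (simp add: case_prod_beta')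
  have meas: "(\<lambda>x. k (fst x) * (1 + (norm (xo (fst x) (snd x)))\<^sup>2)) \<in> borel_measurable (?L \<Otimes>\<^sub>M M)"
    by measurable
  show ?thesis
    unfolding case_prod_beta'
  proof (rule Fubini_integrable[OF meas])
    show "AE t in ?L. integrable M (\<lambda>\<omega>. k (fst (t, \<omega>)) * (1 + (norm (xo (fst (t, \<omega>)) (snd (t, \<omega>))))\<^sup>2))"
      using int by (intro AE_I2) (simp add: space_restrict_space)
    have "integrable ?L (\<lambda>t. \<bar>k t\<bar> * (1 + C))" using k by simp
    then show "integrable ?L (\<lambda>t. \<integral>\<omega>. norm (k (fst (t, \<omega>)) * (1 + (norm (xo (fst (t, \<omega>)) (snd (t, \<omega>))))\<^sup>2)) \<partial>M)"
    proof (rule Bochner_Integration.integrable_bound)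
      show "(\<lambda>t. \<integral>\<omega>. norm (k (fst (t, \<omega>)) * (1 + (norm (xo (fst (t, \<omega>)) (snd (t, \<omega>))))\<^sup>2)) \<partial>M) \<in> borel_measurable ?L"
        unfolding fst_conv snd_conv by measurable
      show "AE t in ?L. norm (\<integral>\<omega>. norm (k (fst (t, \<omega>)) * (1 + (norm (xo (fst (t, \<omega>)) (snd (t, \<omega>))))\<^sup>2)) \<partial>M)
        \<le> norm (\<bar>k t\<bar> * (1 + C))"
      proof (rule AE_I2)
        fix t assume "t \<in> space ?L"
        then have t: "t \<in> {0..T}" by (simp add: space_restrict_space)
        let ?m = "\<integral>\<omega>. (norm (xo t \<omega>))\<^sup>2 \<partial>M"
        have eq: "(\<integral>\<omega>. norm (k t * (1 + (norm (xo t \<omega>))\<^sup>2)) \<partial>M) = \<bar>k t\<bar> * (1 + ?m)"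
          using int[OF t] by (simp add: abs_mult prob_space)
        have "0 \<le> ?m" by simp
        then show "norm (\<integral>\<omega>. norm (k (fst (t, \<omega>)) * (1 + (norm (xo (fst (t, \<omega>)) (snd (t, \<omega>))))\<^sup>2)) \<partial>M)
          \<le> norm (\<bar>k t\<bar> * (1 + C))"
          unfolding fst_conv snd_conv eq using C[OF t] by (auto simp: abs_mult intro!: mult_left_mono)
      qed
    qed
  qed
qed

text \<open>Young's inequality splits the inner products: the squares of \<open>\<psi>\<close> and
  \<open>Q\<close> are integrable, and what remains is an integrable weight in time multiplied by
  \<open>1 + (norm (xo t \<omega>))\<^sup>2\<close>.\<close>

lemma hamiltonian_integrand:
  "\<exists>D. controlled_integrand M G T U (\<lambda>t \<omega>. integrand b \<sigma> ell t (xo t \<omega>, \<psi> t \<omega>, Q t \<omega>)) D"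
proof -
  let ?L = "restrict_space lborel {0..T}" and ?S = "restrict_space borel U"
  obtain K h where K: "integrable ?L (\<lambda>t. (K t)\<^sup>2)" "integrable ?L h"
    "\<And>t x \<xi>. t \<in> {0..T} \<Longrightarrow> \<xi> \<in> U \<Longrightarrow> norm (b t x \<xi>) \<le> K t * (1 + norm x)"
    "\<And>t x \<xi>. t \<in> {0..T} \<Longrightarrow> \<xi> \<in> U \<Longrightarrow> norm (\<sigma> t x \<xi>) \<le> K t * (1 + norm x)"
    "\<And>t x \<xi>. t \<in> {0..T} \<Longrightarrow> \<xi> \<in> U \<Longrightarrow> \<bar>ell t x \<xi>\<bar> \<le> h t * (1 + (norm x)\<^sup>2)"
    by (rule coefficient_bounds) blast
  \<comment> \<open>\<open>(K t)\<^sup>2\<close> is counted twice, once for the drift paired with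
    \<open>\<psi>\<close> and once for the diffusion paired with \<open>Q\<close>.\<close>
  define D where "D t \<omega> = (2 * (K t)\<^sup>2 + h t) * (1 + (norm (xo t \<omega>))\<^sup>2) + ((norm (\<psi> t \<omega>))\<^sup>2 + (norm (Q t \<omega>))\<^sup>2)" for t \<omega>
  have "controlled_integrand M G T U (\<lambda>t \<omega>. integrand b \<sigma> ell t (xo t \<omega>, \<psi> t \<omega>, Q t \<omega>)) D"
  proof
    show "subalgebra M (G t)" if "t \<in> {0..T}" for t
      using that by (intro information_M) simp
    show "closed U" "bounded U" by (fact control_set)+
    have [measurable]: "(\<lambda>x. xo (fst (fst x)) (snd x)) \<in> borel_measurable ((?L \<Otimes>\<^sub>M ?S) \<Otimes>\<^sub>M M)"
      "(\<lambda>x. \<psi> (fst (fst x)) (snd x)) \<in> borel_measurable ((?L \<Otimes>\<^sub>M ?S) \<Otimes>\<^sub>M M)"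
      "(\<lambda>x. Q (fst (fst x)) (snd x)) \<in> borel_measurable ((?L \<Otimes>\<^sub>M ?S) \<Otimes>\<^sub>M M)"
    proof -
      have "(\<lambda>x. (fst (fst x), snd x)) \<in> measurable ((?L \<Otimes>\<^sub>M ?S) \<Otimes>\<^sub>M M) (time_prod T M)"
        by measurable
      note this[THEN measurable_compose, OF process_measurable(1)]
        this[THEN measurable_compose, OF process_measurable(2)]
        this[THEN measurable_compose, OF process_measurable(3)]
      then show "(\<lambda>x. xo (fst (fst x)) (snd x)) \<in> borel_measurable ((?L \<Otimes>\<^sub>M ?S) \<Otimes>\<^sub>M M)"
        "(\<lambda>x. \<psi> (fst (fst x)) (snd x)) \<in> borel_measurable ((?L \<Otimes>\<^sub>M ?S) \<Otimes>\<^sub>M M)"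
        "(\<lambda>x. Q (fst (fst x)) (snd x)) \<in> borel_measurable ((?L \<Otimes>\<^sub>M ?S) \<Otimes>\<^sub>M M)"
        by simp_all
    qed
    have arg: "(\<lambda>x. (fst (fst x), xo (fst (fst x)) (snd x), snd (fst x)))
      \<in> measurable ((?L \<Otimes>\<^sub>M ?S) \<Otimes>\<^sub>M M) (restrict_space borel ({0..T} \<times> UNIV \<times> V))" if "U \<subseteq> V" for V
    proof (intro measurable_restrict_space2 borel_measurable_Pair)
      show "(\<lambda>x. (fst (fst x), xo (fst (fst x)) (snd x), snd (fst x))) \<in> space ((?L \<Otimes>\<^sub>M ?S) \<Otimes>\<^sub>M M) \<rightarrow> {0..T} \<times> UNIV \<times> V"
        using that by (auto simp: space_pair_measure space_restrict_space)
      show "(\<lambda>x. fst (fst x)) \<in> borel_measurable ((?L \<Otimes>\<^sub>M ?S) \<Otimes>\<^sub>M M)"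
        by (intro measurable_compose[OF measurable_fst] measurable_compose[OF measurable_fst] measurable_restrict_space1) simp
      show "(\<lambda>x. snd (fst x)) \<in> borel_measurable ((?L \<Otimes>\<^sub>M ?S) \<Otimes>\<^sub>M M)"
        by (intro measurable_compose[OF measurable_fst] measurable_compose[OF measurable_snd] measurable_restrict_space1) simp
    qed measurable
    have [measurable]: "(\<lambda>x. b (fst (fst x)) (xo (fst (fst x)) (snd x)) (snd (fst x))) \<in> borel_measurable ((?L \<Otimes>\<^sub>M ?S) \<Otimes>\<^sub>M M)"
      "(\<lambda>x. \<sigma> (fst (fst x)) (xo (fst (fst x)) (snd x)) (snd (fst x))) \<in> borel_measurable ((?L \<Otimes>\<^sub>M ?S) \<Otimes>\<^sub>M M)"
      "(\<lambda>x. ell (fst (fst x)) (xo (fst (fst x)) (snd x)) (snd (fst x))) \<in> borel_measurable ((?L \<Otimes>\<^sub>M ?S) \<Otimes>\<^sub>M M)"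
      using measurable_compose[OF arg[of UNIV] borel(1)] measurable_compose[OF arg[of UNIV] borel(2)]
        measurable_compose[OF arg[of U] borel(3)] by simp_all
    show "(\<lambda>((t, \<xi>), \<omega>). integrand b \<sigma> ell t (xo t \<omega>, \<psi> t \<omega>, Q t \<omega>) \<xi>)
      \<in> borel_measurable ((?L \<Otimes>\<^sub>M ?S) \<Otimes>\<^sub>M M)"
      unfolding integrand_def case_prod_beta' fst_conv snd_conv by measurable
    have "integrable (time_prod T M) (\<lambda>(t, \<omega>). (2 * (K t)\<^sup>2 + h t) * (1 + (norm (xo t \<omega>))\<^sup>2))"
      using K(1,2) by (intro weighted_moment_integrable) simp
    moreover have "integrable (time_prod T M) (\<lambda>(t, \<omega>). (norm (\<psi> t \<omega>))\<^sup>2)"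
      "integrable (time_prod T M) (\<lambda>(t, \<omega>). (norm (Q t \<omega>))\<^sup>2)"
      using \<psi> Q by (simp_all add: L2_a_def)
    ultimately show "integrable (time_prod T M) (\<lambda>(t, \<omega>). D t \<omega>)"
      unfolding D_def case_prod_beta' by (intro Bochner_Integration.integrable_add)
    fix t \<omega> \<xi> assume t: "t \<in> {0..T}" and \<xi>: "\<xi> \<in> U"
    \<comment> \<open>The factor 1/2 in Young's inequality absorbs the factor 2 from
      \<open>(1 + a)\<^sup>2 \<le> 2 * (1 + a\<^sup>2)\<close>.\<close>
    have young: "\<bar>v \<bullet> w\<bar> \<le> (K t)\<^sup>2 * (1 + (norm (xo t \<omega>))\<^sup>2) + (norm w)\<^sup>2"
      if "norm v \<le> K t * (1 + norm (xo t \<omega>))" for v w :: "'z::real_inner"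
    proof -
      let ?c = "K t * (1 + norm (xo t \<omega>))"
      have "\<bar>v \<bullet> w\<bar> \<le> norm v * norm w" by (rule Cauchy_Schwarz_ineq2)
      also have "\<dots> \<le> ?c * norm w" using that by (intro mult_right_mono) auto
      also have "\<dots> \<le> (?c\<^sup>2 + (norm w)\<^sup>2) / 2"
        using sum_squares_bound[of ?c "norm w"] by simp
      also have "?c\<^sup>2 \<le> (K t)\<^sup>2 * (2 * (1 + (norm (xo t \<omega>))\<^sup>2))"
        unfolding power_mult_distrib
        using sum_squares_bound[of 1 "norm (xo t \<omega>)"]
        by (intro mult_left_mono) (auto simp: power2_sum)
      finally have "\<bar>v \<bullet> w\<bar> \<le> (K t)\<^sup>2 * (1 + (norm (xo t \<omega>))\<^sup>2) + (norm w)\<^sup>2 / 2"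
        by (simp add: field_simps)
      moreover have "(norm w)\<^sup>2 / 2 \<le> (norm w)\<^sup>2" by simp
      ultimately show ?thesis by linarith
    qed
    show "\<bar>integrand b \<sigma> ell t (xo t \<omega>, \<psi> t \<omega>, Q t \<omega>) \<xi>\<bar> \<le> D t \<omega>"
      using young[OF K(3)[OF t \<xi>], of "\<psi> t \<omega>"] young[OF K(4)[OF t \<xi>], of "Q t \<omega>"] K(5)[OF t \<xi>, of "xo t \<omega>"]
      by (simp add: integrand_def D_def inner_commute[of "Q t \<omega>"] algebra_simps)
  qed
  then show ?thesis by blast
qed

text \<open>\<open>hamiltonian\<close> agrees with the abstract \<open>Hm\<close> for times in
  \<open>{0..T}\<close> and measures in \<open>M1 U\<close>, which covers every value that a control
  takes there. The agreement passes through the time integrals and, almost surely, through the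
  conditional expectations; then the two abstract implications apply.\<close>

lemma hamiltonian_integral_iff_conditional:
  assumes info: "measurable_information M G T" and uo: "uo \<in> relaxed_controls M G T U"
  shows "(\<forall>u\<in>relaxed_controls M G T U.
        (\<integral>\<omega>. (LINT t:{0..T}|lborel. hamiltonian b \<sigma> ell t (xo t \<omega>) (\<psi> t \<omega>) (Q t \<omega>) (u t \<omega>)) \<partial>M)
        \<ge> (\<integral>\<omega>. (LINT t:{0..T}|lborel. hamiltonian b \<sigma> ell t (xo t \<omega>) (\<psi> t \<omega>) (Q t \<omega>) (uo t \<omega>)) \<partial>M))
     \<longleftrightarrow>
     (AE t in lborel. t \<in> {0..T} \<longrightarrow> (\<forall>\<mu>\<in>M1 U. AE \<omega> in M.
        real_cond_exp M (G t) (\<lambda>\<omega>. hamiltonian b \<sigma> ell t (xo t \<omega>) (\<psi> t \<omega>) (Q t \<omega>) \<mu>) \<omega>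
        \<ge> real_cond_exp M (G t) (\<lambda>\<omega>. hamiltonian b \<sigma> ell t (xo t \<omega>) (\<psi> t \<omega>) (Q t \<omega>) (uo t \<omega>)) \<omega>))"
    (is "(\<forall>u\<in>_. ?J uo \<le> ?J u) \<longleftrightarrow> (AE t in lborel. t \<in> {0..T} \<longrightarrow> (\<forall>\<mu>\<in>M1 U. AE \<omega> in M. ?E t (uo t) \<omega> \<le> ?E t (\<lambda>_. \<mu>) \<omega>))")
proof -
  obtain D where D: "controlled_integrand M G T U (\<lambda>t \<omega>. integrand b \<sigma> ell t (xo t \<omega>, \<psi> t \<omega>, Q t \<omega>)) D"
    using hamiltonian_integrand by blast
  interpret H: controlled_integrand M G T U "\<lambda>t \<omega>. integrand b \<sigma> ell t (xo t \<omega>, \<psi> t \<omega>, Q t \<omega>)" D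
    by (rule D)
  have H_eq: "hamiltonian b \<sigma> ell t (xo t \<omega>) (\<psi> t \<omega>) (Q t \<omega>) \<nu> = H.Hm t \<omega> \<nu>"
    if "t \<in> {0..T}" "\<nu> \<in> M1 U" for t \<omega> \<nu>
    unfolding H.Hm_def by (rule hamiltonian_eq_integral[OF that])
  have J: "?J u = (\<integral>\<omega>. (LINT t:{0..T}|lborel. H.Hm t \<omega> (u t \<omega>)) \<partial>M)"
    if "u \<in> relaxed_controls M G T U" for u
    using that by (intro Bochner_Integration.integral_cong refl set_lebesgue_integral_cong allI impI H_eq)
      (auto simp: relaxed_controls_def)
  have E: "AE \<omega> in M. ?E t k \<omega> = real_cond_exp M (G t) (\<lambda>\<omega>. H.Hm t \<omega> (k \<omega>)) \<omega>"
    if t: "t \<in> {0..T}" and k: "k \<in> measurable M (prob_algebra (restrict_space borel U))" for t k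
  proof -
    interpret sigma_finite_subalgebra M "G t"
      using t by (intro subalgebra_sigma_finite information_M) simp
    have eq: "hamiltonian b \<sigma> ell t (xo t \<omega>) (\<psi> t \<omega>) (Q t \<omega>) (k \<omega>) = H.Hm t \<omega> (k \<omega>)" if "\<omega> \<in> space M" for \<omega>
      using measurable_space[OF k that] by (intro H_eq t) (simp add: M1_def)
    have meas: "(\<lambda>\<omega>. H.Hm t \<omega> (k \<omega>)) \<in> borel_measurable M"
      by (rule H.Hm_section_measurable[OF t k])
    then have "(\<lambda>\<omega>. hamiltonian b \<sigma> ell t (xo t \<omega>) (\<psi> t \<omega>) (Q t \<omega>) (k \<omega>)) \<in> borel_measurable M"
      using eq by (subst measurable_cong) auto
    then show ?thesis
      using eq meas by (intro real_cond_exp_cong AE_I2) auto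
  qed
  have E_iff: "(AE \<omega> in M. ?E t (uo t) \<omega> \<le> ?E t (\<lambda>_. \<mu>) \<omega>) \<longleftrightarrow>
      (AE \<omega> in M. real_cond_exp M (G t) (\<lambda>\<omega>. H.Hm t \<omega> (uo t \<omega>)) \<omega> \<le> real_cond_exp M (G t) (\<lambda>\<omega>. H.Hm t \<omega> \<mu>) \<omega>)"
    if "t \<in> {0..T}" "\<mu> \<in> M1 U" for t \<mu>
  proof -
    from E[OF that(1) H.kernel_section[OF uo that(1)]] E[OF that(1) H.const_kernel[OF that(2)]]
    have "AE \<omega> in M. (?E t (uo t) \<omega> \<le> ?E t (\<lambda>_. \<mu>) \<omega>) \<longleftrightarrow>
      (real_cond_exp M (G t) (\<lambda>\<omega>. H.Hm t \<omega> (uo t \<omega>)) \<omega> \<le> real_cond_exp M (G t) (\<lambda>\<omega>. H.Hm t \<omega> \<mu>) \<omega>)"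
      by eventually_elim simp
    then show ?thesis by (rule eventually_subst)
  qed
  show ?thesis
  proof
    assume "\<forall>u\<in>relaxed_controls M G T U. ?J uo \<le> ?J u"
    then have "AE t in lborel. t \<in> {0..T} \<longrightarrow> (\<forall>\<mu>\<in>M1 U. AE \<omega> in M.
      real_cond_exp M (G t) (\<lambda>\<omega>. H.Hm t \<omega> (uo t \<omega>)) \<omega> \<le> real_cond_exp M (G t) (\<lambda>\<omega>. H.Hm t \<omega> \<mu>) \<omega>)"
      using uo by (intro H.conditional_le_if_cost_le info) (simp_all flip: J)
    then show "AE t in lborel. t \<in> {0..T} \<longrightarrow> (\<forall>\<mu>\<in>M1 U. AE \<omega> in M. ?E t (uo t) \<omega> \<le> ?E t (\<lambda>_. \<mu>) \<omega>)"
      by eventually_elim (simp add: E_iff)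
  next
    assume "AE t in lborel. t \<in> {0..T} \<longrightarrow> (\<forall>\<mu>\<in>M1 U. AE \<omega> in M. ?E t (uo t) \<omega> \<le> ?E t (\<lambda>_. \<mu>) \<omega>)"
    then have le: "AE t in lborel. t \<in> {0..T} \<longrightarrow> (\<forall>\<mu>\<in>M1 U. AE \<omega> in M.
      real_cond_exp M (G t) (\<lambda>\<omega>. H.Hm t \<omega> (uo t \<omega>)) \<omega> \<le> real_cond_exp M (G t) (\<lambda>\<omega>. H.Hm t \<omega> \<mu>) \<omega>)"
      by eventually_elim (simp add: E_iff)
    show "\<forall>u\<in>relaxed_controls M G T U. ?J uo \<le> ?J u"
    proof
      fix u assume u: "u \<in> relaxed_controls M G T U"
      show "?J uo \<le> ?J u"
        unfolding J[OF u] J[OF uo]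
      proof (rule H.cost_le_if_conditional_le[OF uo u le])
        fix t assume t: "t \<in> {0..T}"
        show "\<exists>(Z :: 'w \<Rightarrow> (real^'n) \<times> (real^'n) \<times> (real^'m^'n)) \<gamma>. Z \<in> borel_measurable M \<and>
            (\<forall>\<omega>\<in>space M. \<forall>\<xi>\<in>U. integrand b \<sigma> ell t (xo t \<omega>, \<psi> t \<omega>, Q t \<omega>) \<xi> = \<gamma> (Z \<omega>) \<xi>) \<and>
            (\<forall>z. \<gamma> z \<in> borel_measurable (restrict_space borel U)) \<and> (\<forall>z. \<exists>B. \<forall>\<xi>\<in>U. \<bar>\<gamma> z \<xi>\<bar> \<le> B) \<and>
            (\<forall>z. \<forall>e>0. \<exists>\<delta>>0. \<forall>z'. dist z' z < \<delta> \<longrightarrow> (\<forall>\<xi>\<in>U. \<bar>\<gamma> z' \<xi> - \<gamma> z \<xi>\<bar> < e))"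
          by (intro exI[of _ "\<lambda>\<omega>. (xo t \<omega>, \<psi> t \<omega>, Q t \<omega>)"] exI[of _ "integrand b \<sigma> ell t"] conjI allI impI ballI refl
              process_section_measurable[OF t] integrand_approximation[OF t])
      qed
    qed
  qed
qed

end

end

theorem corollary5p3:
  fixes M :: "'w measure"
    and F G :: "real \<Rightarrow> 'w measure"
    and T :: real
    and W :: "real \<Rightarrow> 'w \<Rightarrow> real^'m"
    and U :: "(real^'d) set"
    and b :: "real \<Rightarrow> real^'n \<Rightarrow> real^'d \<Rightarrow> real^'n"
    and \<sigma> :: "real \<Rightarrow> real^'n \<Rightarrow> real^'d \<Rightarrow> real^'m^'n"
    and ell :: "real \<Rightarrow> real^'n \<Rightarrow> real^'d \<Rightarrow> real"
    and \<Phi> :: "real^'n \<Rightarrow> real"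
    and x0 :: "'w \<Rightarrow> real^'n"
    and uo :: "real \<Rightarrow> 'w \<Rightarrow> (real^'d) measure"
    and xo \<psi> :: "real \<Rightarrow> 'w \<Rightarrow> real^'n"
    and Q :: "real \<Rightarrow> 'w \<Rightarrow> real^'m^'n"
  assumes "partially_observed_control M F G T W U b \<sigma> ell \<Phi> x0"
    and "measurable_information M G T"
    and "uo \<in> relaxed_controls M G T U"
    and "xo \<in> B_infty_a M F T" and "\<psi> \<in> L2_a M F T" and "Q \<in> L2_a M F T"
    and "hamiltonian_system M F T W b \<sigma> ell \<Phi> x0 uo xo \<psi> Q"
  shows
    "(\<forall>u\<in>relaxed_controls M G T U.
        (\<integral>\<omega>. (LINT t:{0..T}|lborel. hamiltonian b \<sigma> ell t (xo t \<omega>) (\<psi> t \<omega>) (Q t \<omega>) (u t \<omega>)) \<partial>M)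
        \<ge> (\<integral>\<omega>. (LINT t:{0..T}|lborel. hamiltonian b \<sigma> ell t (xo t \<omega>) (\<psi> t \<omega>) (Q t \<omega>) (uo t \<omega>)) \<partial>M))
     \<longleftrightarrow>
     (AE t in lborel. t \<in> {0..T} \<longrightarrow> (\<forall>\<mu>\<in>M1 U. AE \<omega> in M.
        real_cond_exp M (G t) (\<lambda>\<omega>. hamiltonian b \<sigma> ell t (xo t \<omega>) (\<psi> t \<omega>) (Q t \<omega>) \<mu>) \<omega>
        \<ge> real_cond_exp M (G t) (\<lambda>\<omega>. hamiltonian b \<sigma> ell t (xo t \<omega>) (\<psi> t \<omega>) (Q t \<omega>) (uo t \<omega>)) \<omega>))"
  by (rule partially_observed_control.hamiltonian_integral_iff_conditional[OF assms(1,4,5,6,2,3)])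

end
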